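(* Let $f\colon R\to R'$ be a map of simplicial rings. If $f$ is a de Rham equivalence, then there is an exact sequence $$0\to HC^-_*(f)\xrightarrow{\;F\;}HH_*(f)\xrightarrow{\;B\;}HH_{*+1}(f)$$ that identifies $HC^-_*(f)$ with $\ker(B)\subset HH_*(f)$.
   Context: For a simplicial ring $R$, $HH_*(R)$ is Hochschild homology (the homotopy groups of the cyclic object $HH(R)$), $HC^-_*(R)$ is negative cyclic homology, $B\colon HH_*(R)\to HH_{*+1}(R)$ is Connes' operator (with $BB=0$), and $F\colon HC^-_*(R)\to HH_*(R)$ is the natural Frobenius (forgetful) map. For a map $f\colon R\to R'$, $HH(f)$ and $HC^-(f)$ denote the homotopy fibers of $HH(R)\to HH(R')$ and $HC^-(R)\to HC^-(R')$, so that there is a long exact sequence $$\cdots\to HH_{*+1}(R')\to HH_*(f)\to HH_*(R)\to HH_*(R')\to\cdots,$$ and similarly for $HC^-$; there is an induced relative operator $B\colon HH_*(f)\to HH_{*+1}(f)$ and an induced map $F\colon HC^-_*(f)\to HH_*(f)$. The de Rham homology $H^{dR}_*(f)=\ker(B)/\operatorname{im}(B)$ is the homology of $HH_*(f)$ with respect to $B$. The map $f$ is a de Rham equivalence if $H^{dR}_*(f)=0$. *)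

theory Defs
  imports "HOL-Algebra.Algebra"
begin

section \<open>Simplicial rings\<close>

text \<open>
  Rings are associative and unital, not necessarily commutative. The operator \<open>face R n i\<close> is
  \<open>d\<^sub>i : R\<^sub>n\<^sub>+\<^sub>1 \<rightarrow> R\<^sub>n\<close> (for \<open>i \<le> n + 1\<close>) and \<open>degen R n i\<close> is
  \<open>s\<^sub>i : R\<^sub>n \<rightarrow> R\<^sub>n\<^sub>+\<^sub>1\<close> (for \<open>i \<le> n\<close>).
  Requiring a common type for the elements of all \<open>R\<^sub>n\<close> is no restriction, since the carriers
  may be taken disjoint inside a sum type.
\<close>

record 'a simplicial_ring =
  level :: "nat \<Rightarrow> 'a ring"
  face :: "nat \<Rightarrow> nat \<Rightarrow> 'a \<Rightarrow> 'a"
  degen :: "nat \<Rightarrow> nat \<Rightarrow> 'a \<Rightarrow> 'a"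

locale simplicial_ring =
  fixes R :: "'a simplicial_ring"
  assumes ring_level: "ring (level R n)"
    and face_hom: "i \<le> Suc n \<Longrightarrow> face R n i \<in> ring_hom (level R (Suc n)) (level R n)"
    and degen_hom: "i \<le> n \<Longrightarrow> degen R n i \<in> ring_hom (level R n) (level R (Suc n))"
    and face_face:
      "\<lbrakk>i < j; j \<le> Suc (Suc n); x \<in> carrier (level R (Suc (Suc n)))\<rbrakk>
        \<Longrightarrow> face R n i (face R (Suc n) j x) = face R n (j - 1) (face R (Suc n) i x)"
    and degen_degen:
      "\<lbrakk>i \<le> j; j \<le> n; x \<in> carrier (level R n)\<rbrakk>
        \<Longrightarrow> degen R (Suc n) i (degen R n j x) = degen R (Suc n) (Suc j) (degen R n i x)"
    and face_degen_less:
      "\<lbrakk>i < j; j \<le> Suc n; x \<in> carrier (level R (Suc n))\<rbrakk>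
        \<Longrightarrow> face R (Suc n) i (degen R (Suc n) j x) = degen R n (j - 1) (face R n i x)"
    and face_degen_same:
      "\<lbrakk>j \<le> n; x \<in> carrier (level R n)\<rbrakk> \<Longrightarrow> face R n j (degen R n j x) = x"
    and face_degen_Suc:
      "\<lbrakk>j \<le> n; x \<in> carrier (level R n)\<rbrakk> \<Longrightarrow> face R n (Suc j) (degen R n j x) = x"
    and face_degen_greater:
      "\<lbrakk>Suc j < i; i \<le> Suc (Suc n); x \<in> carrier (level R (Suc n))\<rbrakk>
        \<Longrightarrow> face R (Suc n) i (degen R (Suc n) j x) = degen R n j (face R n (i - 1) x)"

locale simplicial_ring_map = source: simplicial_ring R + target: simplicial_ring R'
  for R :: "'a simplicial_ring" and R' :: "'b simplicial_ring" +
  fixes f :: "nat \<Rightarrow> 'a \<Rightarrow> 'b"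
  assumes map_hom: "f n \<in> ring_hom (level R n) (level R' n)"
    and map_face:
      "\<lbrakk>i \<le> Suc n; x \<in> carrier (level R (Suc n))\<rbrakk> \<Longrightarrow> f n (face R n i x) = face R' n i (f (Suc n) x)"
    and map_degen:
      "\<lbrakk>i \<le> n; x \<in> carrier (level R n)\<rbrakk> \<Longrightarrow> f (Suc n) (degen R n i x) = degen R' n i (f n x)"


section \<open>Chain complexes, mixed complexes and homotopy fibers\<close>

text \<open>
  The map \<open>G / N \<rightarrow> H / M\<close> induced by \<open>h\<close>; it depends only on the target, since
  elements of a quotient group are cosets. It is meaningful when \<open>h\<close> is a homomorphism
  sending \<open>N\<close> into \<open>M\<close>.
\<close>

definition induced_map ::
  "('d, 'm) monoid_scheme \<Rightarrow> 'd set \<Rightarrow> ('c \<Rightarrow> 'd) \<Rightarrow> 'c set \<Rightarrow> 'd set" where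
  "induced_map H M h Y = the_elem ((\<lambda>y. M #>\<^bsub>H\<^esub> h y) ` Y)"

text \<open>
  Complexes are graded by all integers, with \<open>diff C n : C\<^sub>n \<rightarrow> C\<^sub>n\<^sub>-\<^sub>1\<close>, and abelian groups are
  written multiplicatively. The operator of a mixed complex is \<open>conn C n : C\<^sub>n \<rightarrow> C\<^sub>n\<^sub>+\<^sub>1\<close>.
\<close>

record 'c chain_complex =
  grp :: "int \<Rightarrow> 'c monoid"
  diff :: "int \<Rightarrow> 'c \<Rightarrow> 'c"

record 'c mixed_complex = "'c chain_complex" +
  conn :: "int \<Rightarrow> 'c \<Rightarrow> 'c"

definition cycles :: "('c, 'm) chain_complex_scheme \<Rightarrow> int \<Rightarrow> 'c monoid" where
  "cycles C n = (grp C n)\<lparr>carrier := kernel (grp C n) (grp C (n - 1)) (diff C n)\<rparr>"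

definition boundaries :: "('c, 'm) chain_complex_scheme \<Rightarrow> int \<Rightarrow> 'c set" where
  "boundaries C n = diff C (n + 1) ` carrier (grp C (n + 1))"

definition homology :: "('c, 'm) chain_complex_scheme \<Rightarrow> int \<Rightarrow> 'c set monoid" where
  "homology C n = cycles C n Mod boundaries C n"

definition homology_map ::
  "('d, 'm) chain_complex_scheme \<Rightarrow> int \<Rightarrow> ('c \<Rightarrow> 'd) \<Rightarrow> 'c set \<Rightarrow> 'd set" where
  "homology_map D n h = induced_map (cycles D n) (boundaries D n) h"

text \<open>
  Homotopy fiber of a chain map \<open>\<phi> : C \<rightarrow> D\<close>: in degree \<open>n\<close> it is \<open>C\<^sub>n \<times> D\<^sub>n\<^sub>+\<^sub>1\<close>, with
  differential \<open>(x, y) \<mapsto> (d x, \<phi> x - d y)\<close>.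
\<close>

definition fiber ::
  "('c, 'm) chain_complex_scheme \<Rightarrow> ('d, 'n) chain_complex_scheme \<Rightarrow> (int \<Rightarrow> 'c \<Rightarrow> 'd)
    \<Rightarrow> ('c \<times> 'd) chain_complex" where
  "fiber C D \<phi> =
    \<lparr>grp = (\<lambda>n. grp C n \<times>\<times> grp D (n + 1)),
     diff = (\<lambda>n (x, y). (diff C n x, \<phi> n x \<otimes>\<^bsub>grp D n\<^esub> inv\<^bsub>grp D n\<^esub> diff D (n + 1) y))\<rparr>"

text \<open>
  With the sign \<open>(x, y) \<mapsto> (B x, - B y)\<close> the operator anticommutes with the differential of
  the fiber.
\<close>

definition fiber_conn ::
  "('c, 'm) mixed_complex_scheme \<Rightarrow> ('d, 'n) mixed_complex_scheme \<Rightarrow> int \<Rightarrow> 'c \<times> 'd \<Rightarrow> 'c \<times> 'd" where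
  "fiber_conn C D n = (\<lambda>(x, y). (conn C n x, inv\<^bsub>grp D (n + 2)\<^esub> conn D (n + 1) y))"

text \<open>
  Negative cyclic complex: the product total complex of power series \<open>\<Sum> x\<^sub>k u\<^sup>k\<close>, with \<open>u\<close> of
  degree \<open>-2\<close>, \<open>k \<ge> 0\<close>, and differential \<open>b + u B\<close>.
\<close>

definition neg_cyclic :: "('c, 'm) mixed_complex_scheme \<Rightarrow> (nat \<Rightarrow> 'c) chain_complex" where
  "neg_cyclic C =
    \<lparr>grp = (\<lambda>n. product_group UNIV (\<lambda>k. grp C (n + 2 * int k))),
     diff = (\<lambda>n x k.
       case k of
         0 \<Rightarrow> diff C n (x 0)
       | Suc j \<Rightarrow> diff C (n + 2 * int k) (x k)
           \<otimes>\<^bsub>grp C (n - 1 + 2 * int k)\<^esub> conn C (n + 2 * int j) (x j))\<rparr>"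

definition neg_cyclic_map :: "(int \<Rightarrow> 'c \<Rightarrow> 'd) \<Rightarrow> int \<Rightarrow> (nat \<Rightarrow> 'c) \<Rightarrow> nat \<Rightarrow> 'd" where
  "neg_cyclic_map \<phi> n x = (\<lambda>k. \<phi> (n + 2 * int k) (x k))"


section \<open>Tensor powers\<close>

text \<open>
  The tensor power \<open>S\<^sup>\<otimes>\<^sup>m\<close> over the integers is the free abelian group on words of length
  \<open>m\<close> in \<open>S\<close> modulo additivity in each letter; this suffices for multilinearity over the
  integers.
\<close>

definition tensor_words :: "'a ring \<Rightarrow> nat \<Rightarrow> 'a list set" where
  "tensor_words S m = {w. length w = m \<and> set w \<subseteq> carrier S}"

definition tensor_rels :: "'a ring \<Rightarrow> nat \<Rightarrow> ('a list \<Rightarrow>\<^sub>0 int) set" where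
  "tensor_rels S m = generate (free_Abelian_group (tensor_words S m))
    {frag_of (v @ (a \<oplus>\<^bsub>S\<^esub> c) # w) - frag_of (v @ a # w) - frag_of (v @ c # w) | v a c w.
      v @ a # w \<in> tensor_words S m \<and> c \<in> carrier S}"

definition tensor_power :: "'a ring \<Rightarrow> nat \<Rightarrow> ('a list \<Rightarrow>\<^sub>0 int) set monoid" where
  "tensor_power S m = free_Abelian_group (tensor_words S m) Mod tensor_rels S m"

text \<open>The homomorphism into \<open>S\<^sup>\<otimes>\<^sup>m\<close> given on elementary tensors by \<open>\<phi>\<close>.\<close>

definition tensor_map ::
  "'b ring \<Rightarrow> nat \<Rightarrow> ('a list \<Rightarrow> 'b list \<Rightarrow>\<^sub>0 int) \<Rightarrow> ('a list \<Rightarrow>\<^sub>0 int) set \<Rightarrow> ('b list \<Rightarrow>\<^sub>0 int) set" where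
  "tensor_map S m \<phi> =
    induced_map (free_Abelian_group (tensor_words S m)) (tensor_rels S m) (frag_extend \<phi>)"


section \<open>The Hochschild mixed complex of a simplicial ring\<close>

text \<open>
  Structure maps of the cyclic object \<open>[p] \<mapsto> S\<^sup>\<otimes>\<^sup>(\<^sup>p\<^sup>+\<^sup>1\<^sup>)\<close> on elementary tensors
  \<open>[a\<^sub>0, \<dots>, a\<^sub>p]\<close>: the faces multiply cyclically adjacent letters, and the cyclic operator
  moves the last letter to the front (the sign is put in below).
\<close>

definition hoch_face :: "'a ring \<Rightarrow> nat \<Rightarrow> 'a list \<Rightarrow> 'a list" where
  "hoch_face S i w =
    (if Suc i < length w then take i w @ (w ! i \<otimes>\<^bsub>S\<^esub> w ! Suc i) # drop (Suc (Suc i)) w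
     else (last w \<otimes>\<^bsub>S\<^esub> hd w) # butlast (tl w))"

definition hoch_cyc :: "'a list \<Rightarrow> 'a list" where
  "hoch_cyc w = last w # butlast w"

definition hoch_b :: "'a ring \<Rightarrow> 'a list \<Rightarrow> 'a list \<Rightarrow>\<^sub>0 int" where
  "hoch_b S w = (\<Sum>i<length w. frag_cmul ((- 1) ^ i) (frag_of (hoch_face S i w)))"

text \<open>
  Connes' operator \<open>(1 - t) s N\<close> on words of length \<open>p + 1\<close>, where \<open>t\<close> is \<open>(- 1)\<^sup>p\<close> times
  the cyclic operator, \<open>N = 1 + t + \<dots> + t\<^sup>p\<close>, and the extra degeneracy \<open>s\<close> prepends the unit.
\<close>

definition hoch_B :: "'a ring \<Rightarrow> 'a list \<Rightarrow> 'a list \<Rightarrow>\<^sub>0 int" where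
  "hoch_B S w = (let p = length w - 1 in
    \<Sum>j\<le>p. frag_cmul ((- 1) ^ (p * j))
      (frag_of (\<one>\<^bsub>S\<^esub> # (hoch_cyc ^^ j) w)
        - frag_cmul ((- 1) ^ Suc p) (frag_of (hoch_cyc (\<one>\<^bsub>S\<^esub> # (hoch_cyc ^^ j) w)))))"

text \<open>
  The differential in the simplicial direction, from simplicial degree \<open>q + 1\<close> to \<open>q\<close>, with
  the sign that makes it anticommute with \<open>hoch_b\<close>.
\<close>

definition simp_d :: "'a simplicial_ring \<Rightarrow> nat \<Rightarrow> 'a list \<Rightarrow> 'a list \<Rightarrow>\<^sub>0 int" where
  "simp_d R q w = (let p = length w - 1 in
    \<Sum>i\<le>Suc q. frag_cmul ((- 1) ^ (p + i)) (frag_of (map (face R q i) w)))"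

text \<open>
  The cyclic simplicial abelian group \<open>HH(R)\<close>, with \<open>R\<^sub>q\<^sup>\<otimes>\<^sup>(\<^sup>p\<^sup>+\<^sup>1\<^sup>)\<close> in bidegree \<open>(p, q)\<close>, is
  represented by its total complex: in degree \<open>n\<close> an element is a family \<open>x\<close> with \<open>x p\<close> in
  bidegree \<open>(p, n - p)\<close>. The groups are trivial for negative \<open>n\<close>.
\<close>

definition HH :: "'a simplicial_ring \<Rightarrow> (nat \<Rightarrow> ('a list \<Rightarrow>\<^sub>0 int) set) mixed_complex" where
  "HH R =
    \<lparr>grp = (\<lambda>n. product_group {p. int p \<le> n}
       (\<lambda>p. tensor_power (level R (nat (n - int p))) (Suc p))),
     diff = (\<lambda>n x. \<lambda>p\<in>{p. int p \<le> n - 1}.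
       let q = nat (n - 1 - int p); S = level R q in
         tensor_map S (Suc p) (hoch_b S) (x (Suc p))
           \<otimes>\<^bsub>tensor_power S (Suc p)\<^esub> tensor_map S (Suc p) (simp_d R q) (x p)),
     conn = (\<lambda>n x. \<lambda>p\<in>{p. int p \<le> n + 1}.
       let S = level R (nat (n + 1 - int p)) in
         case p of
           0 \<Rightarrow> \<one>\<^bsub>tensor_power S 1\<^esub>
         | Suc p' \<Rightarrow> tensor_map S (Suc p) (hoch_B S) (x p'))\<rparr>"

definition HH_map :: "'b simplicial_ring \<Rightarrow> (nat \<Rightarrow> 'a \<Rightarrow> 'b) \<Rightarrow> int
    \<Rightarrow> (nat \<Rightarrow> ('a list \<Rightarrow>\<^sub>0 int) set) \<Rightarrow> nat \<Rightarrow> ('b list \<Rightarrow>\<^sub>0 int) set" where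
  "HH_map R' f n x = (\<lambda>p\<in>{p. int p \<le> n}.
    let q = nat (n - int p) in
      tensor_map (level R' q) (Suc p) (\<lambda>w. frag_of (map (f q) w)) (x p))"


section \<open>Relative invariants of a map of simplicial rings\<close>

type_synonym ('a, 'b) hh_rel =
  "(nat \<Rightarrow> ('a list \<Rightarrow>\<^sub>0 int) set) \<times> (nat \<Rightarrow> ('b list \<Rightarrow>\<^sub>0 int) set)"

type_synonym ('a, 'b) hcm_rel =
  "(nat \<Rightarrow> nat \<Rightarrow> ('a list \<Rightarrow>\<^sub>0 int) set) \<times> (nat \<Rightarrow> nat \<Rightarrow> ('b list \<Rightarrow>\<^sub>0 int) set)"

definition HH_fiber ::
  "'a simplicial_ring \<Rightarrow> 'b simplicial_ring \<Rightarrow> (nat \<Rightarrow> 'a \<Rightarrow> 'b) \<Rightarrow> ('a, 'b) hh_rel chain_complex" where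
  "HH_fiber R R' f = fiber (HH R) (HH R') (HH_map R' f)"

definition HCm_fiber ::
  "'a simplicial_ring \<Rightarrow> 'b simplicial_ring \<Rightarrow> (nat \<Rightarrow> 'a \<Rightarrow> 'b) \<Rightarrow> ('a, 'b) hcm_rel chain_complex" where
  "HCm_fiber R R' f =
    fiber (neg_cyclic (HH R)) (neg_cyclic (HH R')) (neg_cyclic_map (HH_map R' f))"

definition HH_rel ::
  "'a simplicial_ring \<Rightarrow> 'b simplicial_ring \<Rightarrow> (nat \<Rightarrow> 'a \<Rightarrow> 'b) \<Rightarrow> int \<Rightarrow> ('a, 'b) hh_rel set monoid" where
  "HH_rel R R' f n = homology (HH_fiber R R' f) n"

definition HCm_rel ::
  "'a simplicial_ring \<Rightarrow> 'b simplicial_ring \<Rightarrow> (nat \<Rightarrow> 'a \<Rightarrow> 'b) \<Rightarrow> int \<Rightarrow> ('a, 'b) hcm_rel set monoid" where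
  "HCm_rel R R' f n = homology (HCm_fiber R R' f) n"

definition B_rel ::
  "'a simplicial_ring \<Rightarrow> 'b simplicial_ring \<Rightarrow> (nat \<Rightarrow> 'a \<Rightarrow> 'b) \<Rightarrow> int
    \<Rightarrow> ('a, 'b) hh_rel set \<Rightarrow> ('a, 'b) hh_rel set" where
  "B_rel R R' f n = homology_map (HH_fiber R R' f) (n + 1) (fiber_conn (HH R) (HH R') n)"

text \<open>\<open>F\<close> is induced by setting \<open>u = 0\<close> in both components of the fiber.\<close>

definition F_rel ::
  "'a simplicial_ring \<Rightarrow> 'b simplicial_ring \<Rightarrow> (nat \<Rightarrow> 'a \<Rightarrow> 'b) \<Rightarrow> int
    \<Rightarrow> ('a, 'b) hcm_rel set \<Rightarrow> ('a, 'b) hh_rel set" where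
  "F_rel R R' f n = homology_map (HH_fiber R R' f) n (\<lambda>(x, y). (x 0, y 0))"

abbreviation ker_B_rel ::
  "'a simplicial_ring \<Rightarrow> 'b simplicial_ring \<Rightarrow> (nat \<Rightarrow> 'a \<Rightarrow> 'b) \<Rightarrow> int \<Rightarrow> ('a, 'b) hh_rel set set" where
  "ker_B_rel R R' f n \<equiv> kernel (HH_rel R R' f n) (HH_rel R R' f (n + 1)) (B_rel R R' f n)"

definition de_Rham_homology_rel ::
  "'a simplicial_ring \<Rightarrow> 'b simplicial_ring \<Rightarrow> (nat \<Rightarrow> 'a \<Rightarrow> 'b) \<Rightarrow> int
    \<Rightarrow> ('a, 'b) hh_rel set set monoid" where
  "de_Rham_homology_rel R R' f n =
    (HH_rel R R' f n)\<lparr>carrier := ker_B_rel R R' f n\<rparr>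
      Mod (B_rel R R' f (n - 1) ` carrier (HH_rel R R' f (n - 1)))"

definition de_Rham_equivalence ::
  "'a simplicial_ring \<Rightarrow> 'b simplicial_ring \<Rightarrow> (nat \<Rightarrow> 'a \<Rightarrow> 'b) \<Rightarrow> bool" where
  "de_Rham_equivalence R R' f \<longleftrightarrow> (\<forall>n. trivial_group (de_Rham_homology_rel R R' f n))"

end

theory Submission
  imports Defs
begin

text \<open>
  An element of degree \<open>n\<close> in the negative cyclic complex of a mixed complex is a power series
  \<open>x\<^sub>0 + x\<^sub>1 u + x\<^sub>2 u\<^sup>2 + \<dots>\<close>, and it is a cycle for \<open>b + u B\<close> when \<open>b x\<^sub>0 = 0\<close> and
  \<open>b x\<^sub>k\<^sub>+\<^sub>1 = - B x\<^sub>k\<close> for all \<open>k\<close>; the map \<open>F\<close> keeps only \<open>x\<^sub>0\<close>. The equation for \<open>k = 0\<close> puts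
  the image of \<open>F\<close> into the kernel of \<open>B\<close> on homology. Suppose now that homology is exact with
  respect to \<open>B\<close>, which is what vanishing of de Rham homology says.

  \<^item> Surjectivity onto the kernel. If \<open>b x\<^sub>0 = 0\<close> and \<open>B x\<^sub>0 = - b x\<^sub>1\<close>, then \<open>B x\<^sub>1\<close> is a cycle
    whose class is killed by \<open>B\<close>, hence homologous to \<open>B c\<close> for a cycle \<open>c\<close>. Replacing \<open>x\<^sub>1\<close> by
    \<open>x\<^sub>1 - c\<close> keeps the equation for \<open>k = 0\<close> and makes \<open>B x\<^sub>1\<close> a boundary, so that \<open>x\<^sub>2\<close> can be
    chosen, and so on (lemmas \<open>lift_step\<close>, \<open>lift\<close>).

  \<^item> Injectivity. Let \<open>x\<close> be a cycle with \<open>x\<^sub>0 = b z\<^sub>0\<close>. Then \<open>x\<^sub>1 - B z\<^sub>0\<close> is a cycle whose class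
    is killed by \<open>B\<close>; after correcting \<open>z\<^sub>0\<close> by a cycle it becomes a boundary \<open>b z\<^sub>1\<close>, and the
    argument repeats (lemmas \<open>bound_step\<close>, \<open>bound\<close>).

  In both cases infinitely many choices are made. They assemble to one chain because the negative
  cyclic complex is a product rather than a sum.

  The relative theories are homotopy fibers. Taking fibers commutes with passing to power series
  in \<open>u\<close>: the \<open>k\<close>-th coefficient of a chain in the fiber of negative cyclic complexes is a chain
  in the fiber of mixed complexes, and the differentials correspond (lemma
  \<open>coeff_diff_Suc\<close>). So the argument applies to the fiber of the Hochschild complexes
  (theorem \<open>neg_cyclic_fiber_iso_kernel\<close>).

  What remains is that the Hochschild complex of a simplicial ring is a mixed complex, naturally in
  the ring. The identities \<open>b b = 0\<close>, \<open>B B = 0\<close>, \<open>b B + B b = 0\<close> and those involving the simplicial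
  differential hold already for formal sums of words, before additivity in the letters is imposed.
  There they follow from the classical relations between \<open>b\<close>, the bar differential \<open>b'\<close>, the signed
  rotation \<open>t\<close>, the norm \<open>N\<close> and the extra degeneracy \<open>s\<close>:
  \<open>b (1 - t) = (1 - t) b'\<close>, \<open>b' N = N b\<close>, \<open>b' s + s b' = 1\<close>, \<open>N (1 - t) = (1 - t) N = 0\<close>.
  All these operators respect the relations defining the tensor powers, and the identities descend
  by computing with representatives.
\<close>

section \<open>Complexes of abelian groups and mixed complexes\<close>

lemma comm_group_DirProd:
  assumes "comm_group G" "comm_group H"
  shows "comm_group (G \<times>\<times> H)"
proof (rule group.group_comm_groupI)
  show "group (G \<times>\<times> H)" using assms by (simp add: DirProd_group comm_group_def)
qed (use assms in \<open>auto simp: comm_groupE(4)\<close>)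

lemma comm_group_product_group:
  assumes "\<And>i. i \<in> I \<Longrightarrow> comm_group (G i)"
  shows "comm_group (product_group I G)"
proof (rule group.group_comm_groupI)
  show "group (product_group I G)"
    using assms by (auto simp: comm_group_def)
  fix x y assume "x \<in> carrier (product_group I G)" "y \<in> carrier (product_group I G)"
  then show "x \<otimes>\<^bsub>product_group I G\<^esub> y = y \<otimes>\<^bsub>product_group I G\<^esub> x"
    using assms by (auto intro!: restrict_ext comm_groupE(4))
qed

text \<open>
  The hypotheses make all values \<open>h y\<close> for \<open>y\<close> in one coset of \<open>N\<close> lie in one coset of \<open>M\<close>, so the
  image whose only element the definition selects is indeed a singleton.
\<close>

lemma induced_map_coset:
  assumes h: "h \<in> hom G H" and N: "N \<lhd> G" and M: "M \<lhd> H" and NM: "h ` N \<subseteq> M"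
    and x: "x \<in> carrier G"
  shows "induced_map H M h (N #>\<^bsub>G\<^esub> x) = M #>\<^bsub>H\<^esub> h x"
proof -
  interpret N: normal N G by fact
  interpret M: normal M H by fact
  have "M #>\<^bsub>H\<^esub> h y = M #>\<^bsub>H\<^esub> h x" if y: "y \<in> N #>\<^bsub>G\<^esub> x" for y
  proof -
    obtain k where k: "k \<in> N" "y = k \<otimes>\<^bsub>G\<^esub> x" using y unfolding r_coset_def by blast
    then have "h y = h k \<otimes>\<^bsub>H\<^esub> h x" "h k \<in> M"
      using hom_mult[OF h] x NM by auto
    moreover have "h x \<in> carrier H" using h x by (auto simp: hom_def)
    ultimately show ?thesis
      using M.coset_mult_assoc[OF M.subset, of "h k" "h x"] M.rcos_const[OF M.is_group, of "h k"] M.subset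
      by auto
  qed
  moreover have "x \<in> N #>\<^bsub>G\<^esub> x" using x N.rcos_self N.is_subgroup by blast
  ultimately show ?thesis
    unfolding induced_map_def by (intro the_elem_image_unique) blast+
qed

definition homology_class :: "('c, 'm) chain_complex_scheme \<Rightarrow> int \<Rightarrow> 'c \<Rightarrow> 'c set" where
  "homology_class C n x = boundaries C n #>\<^bsub>cycles C n\<^esub> x"

text \<open>
  The derived rules below take the neighbouring degrees as separate variables with a side equation:
  degrees are integer expressions such as \<open>n - 1 + 1\<close>, which would otherwise have to match
  syntactically.
\<close>

locale group_complex =
  fixes C :: "('c, 'm) chain_complex_scheme"
  assumes comm: "comm_group (grp C n)"
    and diff_in_hom: "diff C n \<in> hom (grp C n) (grp C (n - 1))"
    and diff_diff': "x \<in> carrier (grp C (n + 1)) \<Longrightarrow> diff C n (diff C (n + 1) x) = \<one>\<^bsub>grp C (n - 1)\<^esub>"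
begin

lemma grp: "group (grp C n)"
  using comm by (simp add: comm_group_def)

lemma diff_hom: "m = n - 1 \<Longrightarrow> diff C n \<in> hom (grp C n) (grp C m)"
  using diff_in_hom by simp

lemma diff_closed: "x \<in> carrier (grp C n) \<Longrightarrow> m = n - 1 \<Longrightarrow> diff C n x \<in> carrier (grp C m)"
  by (rule hom_in_carrier[OF diff_hom])

lemma diff_mult:
  "x \<in> carrier (grp C n) \<Longrightarrow> y \<in> carrier (grp C n) \<Longrightarrow> m = n - 1 \<Longrightarrow>
    diff C n (x \<otimes>\<^bsub>grp C n\<^esub> y) = diff C n x \<otimes>\<^bsub>grp C m\<^esub> diff C n y"
  by (rule hom_mult[OF diff_hom])

lemma diff_inv: "x \<in> carrier (grp C n) \<Longrightarrow> m = n - 1 \<Longrightarrow>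
    diff C n (inv\<^bsub>grp C n\<^esub> x) = inv\<^bsub>grp C m\<^esub> diff C n x"
  using group_hom.hom_inv[of "grp C n" "grp C m" "diff C n" x] diff_hom[of m n] grp
  by (simp add: group_hom_def group_hom_axioms_def)

lemma diff_diff: "x \<in> carrier (grp C n) \<Longrightarrow> m = n - 1 \<Longrightarrow> k = n - 2 \<Longrightarrow>
    diff C m (diff C n x) = \<one>\<^bsub>grp C k\<^esub>"
  using diff_diff'[of x "n - 1"] by simp

lemma carrier_cycles: "m = n - 1 \<Longrightarrow> x \<in> carrier (cycles C n) \<longleftrightarrow> x \<in> carrier (grp C n) \<and> diff C n x = \<one>\<^bsub>grp C m\<^esub>"
  by (auto simp: cycles_def kernel_def)

lemma mult_cycles [simp]: "monoid.mult (cycles C n) = monoid.mult (grp C n)" and one_cycles [simp]: "one (cycles C n) = one (grp C n)"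
  by (simp_all add: cycles_def)

lemma subgroup_cycles: "subgroup (carrier (cycles C n)) (grp C n)"
  using group_hom.subgroup_kernel[of "grp C n" "grp C (n - 1)" "diff C n"] diff_in_hom grp
  by (simp add: cycles_def group_hom_def group_hom_axioms_def)

lemma comm_group_cycles: "comm_group (cycles C n)"
proof (rule group.group_comm_groupI)
  show "group (cycles C n)"
    using group.subgroup_imp_group[OF grp subgroup_cycles] by (simp add: cycles_def)
  fix x y assume "x \<in> carrier (cycles C n)" "y \<in> carrier (cycles C n)"
  then show "x \<otimes>\<^bsub>cycles C n\<^esub> y = y \<otimes>\<^bsub>cycles C n\<^esub> x"
    using comm_groupE(4)[OF comm, of x n y] by (simp add: carrier_cycles[OF refl])
qed

lemma mem_boundaries: "m = n + 1 \<Longrightarrow> x \<in> boundaries C n \<longleftrightarrow> (\<exists>y \<in> carrier (grp C m). x = diff C m y)"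
  by (auto simp: boundaries_def)

lemma boundaries_subset_cycles: "boundaries C n \<subseteq> carrier (cycles C n)"
  by (auto simp: boundaries_def carrier_cycles[OF refl] diff_closed diff_diff)

lemma subgroup_boundaries: "subgroup (boundaries C n) (cycles C n)"
proof -
  have "subgroup (boundaries C n) (grp C n)"
    unfolding boundaries_def
    using group_hom.img_is_subgroup[of "grp C (n + 1)" "grp C n" "diff C (n + 1)"] grp diff_hom[of n "n + 1"]
    by (simp add: group_hom_def group_hom_axioms_def)
  then show ?thesis
    using group.subgroup_incl[OF grp _ subgroup_cycles boundaries_subset_cycles]
    by (simp add: cycles_def)
qed

lemma one_boundaries: "\<one>\<^bsub>grp C n\<^esub> \<in> boundaries C n"
  using subgroup.one_closed[OF subgroup_boundaries] by simp

lemma normal_boundaries: "boundaries C n \<lhd> cycles C n"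
  using comm_group.normal_iff_subgroup[OF comm_group_cycles] subgroup_boundaries by blast

lemma comm_group_homology: "comm_group (homology C n)"
  unfolding homology_def by (intro comm_group.abelian_FactGroup comm_group_cycles subgroup_boundaries)

lemma carrier_homology: "carrier (homology C n) = homology_class C n ` carrier (cycles C n)"
  by (simp add: homology_def carrier_FactGroup homology_class_def[abs_def])

lemma homology_class_mult:
  "x \<in> carrier (cycles C n) \<Longrightarrow> y \<in> carrier (cycles C n) \<Longrightarrow>
   homology_class C n x \<otimes>\<^bsub>homology C n\<^esub> homology_class C n y = homology_class C n (x \<otimes>\<^bsub>grp C n\<^esub> y)"
  using normal.rcos_sum[OF normal_boundaries, of x n y]
  by (simp add: homology_class_def homology_def)

lemma homology_class_eq_one:
  "x \<in> carrier (cycles C n) \<Longrightarrow> homology_class C n x = \<one>\<^bsub>homology C n\<^esub> \<longleftrightarrow> x \<in> boundaries C n"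
proof
  interpret Z: comm_group "cycles C n" by (rule comm_group_cycles)
  assume x: "x \<in> carrier (cycles C n)" and "homology_class C n x = \<one>\<^bsub>homology C n\<^esub>"
  then show "x \<in> boundaries C n"
    using Z.rcos_self[OF x subgroup_boundaries]
    by (simp add: homology_class_def homology_def)
next
  interpret Z: comm_group "cycles C n" by (rule comm_group_cycles)
  assume "x \<in> boundaries C n"
  then show "homology_class C n x = \<one>\<^bsub>homology C n\<^esub>"
    using subgroup.rcos_const[OF subgroup_boundaries Z.is_group]
    by (simp add: homology_class_def homology_def)
qed

end

lemma
  assumes "group_complex C" "group_complex D" and h: "h \<in> hom (grp C n) (grp D m)"
    and cyc: "\<And>x. x \<in> carrier (cycles C n) \<Longrightarrow> h x \<in> carrier (cycles D m)"
    and bd: "h ` boundaries C n \<subseteq> boundaries D m"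
  shows homology_map_class: "x \<in> carrier (cycles C n) \<Longrightarrow>
      homology_map D m h (homology_class C n x) = homology_class D m (h x)"
    and homology_map_group_hom: "group_hom (homology C n) (homology D m) (homology_map D m h)"
proof -
  interpret C: group_complex C by fact
  interpret D: group_complex D by fact
  have hc: "h \<in> hom (cycles C n) (cycles D m)"
    using cyc h by (intro homI) (auto simp: C.carrier_cycles[OF refl] hom_mult)
  have A: "homology_map D m h (homology_class C n x) = homology_class D m (h x)"
    if "x \<in> carrier (cycles C n)" for x
    unfolding homology_map_def homology_class_def
    by (rule induced_map_coset[OF hc C.normal_boundaries D.normal_boundaries bd that])
  show "x \<in> carrier (cycles C n) \<Longrightarrow> homology_map D m h (homology_class C n x) = homology_class D m (h x)"
    by (rule A)
  have "homology_map D m h \<in> hom (homology C n) (homology D m)"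
  proof (rule homI)
    fix u assume "u \<in> carrier (homology C n)"
    then obtain x where x: "x \<in> carrier (cycles C n)" "u = homology_class C n x"
      by (auto simp: C.carrier_homology)
    then show "homology_map D m h u \<in> carrier (homology D m)"
      using A[OF x(1)] cyc by (simp add: D.carrier_homology)
    fix v assume "v \<in> carrier (homology C n)"
    then obtain y where y: "y \<in> carrier (cycles C n)" "v = homology_class C n y"
      by (auto simp: C.carrier_homology)
    interpret Z: comm_group "cycles C n" by (rule C.comm_group_cycles)
    have xy: "x \<otimes>\<^bsub>grp C n\<^esub> y \<in> carrier (cycles C n)"
      using Z.m_closed[OF x(1) y(1)] by simp
    have "h (x \<otimes>\<^bsub>grp C n\<^esub> y) = h x \<otimes>\<^bsub>grp D m\<^esub> h y"
      using hom_mult[OF h, of x y] x y by (simp add: C.carrier_cycles[OF refl])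
    then show "homology_map D m h (u \<otimes>\<^bsub>homology C n\<^esub> v)
        = homology_map D m h u \<otimes>\<^bsub>homology D m\<^esub> homology_map D m h v"
      using x y A[OF xy] A[OF x(1)] A[OF y(1)] cyc[OF x(1)] cyc[OF y(1)]
      by (simp add: C.homology_class_mult D.homology_class_mult)
  qed
  then show "group_hom (homology C n) (homology D m) (homology_map D m h)"
    using C.comm_group_homology D.comm_group_homology
    by (simp add: group_hom_def group_hom_axioms_def comm_group_def)
qed

text \<open>
  The operator is a parameter separate from the complex, since the operator of a homotopy fiber is
  not a component of the fiber record.
\<close>

locale group_mixed = group_complex C
  for C :: "('c, 'm) chain_complex_scheme" +
  fixes B :: "int \<Rightarrow> 'c \<Rightarrow> 'c"
  assumes B_in_hom: "B n \<in> hom (grp C n) (grp C (n + 1))"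
    and B_B': "x \<in> carrier (grp C n) \<Longrightarrow> B (n + 1) (B n x) = \<one>\<^bsub>grp C (n + 2)\<^esub>"
    and diff_B': "x \<in> carrier (grp C n) \<Longrightarrow>
      diff C (n + 1) (B n x) \<otimes>\<^bsub>grp C n\<^esub> B (n - 1) (diff C n x) = \<one>\<^bsub>grp C n\<^esub>"
begin

lemma B_hom: "m = n + 1 \<Longrightarrow> B n \<in> hom (grp C n) (grp C m)"
  using B_in_hom by simp

lemma B_closed: "x \<in> carrier (grp C n) \<Longrightarrow> m = n + 1 \<Longrightarrow> B n x \<in> carrier (grp C m)"
  by (rule hom_in_carrier[OF B_hom])

lemma B_mult:
  "x \<in> carrier (grp C n) \<Longrightarrow> y \<in> carrier (grp C n) \<Longrightarrow> m = n + 1 \<Longrightarrow>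
    B n (x \<otimes>\<^bsub>grp C n\<^esub> y) = B n x \<otimes>\<^bsub>grp C m\<^esub> B n y"
  by (rule hom_mult[OF B_hom])

lemma B_one: "m = n + 1 \<Longrightarrow> B n \<one>\<^bsub>grp C n\<^esub> = \<one>\<^bsub>grp C m\<^esub>"
  by (rule hom_one[OF B_hom grp grp])

lemma B_inv: "x \<in> carrier (grp C n) \<Longrightarrow> m = n + 1 \<Longrightarrow>
    B n (inv\<^bsub>grp C n\<^esub> x) = inv\<^bsub>grp C m\<^esub> B n x"
  using group_hom.hom_inv[of "grp C n" "grp C m" "B n" x] B_hom[of m n] grp
  by (simp add: group_hom_def group_hom_axioms_def)

lemma B_B: "x \<in> carrier (grp C n) \<Longrightarrow> m = n + 1 \<Longrightarrow> k = n + 2 \<Longrightarrow>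
    B m (B n x) = \<one>\<^bsub>grp C k\<^esub>"
  using B_B'[of x n] by simp

lemma diff_B:
  assumes "x \<in> carrier (grp C n)" "m = n + 1" "k = n - 1"
  shows "diff C m (B n x) = inv\<^bsub>grp C n\<^esub> B k (diff C n x)"
proof -
  interpret comm_group "grp C n" by (rule comm)
  have "diff C m (B n x) \<in> carrier (grp C n)" "B k (diff C n x) \<in> carrier (grp C n)"
    using assms diff_closed[OF B_closed[OF assms(1,2)], of n] B_closed[OF diff_closed[OF assms(1,3)], of n]
    by simp_all
  with diff_B'[OF assms(1)] assms(2,3) show ?thesis by (simp add: inv_equality)
qed

lemma B_cycles: "x \<in> carrier (cycles C n) \<Longrightarrow> m = n + 1 \<Longrightarrow> B n x \<in> carrier (cycles C m)"
  using diff_B[of x n m "n - 1"] B_one[of n "n - 1"] monoid.inv_one[OF group.is_monoid[OF grp], of n]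
    carrier_cycles[of "n - 1" n x] carrier_cycles[of n m "B n x"] B_closed[of x n m]
  by auto

text \<open>Anticommutation gives \<open>B (d y) = d (- B y)\<close>.\<close>

lemma B_boundaries: "B n ` boundaries C n \<subseteq> boundaries C (n + 1)"
proof clarify
  fix x assume "x \<in> boundaries C n"
  then obtain y where y: "y \<in> carrier (grp C (n + 1))" "x = diff C (n + 1) y"
    by (auto simp: boundaries_def)
  interpret G: comm_group "grp C (n + 1)" by (rule comm)
  interpret G2: comm_group "grp C (n + 1 + 1)" by (rule comm)
  have By: "B (n + 1) y \<in> carrier (grp C (n + 1 + 1))" using y by (simp add: B_closed)
  have Bx: "B n x \<in> carrier (grp C (n + 1))" using y by (simp add: B_closed diff_closed)
  have "diff C (n + 1 + 1) (inv\<^bsub>grp C (n + 1 + 1)\<^esub> B (n + 1) y) = B n x"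
    using diff_inv[OF By, of "n + 1"] diff_B[OF y(1) refl, of n] y Bx by simp
  then show "B n x \<in> boundaries C (n + 1)"
    unfolding boundaries_def using G2.inv_closed[OF By] by (metis image_eqI)
qed

lemma homology_B: "x \<in> carrier (cycles C n) \<Longrightarrow>
    homology_map C (n + 1) (B n) (homology_class C n x) = homology_class C (n + 1) (B n x)"
  by (rule homology_map_class[OF group_complex_axioms group_complex_axioms B_in_hom _ B_boundaries])
    (rule B_cycles[OF _ refl])

lemma group_hom_homology_B:
  "group_hom (homology C n) (homology C (n + 1)) (homology_map C (n + 1) (B n))"
  by (rule homology_map_group_hom[OF group_complex_axioms group_complex_axioms B_in_hom _ B_boundaries])
    (rule B_cycles[OF _ refl])

end

section \<open>Mixed complexes that are acyclic for the operator on homology\<close>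

text \<open>
  Exactness of homology with respect to the operator induced by \<open>B\<close>, spelled out for representatives
  because the constructions below choose chains, not classes.
\<close>

locale B_acyclic_mixed = group_mixed +
  assumes acyclic: "\<lbrakk>x \<in> carrier (cycles C n); B n x \<in> boundaries C (n + 1)\<rbrakk> \<Longrightarrow>
    \<exists>y \<in> carrier (cycles C (n - 1)). \<exists>z \<in> carrier (grp C (n + 1)).
      x = B (n - 1) y \<otimes>\<^bsub>grp C n\<^esub> diff C (n + 1) z"

lemma (in group_complex) homology_class_eqD:
  assumes "x \<in> carrier (cycles C n)" "y \<in> carrier (cycles C n)" "homology_class C n x = homology_class C n y"
  shows "\<exists>z \<in> carrier (grp C (n + 1)). x = y \<otimes>\<^bsub>grp C n\<^esub> diff C (n + 1) z"
proof -
  interpret Z: comm_group "cycles C n" by (rule comm_group_cycles)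
  have "x \<in> homology_class C n x"
    unfolding homology_class_def using assms(1) subgroup_boundaries by (rule Z.rcos_self)
  then have "x \<in> boundaries C n #>\<^bsub>cycles C n\<^esub> y"
    unfolding assms(3) unfolding homology_class_def .
  then obtain b where b: "b \<in> boundaries C n" "x = b \<otimes>\<^bsub>grp C n\<^esub> y"
    by (auto simp: r_coset_def)
  then have "x = y \<otimes>\<^bsub>grp C n\<^esub> b"
    using Z.m_comm[of b y] boundaries_subset_cycles assms(2) by auto
  with b(1) show ?thesis by (auto simp: boundaries_def)
qed

text \<open>
  A trivial quotient of the kernel by the image means that every class in the kernel is in the
  image; choosing a cycle for the preimage, equality of the two classes supplies the boundary term.
\<close>

lemma (in group_mixed) B_acyclic_mixedI:
  assumes "\<And>n. trivial_group ((homology C n)\<lparr>carrier :=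
      kernel (homology C n) (homology C (n + 1)) (homology_map C (n + 1) (B n))\<rparr>
    Mod (homology_map C (n - 1 + 1) (B (n - 1)) ` carrier (homology C (n - 1))))"
  shows "B_acyclic_mixed C B"
proof unfold_locales
  fix x n assume x: "x \<in> carrier (cycles C n)" and Bx: "B n x \<in> boundaries C (n + 1)"
  let ?HB = "\<lambda>n. homology_map C (n + 1) (B n)"
  let ?I = "homology_map C (n - 1 + 1) (B (n - 1)) ` carrier (homology C (n - 1))"
  let ?Z = "(homology C n)\<lparr>carrier := kernel (homology C n) (homology C (n + 1)) (?HB n)\<rparr>"
  interpret H: comm_group "homology C n" by (rule comm_group_homology)
  interpret HB: group_hom "homology C (n - 1)" "homology C (n - 1 + 1)" "homology_map C (n - 1 + 1) (B (n - 1))"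
    by (rule group_hom_homology_B)
  let ?u = "homology_class C n x"
  have "B n x \<in> carrier (cycles C (n + 1))" using x by (rule B_cycles) simp
  then have "?HB n ?u = \<one>\<^bsub>homology C (n + 1)\<^esub>"
    using homology_B[OF x] Bx by (simp add: homology_class_eq_one)
  then have u: "?u \<in> carrier ?Z" using x by (simp add: kernel_def carrier_homology)
  have sub: "subgroup ?I (homology C n)"
    using HB.img_is_subgroup by simp
  have one: "\<one>\<^bsub>homology C n\<^esub> \<in> ?I" using sub by (rule subgroup.one_closed)
  have "?I #>\<^bsub>?Z\<^esub> ?u \<in> carrier (?Z Mod ?I)"
    using u by (auto simp: carrier_FactGroup)
  then have "?I #>\<^bsub>?Z\<^esub> ?u = ?I"
    using assms[of n] by (simp add: trivial_group_def)
  moreover have "\<one>\<^bsub>homology C n\<^esub> \<otimes>\<^bsub>homology C n\<^esub> ?u = ?u"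
    using x by (simp add: carrier_homology)
  then have "?u \<in> ?I #>\<^bsub>?Z\<^esub> ?u"
    using one by (force simp: r_coset_def)
  ultimately have "?u \<in> ?I" by simp
  then obtain y where y: "y \<in> carrier (cycles C (n - 1))"
    and "?u = homology_map C (n - 1 + 1) (B (n - 1)) (homology_class C (n - 1) y)"
    by (auto simp: carrier_homology)
  then have "?u = homology_class C n (B (n - 1) y)"
    using homology_B[OF y] by simp
  moreover have "B (n - 1) y \<in> carrier (cycles C n)" using y by (rule B_cycles) simp
  ultimately show "\<exists>y\<in>carrier (cycles C (n - 1)). \<exists>z\<in>carrier (grp C (n + 1)).
     x = B (n - 1) y \<otimes>\<^bsub>grp C n\<^esub> diff C (n + 1) z"
    using homology_class_eqD[OF x] y by blast
qed

context B_acyclic_mixed begin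

lemma acyclicE:
  assumes "x \<in> carrier (cycles C n)" "B n x \<in> boundaries C m" "m = n + 1" "k = n - 1"
  obtains y z where "y \<in> carrier (cycles C k)" "z \<in> carrier (grp C m)"
    "x = B k y \<otimes>\<^bsub>grp C n\<^esub> diff C m z"
  using acyclic[of x n] assms by auto

text \<open>
  One coefficient of the lift. Any \<open>y\<close> with \<open>d y = - B x\<close> has a cycle as \<open>B y\<close>, and exactness allows
  a correction of \<open>y\<close> by a cycle after which \<open>B y\<close> is a boundary, the hypothesis of the next step.
  Only the first coefficient \<open>x\<close> is a cycle; the later ones satisfy just the condition on \<open>B x\<close>.
\<close>

lemma lift_step:
  assumes x: "x \<in> carrier (grp C n)" and Bx: "B n x \<in> boundaries C (n + 1)"
  shows "\<exists>y \<in> carrier (grp C (n + 2)). diff C (n + 2) y \<otimes>\<^bsub>grp C (n + 1)\<^esub> B n x = \<one>\<^bsub>grp C (n + 1)\<^esub>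
    \<and> B (n + 2) y \<in> boundaries C (n + 3)"
proof -
  interpret G1: comm_group "grp C (n + 1)" by (rule comm)
  interpret G2: comm_group "grp C (n + 2)" by (rule comm)
  interpret G3: comm_group "grp C (n + 3)" by (rule comm)
  obtain w where w: "w \<in> carrier (grp C (n + 2))" "B n x = diff C (n + 2) w"
    using Bx mem_boundaries[of "n + 2" "n + 1"] by auto
  let ?y = "inv\<^bsub>grp C (n + 2)\<^esub> w"
  have y: "?y \<in> carrier (grp C (n + 2))" using w by simp
  have Bxc: "B n x \<in> carrier (grp C (n + 1))" by (rule B_closed[OF x refl])
  have dy: "diff C (n + 2) ?y = inv\<^bsub>grp C (n + 1)\<^esub> B n x"
    using diff_inv[OF w(1), of "n + 1"] w(2) by simp
  have Bdy: "B (n + 1) (diff C (n + 2) ?y) = \<one>\<^bsub>grp C (n + 2)\<^esub>"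
    unfolding dy using B_inv[OF Bxc, of "n + 2"] B_B[OF x refl, of "n + 2"] by simp
  have "diff C (n + 3) (B (n + 2) ?y) = \<one>\<^bsub>grp C (n + 2)\<^esub>"
    using diff_B[OF y, of "n + 3" "n + 1"] Bdy by simp
  then have "B (n + 2) ?y \<in> carrier (cycles C (n + 3))"
    using B_closed[OF y, of "n + 3"] by (simp add: carrier_cycles[of "n + 2" "n + 3"])
  moreover have "B (n + 3) (B (n + 2) ?y) \<in> boundaries C (n + 4)"
    using B_B[OF y, of "n + 3" "n + 4"] one_boundaries[of "n + 4"] by simp
  ultimately obtain c z where c: "c \<in> carrier (cycles C (n + 2))" and z: "z \<in> carrier (grp C (n + 4))"
    and eq: "B (n + 2) ?y = B (n + 2) c \<otimes>\<^bsub>grp C (n + 3)\<^esub> diff C (n + 4) z"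
    by (rule acyclicE[where k = "n + 2"]) (simp, simp, rule that)
  have c': "c \<in> carrier (grp C (n + 2))" "diff C (n + 2) c = \<one>\<^bsub>grp C (n + 1)\<^esub>"
    using c by (auto simp: carrier_cycles[of "n + 1" "n + 2"])
  have cl: "B (n + 2) c \<in> carrier (grp C (n + 3))" "diff C (n + 4) z \<in> carrier (grp C (n + 3))"
    using c' z by (auto intro: B_closed diff_closed)
  (* Correcting by the cycle c leaves d y unchanged and removes B c from B y. *)
  let ?y' = "?y \<otimes>\<^bsub>grp C (n + 2)\<^esub> inv\<^bsub>grp C (n + 2)\<^esub> c"
  have ic: "inv\<^bsub>grp C (n + 2)\<^esub> c \<in> carrier (grp C (n + 2))" using c' by simp
  have "diff C (n + 2) ?y' = diff C (n + 2) ?y"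
    using diff_mult[OF y ic, of "n + 1"] diff_inv[OF c'(1), of "n + 1"] c' dy Bxc by simp
  moreover have "B (n + 2) ?y' = diff C (n + 4) z"
    using B_mult[OF y ic, of "n + 3"] B_inv[OF c'(1), of "n + 3"] c' eq cl
      G3.m_comm[OF cl] G3.m_assoc[of "diff C (n + 4) z" "B (n + 2) c" "inv\<^bsub>grp C (n + 3)\<^esub> B (n + 2) c"]
    by simp
  moreover have "?y' \<in> carrier (grp C (n + 2))" using y c' by simp
  ultimately show ?thesis
    using dy Bxc z mem_boundaries[of "n + 4" "n + 3"] by (intro bexI[of _ ?y']) auto
qed

lemma lift:
  assumes x0: "x0 \<in> carrier (cycles C n)" and Bx0: "B n x0 \<in> boundaries C (n + 1)"
  shows "\<exists>x. x 0 = x0 \<and> (\<forall>k. x k \<in> carrier (grp C (n + 2 * int k)) \<and>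
    diff C (n + 2 * int (Suc k)) (x (Suc k)) \<otimes>\<^bsub>grp C (n + 2 * int k + 1)\<^esub> B (n + 2 * int k) (x k)
      = \<one>\<^bsub>grp C (n + 2 * int k + 1)\<^esub>)"
proof -
  let ?P = "\<lambda>k x. x \<in> carrier (grp C (n + 2 * int k)) \<and> B (n + 2 * int k) x \<in> boundaries C (n + 2 * int k + 1)
    \<and> (k = 0 \<longrightarrow> x = x0)"
  let ?Q = "\<lambda>k x y. diff C (n + 2 * int (Suc k)) y \<otimes>\<^bsub>grp C (n + 2 * int k + 1)\<^esub> B (n + 2 * int k) x
      = \<one>\<^bsub>grp C (n + 2 * int k + 1)\<^esub>"
  have "\<exists>x. \<forall>k. ?P k (x k) \<and> ?Q k (x k) (x (Suc k))"
  proof (rule dependent_nat_choice)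
    show "\<exists>x. ?P 0 x"
      using x0 Bx0 by (auto simp: carrier_cycles[OF refl])
    fix x k assume "?P k x"
    then show "\<exists>y. ?P (Suc k) y \<and> ?Q k x y"
      using lift_step[of x "n + 2 * int k"] by (auto simp: algebra_simps)
  qed
  then show ?thesis by blast
qed

text \<open>
  One coefficient of a bounding chain. In the application \<open>a\<close> is what the coefficients found so far
  leave of the current coefficient of the cycle and \<open>x\<close> is the next coefficient. If \<open>a = d w\<close>, then
  \<open>x - B w\<close> is a cycle whose class is killed by \<open>B\<close>; correcting \<open>w\<close> by a cycle turns it into a
  boundary, so that the same situation recurs two degrees higher.
\<close>

lemma bound_step:
  assumes a: "a \<in> boundaries C n" and x: "x \<in> carrier (grp C (n + 2))"
    and dx: "diff C (n + 2) x \<otimes>\<^bsub>grp C (n + 1)\<^esub> B n a = \<one>\<^bsub>grp C (n + 1)\<^esub>"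
    and Bx: "B (n + 2) x \<in> boundaries C (n + 3)"
  shows "\<exists>z \<in> carrier (grp C (n + 1)). diff C (n + 1) z = a \<and>
    x \<otimes>\<^bsub>grp C (n + 2)\<^esub> inv\<^bsub>grp C (n + 2)\<^esub> B (n + 1) z \<in> boundaries C (n + 2)"
proof -
  interpret G0: comm_group "grp C n" by (rule comm)
  interpret G1: comm_group "grp C (n + 1)" by (rule comm)
  interpret G2: comm_group "grp C (n + 2)" by (rule comm)
  interpret G3: comm_group "grp C (n + 3)" by (rule comm)
  obtain w where w: "w \<in> carrier (grp C (n + 1))" "a = diff C (n + 1) w"
    using a mem_boundaries[of "n + 1" n] by auto
  have Bw: "B (n + 1) w \<in> carrier (grp C (n + 2))" using w by (auto intro: B_closed)
  have a': "a \<in> carrier (grp C n)" using w by (simp add: diff_closed)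
  have Ba: "B n a \<in> carrier (grp C (n + 1))" using B_closed[OF a' refl] .
  let ?y = "x \<otimes>\<^bsub>grp C (n + 2)\<^esub> inv\<^bsub>grp C (n + 2)\<^esub> B (n + 1) w"
  have y: "?y \<in> carrier (grp C (n + 2))" using x Bw by simp
  have dBw: "diff C (n + 2) (B (n + 1) w) = inv\<^bsub>grp C (n + 1)\<^esub> B n a"
    using diff_B[OF w(1), of "n + 2" n] w(2) by simp
  have iBw: "inv\<^bsub>grp C (n + 2)\<^esub> B (n + 1) w \<in> carrier (grp C (n + 2))" using Bw by simp
  have "diff C (n + 2) (inv\<^bsub>grp C (n + 2)\<^esub> B (n + 1) w) = B n a"
    using diff_inv[OF Bw, of "n + 1"] Ba dBw by simp
  then have "diff C (n + 2) ?y = \<one>\<^bsub>grp C (n + 1)\<^esub>"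
    using diff_mult[OF x iBw, of "n + 1"] dx by simp
  then have "?y \<in> carrier (cycles C (n + 2))"
    using y by (simp add: carrier_cycles[of "n + 1" "n + 2"])
  moreover have "B (n + 2) ?y \<in> boundaries C (n + 3)"
    using Bx B_mult[OF x iBw, of "n + 3"] B_inv[OF Bw, of "n + 3"] Bw
      B_B[OF w(1), of "n + 2" "n + 3"] B_closed[OF x, of "n + 3"] by simp
  ultimately obtain c v where c: "c \<in> carrier (cycles C (n + 1))" and v: "v \<in> carrier (grp C (n + 3))"
    and eq: "?y = B (n + 1) c \<otimes>\<^bsub>grp C (n + 2)\<^esub> diff C (n + 3) v"
    by (rule acyclicE[where k = "n + 1"]) (simp, simp, rule that)
  have c': "c \<in> carrier (grp C (n + 1))" "diff C (n + 1) c = \<one>\<^bsub>grp C n\<^esub>"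
    using c by (auto simp: carrier_cycles[of "n" "n + 1"])
  have cl: "B (n + 1) c \<in> carrier (grp C (n + 2))" "diff C (n + 3) v \<in> carrier (grp C (n + 2))"
    using c' v by (auto intro: B_closed diff_closed)
  let ?z = "w \<otimes>\<^bsub>grp C (n + 1)\<^esub> c"
  have "diff C (n + 1) ?z = a"
    using diff_mult[OF w(1) c'(1), of n] w a' c' by simp
  moreover have "x \<otimes>\<^bsub>grp C (n + 2)\<^esub> inv\<^bsub>grp C (n + 2)\<^esub> B (n + 1) ?z = diff C (n + 3) v"
  proof -
    have "x \<otimes>\<^bsub>grp C (n + 2)\<^esub> inv\<^bsub>grp C (n + 2)\<^esub> B (n + 1) ?z = ?y \<otimes>\<^bsub>grp C (n + 2)\<^esub> inv\<^bsub>grp C (n + 2)\<^esub> B (n + 1) c"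
      using B_mult[OF w(1) c'(1), of "n + 2"] Bw cl x by (simp add: G2.inv_mult G2.m_assoc)
    also have "\<dots> = diff C (n + 3) v"
      unfolding eq G2.m_comm[OF cl] using cl by (simp add: G2.m_assoc)
    finally show ?thesis .
  qed
  moreover have "?z \<in> carrier (grp C (n + 1))" using w c' by simp
  ultimately show ?thesis
    using v mem_boundaries[of "n + 3" "n + 2"] by (intro bexI[of _ ?z]) auto
qed

lemma bound:
  assumes x: "\<And>k. x k \<in> carrier (grp C (n + 2 * int k))"
    and dx: "\<And>k. diff C (n + 2 * int (Suc k)) (x (Suc k)) \<otimes>\<^bsub>grp C (n + 2 * int k + 1)\<^esub> B (n + 2 * int k) (x k)
      = \<one>\<^bsub>grp C (n + 2 * int k + 1)\<^esub>"
    and x0: "x 0 \<in> boundaries C n"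
  shows "\<exists>z. diff C (n + 1) (z 0) = x 0 \<and> (\<forall>k. z k \<in> carrier (grp C (n + 1 + 2 * int k)) \<and>
    diff C (n + 1 + 2 * int (Suc k)) (z (Suc k)) \<otimes>\<^bsub>grp C (n + 2 * int (Suc k))\<^esub> B (n + 1 + 2 * int k) (z k) = x (Suc k))"
proof -
  (* The cycle condition exhibits B (x k) as the boundary of minus the next coefficient. *)
  have dx': "B N y \<in> boundaries C (N + 1)" if N: "N = n + 2 * int k" "y = x k" for N y k
  proof -
    interpret G: comm_group "grp C (N + 1)" by (rule comm)
    interpret G2: comm_group "grp C (N + 2)" by (rule comm)
    have cl: "B N y \<in> carrier (grp C (N + 1))" "x (Suc k) \<in> carrier (grp C (N + 2))"
      "diff C (N + 2) (x (Suc k)) \<in> carrier (grp C (N + 1))"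
      using x[of k] x[of "Suc k"] N by (auto intro!: B_closed diff_closed simp: algebra_simps)
    have "diff C (N + 2) (x (Suc k)) \<otimes>\<^bsub>grp C (N + 1)\<^esub> B N y = \<one>\<^bsub>grp C (N + 1)\<^esub>"
      using dx[of k] N by (simp add: algebra_simps)
    then have "inv\<^bsub>grp C (N + 1)\<^esub> diff C (N + 2) (x (Suc k)) = B N y"
      using cl G.inv_equality[of "B N y" "diff C (N + 2) (x (Suc k))"] by (simp add: G.m_comm)
    then have "diff C (N + 2) (inv\<^bsub>grp C (N + 2)\<^esub> x (Suc k)) = B N y"
      using diff_inv[OF cl(2), of "N + 1"] by simp
    then show ?thesis
      using mem_boundaries[of "N + 2" "N + 1" "B N y"] G2.inv_closed[OF cl(2)] by (auto intro: bexI[rotated])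
  qed
  let ?P = "\<lambda>k z. z \<in> carrier (grp C (n + 1 + 2 * int k)) \<and> (k = 0 \<longrightarrow> diff C (n + 1) z = x 0) \<and>
     x (Suc k) \<otimes>\<^bsub>grp C (n + 2 * int (Suc k))\<^esub> inv\<^bsub>grp C (n + 2 * int (Suc k))\<^esub> B (n + 1 + 2 * int k) z
       \<in> boundaries C (n + 2 * int (Suc k))"
  let ?Q = "\<lambda>k z z'. diff C (n + 1 + 2 * int (Suc k)) z'
      \<otimes>\<^bsub>grp C (n + 2 * int (Suc k))\<^esub> B (n + 1 + 2 * int k) z = x (Suc k)"
  have "\<exists>z. \<forall>k. ?P k (z k) \<and> ?Q k (z k) (z (Suc k))"
  proof (rule dependent_nat_choice)
    show "\<exists>z. ?P 0 z"
      using bound_step[OF x0, of "x 1"] x[of 1] dx[of 0] dx'[of "n + 2" 1 "x 1"] by (auto simp: algebra_simps)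
    fix z k assume z: "?P k z"
    define N where "N = n + 2 * int (Suc k)"
    interpret G: comm_group "grp C N" by (rule comm)
    interpret G1: comm_group "grp C (N + 1)" by (rule comm)
    have zc: "z \<in> carrier (grp C (N - 1))" using z by (simp add: N_def algebra_simps)
    have xk: "x (Suc k) \<in> carrier (grp C N)" using x[of "Suc k"] by (simp add: N_def)
    have Bz: "B (N - 1) z \<in> carrier (grp C N)" using zc by (simp add: B_closed)
    let ?a = "x (Suc k) \<otimes>\<^bsub>grp C N\<^esub> inv\<^bsub>grp C N\<^esub> B (N - 1) z"
    have a: "?a \<in> boundaries C N" using z by (simp add: N_def algebra_simps)
    have iBz: "inv\<^bsub>grp C N\<^esub> B (N - 1) z \<in> carrier (grp C N)" using Bz by simp
    have "B N ?a = B N (x (Suc k))"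
      using B_mult[OF xk iBz, of "N + 1"] B_inv[OF Bz, of "N + 1"] Bz
        B_B[OF zc, of N "N + 1"] B_closed[OF xk refl] by simp
    then have "diff C (N + 2) (x (Suc (Suc k))) \<otimes>\<^bsub>grp C (N + 1)\<^esub> B N ?a = \<one>\<^bsub>grp C (N + 1)\<^esub>"
      using dx[of "Suc k"] by (simp add: N_def algebra_simps)
    moreover have "x (Suc (Suc k)) \<in> carrier (grp C (N + 2))"
      using x[of "Suc (Suc k)"] by (simp add: N_def algebra_simps)
    moreover have "B (N + 2) (x (Suc (Suc k))) \<in> boundaries C (N + 3)"
      using dx'[of "N + 2" "Suc (Suc k)"] by (simp add: N_def algebra_simps)
    ultimately obtain z' where z': "z' \<in> carrier (grp C (N + 1))" "diff C (N + 1) z' = ?a"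
      "x (Suc (Suc k)) \<otimes>\<^bsub>grp C (N + 2)\<^esub> inv\<^bsub>grp C (N + 2)\<^esub> B (N + 1) z' \<in> boundaries C (N + 2)"
      using bound_step[OF a] by blast
    have "diff C (N + 1) z' \<otimes>\<^bsub>grp C N\<^esub> B (N - 1) z = x (Suc k)"
      unfolding z'(2) using xk Bz by (simp add: G.m_assoc)
    with z' show "\<exists>z'. ?P (Suc k) z' \<and> ?Q k z z'"
      by (intro exI[of _ z']) (simp add: N_def algebra_simps)
  qed
  then show ?thesis by blast
qed

end

section \<open>Homotopy fibers\<close>

locale complex_map = C: group_complex C + D: group_complex D
  for C :: "('c, 'm) chain_complex_scheme" and D :: "('d, 'n) chain_complex_scheme" +
  fixes \<phi> :: "int \<Rightarrow> 'c \<Rightarrow> 'd"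
  assumes \<phi>_hom: "\<phi> n \<in> hom (grp C n) (grp D n)"
    and \<phi>_diff: "x \<in> carrier (grp C n) \<Longrightarrow> diff D n (\<phi> n x) = \<phi> (n - 1) (diff C n x)"
begin

lemma \<phi>_closed: "x \<in> carrier (grp C n) \<Longrightarrow> \<phi> n x \<in> carrier (grp D n)"
  by (rule hom_in_carrier[OF \<phi>_hom])

lemma \<phi>_one: "\<phi> n \<one>\<^bsub>grp C n\<^esub> = \<one>\<^bsub>grp D n\<^esub>"
  by (rule hom_one[OF \<phi>_hom C.grp D.grp])

lemma grp_fiber: "grp (fiber C D \<phi>) n = grp C n \<times>\<times> grp D (n + 1)"
  by (simp add: fiber_def)

lemma grp_fiber_Suc: "grp (fiber C D \<phi>) (n + 1) = grp C (n + 1) \<times>\<times> grp D (n + 2)"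
proof -
  have "n + 1 + 1 = n + 2" by simp
  then show ?thesis unfolding grp_fiber by (rule arg_cong)
qed

lemma diff_fiber: "diff (fiber C D \<phi>) n (x, y) =
    (diff C n x, \<phi> n x \<otimes>\<^bsub>grp D n\<^esub> inv\<^bsub>grp D n\<^esub> diff D (n + 1) y)"
  by (simp add: fiber_def)

lemma diff_fiber_Suc: "diff (fiber C D \<phi>) (n + 1) (x, y) =
    (diff C (n + 1) x, \<phi> (n + 1) x \<otimes>\<^bsub>grp D (n + 1)\<^esub> inv\<^bsub>grp D (n + 1)\<^esub> diff D (n + 2) y)"
proof -
  have "n + 1 + 1 = n + 2" by simp
  then show ?thesis unfolding diff_fiber by (rule arg_cong)
qed

lemma group_complex_fiber: "group_complex (fiber C D \<phi>)"
proof (rule group_complex.intro)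
  fix n
  show "comm_group (grp (fiber C D \<phi>) n)"
    by (simp add: grp_fiber comm_group_DirProd C.comm D.comm)
  interpret Dn: comm_group "grp D n" by (rule D.comm)
  show "diff (fiber C D \<phi>) n \<in> hom (grp (fiber C D \<phi>) n) (grp (fiber C D \<phi>) (n - 1))"
  proof (rule homI)
    fix u v assume "u \<in> carrier (grp (fiber C D \<phi>) n)" "v \<in> carrier (grp (fiber C D \<phi>) n)"
    then obtain x y x' y' where u: "u = (x, y)" "x \<in> carrier (grp C n)" "y \<in> carrier (grp D (n + 1))"
      and v: "v = (x', y')" "x' \<in> carrier (grp C n)" "y' \<in> carrier (grp D (n + 1))"
      by (auto simp: grp_fiber)
    have cl: "\<phi> n x \<in> carrier (grp D n)" "\<phi> n x' \<in> carrier (grp D n)"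
       "diff D (n + 1) y \<in> carrier (grp D n)" "diff D (n + 1) y' \<in> carrier (grp D n)"
      using u v by (simp_all add: \<phi>_closed D.diff_closed)
    show "diff (fiber C D \<phi>) n u \<in> carrier (grp (fiber C D \<phi>) (n - 1))"
      using u cl by (simp add: diff_fiber grp_fiber C.diff_closed)
    show "diff (fiber C D \<phi>) n (u \<otimes>\<^bsub>grp (fiber C D \<phi>) n\<^esub> v) =
      diff (fiber C D \<phi>) n u \<otimes>\<^bsub>grp (fiber C D \<phi>) (n - 1)\<^esub> diff (fiber C D \<phi>) n v"
      using u v cl C.diff_mult[of x n x' "n - 1"] D.diff_mult[of y "n + 1" y' n] hom_mult[OF \<phi>_hom, of x n x']
      by (simp add: diff_fiber grp_fiber Dn.m_ac Dn.inv_mult)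
  qed
next
  fix n u assume "u \<in> carrier (grp (fiber C D \<phi>) (n + 1))"
  then obtain x y where u: "u = (x, y)" "x \<in> carrier (grp C (n + 1))" "y \<in> carrier (grp D (n + 2))"
    by (auto simp: grp_fiber_Suc)
  interpret Dn: comm_group "grp D n" by (rule D.comm)
  interpret Dn1: comm_group "grp D (n + 1)" by (rule D.comm)
  have cl: "\<phi> (n + 1) x \<in> carrier (grp D (n + 1))" "diff D (n + 2) y \<in> carrier (grp D (n + 1))"
    using u by (simp_all add: \<phi>_closed D.diff_closed)
  have cl2: "\<phi> n (diff C (n + 1) x) \<in> carrier (grp D n)"
    using u by (simp add: \<phi>_closed C.diff_closed)
  have "diff D (n + 1) (inv\<^bsub>grp D (n + 1)\<^esub> diff D (n + 2) y) = \<one>\<^bsub>grp D n\<^esub>"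
    using D.diff_inv[OF cl(2), of n] D.diff_diff[OF u(3), of "n + 1" n] by simp
  then have "diff D (n + 1) (\<phi> (n + 1) x \<otimes>\<^bsub>grp D (n + 1)\<^esub> inv\<^bsub>grp D (n + 1)\<^esub> diff D (n + 2) y)
    = \<phi> n (diff C (n + 1) x)"
    using D.diff_mult[OF cl(1) Dn1.inv_closed[OF cl(2)], of n] \<phi>_diff[OF u(2)] cl2 by simp
  then show "diff (fiber C D \<phi>) n (diff (fiber C D \<phi>) (n + 1) u) = \<one>\<^bsub>grp (fiber C D \<phi>) (n - 1)\<^esub>"
    unfolding u(1) diff_fiber_Suc using cl2 C.diff_diff'[OF u(2)] by (simp add: diff_fiber grp_fiber)
qed

end

locale mixed_map = complex_map C D \<phi> + C: group_mixed C "conn C" + D: group_mixed D "conn D"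
  for C :: "('c, 'm) mixed_complex_scheme" and D :: "('d, 'n) mixed_complex_scheme"
    and \<phi> :: "int \<Rightarrow> 'c \<Rightarrow> 'd" +
  assumes \<phi>_conn: "x \<in> carrier (grp C n) \<Longrightarrow> conn D n (\<phi> n x) = \<phi> (n + 1) (conn C n x)"
begin

lemma fiber_conn_Pair: "fiber_conn C D n (x, y) = (conn C n x, inv\<^bsub>grp D (n + 2)\<^esub> conn D (n + 1) y)"
  by (simp add: fiber_conn_def)

lemma fiber_conn_pred: "fiber_conn C D (n - 1) (x, y) = (conn C (n - 1) x, inv\<^bsub>grp D (n + 1)\<^esub> conn D n y)"
proof -
  have "n - 1 + 2 = n + 1" "n - 1 + 1 = n" by simp_all
  then show ?thesis by (simp only: fiber_conn_Pair)
qed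

text \<open>
  The sign in the second component of the operator is what makes it anticommute with the
  differential: the two occurrences of \<open>\<phi> (B x) = B (\<phi> x)\<close> cancel only because of it.
\<close>

lemma group_mixed_fiber: "group_mixed (fiber C D \<phi>) (fiber_conn C D)"
proof (rule group_mixed.intro[OF group_complex_fiber], unfold_locales)
  fix n
  interpret D2: comm_group "grp D (n + 2)" by (rule D.comm)
  show "fiber_conn C D n \<in> hom (grp (fiber C D \<phi>) n) (grp (fiber C D \<phi>) (n + 1))"
  proof (rule homI)
    fix u v assume "u \<in> carrier (grp (fiber C D \<phi>) n)" "v \<in> carrier (grp (fiber C D \<phi>) n)"
    then obtain x y x' y' where u: "u = (x, y)" "x \<in> carrier (grp C n)" "y \<in> carrier (grp D (n + 1))"
      and v: "v = (x', y')" "x' \<in> carrier (grp C n)" "y' \<in> carrier (grp D (n + 1))"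
      by (auto simp: grp_fiber)
    have cl: "conn D (n + 1) y \<in> carrier (grp D (n + 2))" "conn D (n + 1) y' \<in> carrier (grp D (n + 2))"
      using u v by (simp_all add: D.B_closed)
    show "fiber_conn C D n u \<in> carrier (grp (fiber C D \<phi>) (n + 1))"
      unfolding grp_fiber_Suc using u cl by (simp add: fiber_conn_Pair C.B_closed)
    show "fiber_conn C D n (u \<otimes>\<^bsub>grp (fiber C D \<phi>) n\<^esub> v) =
      fiber_conn C D n u \<otimes>\<^bsub>grp (fiber C D \<phi>) (n + 1)\<^esub> fiber_conn C D n v"
      unfolding grp_fiber_Suc using u v cl C.B_mult[of x n x' "n + 1"] D.B_mult[of y "n + 1" y' "n + 2"]
      by (simp add: fiber_conn_Pair grp_fiber D2.inv_mult)
  qed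
next
  fix n u assume "u \<in> carrier (grp (fiber C D \<phi>) n)"
  then obtain x y where u: "u = (x, y)" "x \<in> carrier (grp C n)" "y \<in> carrier (grp D (n + 1))"
    by (auto simp: grp_fiber)
  interpret D0: comm_group "grp D n" by (rule D.comm)
  interpret D1: comm_group "grp D (n + 1)" by (rule D.comm)
  interpret D2: comm_group "grp D (n + 2)" by (rule D.comm)
  interpret D3: comm_group "grp D (n + 3)" by (rule D.comm)
  have By: "conn D (n + 1) y \<in> carrier (grp D (n + 2))" using u by (simp add: D.B_closed)
  have "conn D (n + 2) (inv\<^bsub>grp D (n + 2)\<^esub> conn D (n + 1) y) = \<one>\<^bsub>grp D (n + 3)\<^esub>"
    using D.B_inv[OF By, of "n + 3"] D.B_B[OF u(3), of "n + 2" "n + 3"] by simp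
  then show "fiber_conn C D (n + 1) (fiber_conn C D n u) = \<one>\<^bsub>grp (fiber C D \<phi>) (n + 2)\<^esub>"
    using u C.B_B'[OF u(2)] by (simp add: fiber_conn_Pair grp_fiber add.commute)
  have dy: "diff D (n + 1) y \<in> carrier (grp D n)" using u by (simp add: D.diff_closed)
  have Bdy: "conn D n (diff D (n + 1) y) \<in> carrier (grp D (n + 1))" using dy by (simp add: D.B_closed)
  have "diff D (n + 2) (inv\<^bsub>grp D (n + 2)\<^esub> conn D (n + 1) y) = conn D n (diff D (n + 1) y)"
    using D.diff_inv[OF By, of "n + 1"] D.diff_B[OF u(3), of "n + 2" n] Bdy by simp
  moreover have x: "\<phi> n x \<in> carrier (grp D n)" "\<phi> (n + 1) (conn C n x) \<in> carrier (grp D (n + 1))"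
    using u by (simp_all add: \<phi>_closed C.B_closed)
  moreover have "conn D n (\<phi> n x \<otimes>\<^bsub>grp D n\<^esub> inv\<^bsub>grp D n\<^esub> diff D (n + 1) y) =
     \<phi> (n + 1) (conn C n x) \<otimes>\<^bsub>grp D (n + 1)\<^esub> inv\<^bsub>grp D (n + 1)\<^esub> conn D n (diff D (n + 1) y)"
    using D.B_mult[OF x(1) D0.inv_closed[OF dy], of "n + 1"] D.B_inv[OF dy, of "n + 1"] \<phi>_conn[OF u(2)] by simp
  ultimately show "diff (fiber C D \<phi>) (n + 1) (fiber_conn C D n u) \<otimes>\<^bsub>grp (fiber C D \<phi>) n\<^esub>
      fiber_conn C D (n - 1) (diff (fiber C D \<phi>) n u) = \<one>\<^bsub>grp (fiber C D \<phi>) n\<^esub>"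
    unfolding u(1) diff_fiber unfolding fiber_conn_pred unfolding fiber_conn_Pair unfolding diff_fiber_Suc
    using C.diff_B'[OF u(2)] Bdy by (simp add: grp_fiber)
qed

end

section \<open>The negative cyclic complex\<close>

lemma index_shift: "n - 1 + 2 * int (Suc k) = n + 2 * int k + 1" for n :: int
  by simp

text \<open>
  The power series construction applies to a mixed complex whose operator is the one in its record.
\<close>

locale record_mixed = group_mixed C "conn C" for C :: "('c, 'm) mixed_complex_scheme"
begin

lemma grp_neg: "grp (neg_cyclic C) n = product_group UNIV (\<lambda>k. grp C (n + 2 * int k))"
  by (simp add: neg_cyclic_def)

lemma carrier_neg: "x \<in> carrier (grp (neg_cyclic C) n) \<longleftrightarrow> (\<forall>k. x k \<in> carrier (grp C (n + 2 * int k)))"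
  by (auto simp: grp_neg)

lemma one_neg: "\<one>\<^bsub>grp (neg_cyclic C) n\<^esub> k = \<one>\<^bsub>grp C (n + 2 * int k)\<^esub>"
  by (simp add: grp_neg)

lemma mult_neg: "(x \<otimes>\<^bsub>grp (neg_cyclic C) n\<^esub> y) k = x k \<otimes>\<^bsub>grp C (n + 2 * int k)\<^esub> y k"
  by (simp add: grp_neg)

lemma inv_neg: "x \<in> carrier (grp (neg_cyclic C) n) \<Longrightarrow>
    (inv\<^bsub>grp (neg_cyclic C) n\<^esub> x) k = inv\<^bsub>grp C (n + 2 * int k)\<^esub> x k"
  by (simp add: grp_neg grp)

lemma diff_neg_0: "diff (neg_cyclic C) n x 0 = diff C n (x 0)"
  by (simp add: neg_cyclic_def)

lemma diff_neg_Suc: "diff (neg_cyclic C) n x (Suc j) = diff C (n + 2 * int (Suc j)) (x (Suc j))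
   \<otimes>\<^bsub>grp C (n + 2 * int j + 1)\<^esub> conn C (n + 2 * int j) (x j)"
  by (simp add: neg_cyclic_def add.commute)

lemma diff_neg_terms_closed:
  assumes "x \<in> carrier (grp (neg_cyclic C) n)"
  shows "diff C (n + 2 * int (Suc k)) (x (Suc k)) \<in> carrier (grp C (n + 2 * int k + 1))"
    "conn C (n + 2 * int k) (x k) \<in> carrier (grp C (n + 2 * int k + 1))"
  using assms diff_closed[of "x (Suc k)" "n + 2 * int (Suc k)" "n + 2 * int k + 1"]
    B_closed[of "x k" "n + 2 * int k" "n + 2 * int k + 1"] unfolding carrier_neg by (auto simp del: of_nat_Suc) simp_all

text \<open>
  In the coefficient of \<open>u\<^sup>k\<close>, the square of \<open>b + u B\<close> consists of \<open>b b\<close>, \<open>b B + B b\<close> and \<open>B B\<close>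
  applied to three consecutive coefficients. The last is absent for \<open>k = 1\<close> and only the first is
  present for \<open>k = 0\<close>, whence the case distinctions.
\<close>

lemma group_complex_neg: "group_complex (neg_cyclic C)"
proof (rule group_complex.intro)
  fix n
  show "comm_group (grp (neg_cyclic C) n)"
    by (simp add: grp_neg comm_group_product_group comm)
  show "diff (neg_cyclic C) n \<in> hom (grp (neg_cyclic C) n) (grp (neg_cyclic C) (n - 1))"
  proof (rule homI)
    fix x y assume x: "x \<in> carrier (grp (neg_cyclic C) n)" and y: "y \<in> carrier (grp (neg_cyclic C) n)"
    show "diff (neg_cyclic C) n x \<in> carrier (grp (neg_cyclic C) (n - 1))"
      unfolding carrier_neg
    proof
      fix k
      show "diff (neg_cyclic C) n x k \<in> carrier (grp C (n - 1 + 2 * int k))"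
      proof (cases k)
        case 0
        then show ?thesis using x[unfolded carrier_neg, rule_format, of 0] by (simp add: diff_neg_0 diff_closed)
      next
        case (Suc j)
        interpret G: comm_group "grp C (n + 2 * int j + 1)" by (rule comm)
        show ?thesis
          unfolding Suc index_shift diff_neg_Suc using diff_neg_terms_closed[OF x, of j] by (rule G.m_closed)
      qed
    qed
    show "diff (neg_cyclic C) n (x \<otimes>\<^bsub>grp (neg_cyclic C) n\<^esub> y) =
      diff (neg_cyclic C) n x \<otimes>\<^bsub>grp (neg_cyclic C) (n - 1)\<^esub> diff (neg_cyclic C) n y"
    proof
      fix k
      show "diff (neg_cyclic C) n (x \<otimes>\<^bsub>grp (neg_cyclic C) n\<^esub> y) k =
        (diff (neg_cyclic C) n x \<otimes>\<^bsub>grp (neg_cyclic C) (n - 1)\<^esub> diff (neg_cyclic C) n y) k"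
      proof (cases k)
        case 0
        have "x 0 \<in> carrier (grp C n)" "y 0 \<in> carrier (grp C n)"
          using x[unfolded carrier_neg, rule_format, of 0] y[unfolded carrier_neg, rule_format, of 0] by simp_all
        then show ?thesis using 0 diff_mult[of "x 0" n "y 0" "n - 1"]
          by (simp add: diff_neg_0 mult_neg)
      next
        case (Suc j)
        interpret G: comm_group "grp C (n + 2 * int j + 1)" by (rule comm)
        have d: "diff C (n + 2 * int (Suc j)) (x (Suc j) \<otimes>\<^bsub>grp C (n + 2 * int (Suc j))\<^esub> y (Suc j))
            = diff C (n + 2 * int (Suc j)) (x (Suc j)) \<otimes>\<^bsub>grp C (n + 2 * int j + 1)\<^esub> diff C (n + 2 * int (Suc j)) (y (Suc j))"
          by (rule diff_mult) (use x y in \<open>auto simp: carrier_neg simp del: of_nat_Suc\<close>, simp)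
        have B: "conn C (n + 2 * int j) (x j \<otimes>\<^bsub>grp C (n + 2 * int j)\<^esub> y j)
            = conn C (n + 2 * int j) (x j) \<otimes>\<^bsub>grp C (n + 2 * int j + 1)\<^esub> conn C (n + 2 * int j) (y j)"
          by (rule B_mult) (use x y in \<open>auto simp: carrier_neg\<close>)
        show ?thesis
          unfolding Suc diff_neg_Suc mult_neg index_shift d B
          using diff_neg_terms_closed[OF x, of j] diff_neg_terms_closed[OF y, of j]
          by (simp add: G.m_ac del: of_nat_Suc)
      qed
    qed
  qed
next
  fix n x assume "x \<in> carrier (grp (neg_cyclic C) (n + 1))"
  then have x: "x k \<in> carrier (grp C (n + 1 + 2 * int k))" for k by (simp add: carrier_neg)
  note xn = \<open>x \<in> carrier (grp (neg_cyclic C) (n + 1))\<close>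
  let ?y = "diff (neg_cyclic C) (n + 1) x"
  show "diff (neg_cyclic C) n ?y = \<one>\<^bsub>grp (neg_cyclic C) (n - 1)\<^esub>"
  proof
    fix k
    show "diff (neg_cyclic C) n ?y k = \<one>\<^bsub>grp (neg_cyclic C) (n - 1)\<^esub> k"
    proof (cases k)
      case 0
      have "x 0 \<in> carrier (grp C (n + 1))" using x[of 0] by simp
      then show ?thesis using 0 by (simp add: diff_neg_0 one_neg diff_diff')
    next
      case (Suc j)
      define N where "N = n + 1 + 2 * int j"
      interpret G: comm_group "grp C N" by (rule comm)
      interpret G1: comm_group "grp C (N + 1)" by (rule comm)
      have xj: "x j \<in> carrier (grp C N)" and xk: "x (Suc j) \<in> carrier (grp C (N + 2))"
        using x[of j] x[of "Suc j"] by (simp_all add: N_def algebra_simps)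
      have Bxj: "conn C N (x j) \<in> carrier (grp C (N + 1))" using xj by (simp add: B_closed)
      have dxk: "diff C (N + 2) (x (Suc j)) \<in> carrier (grp C (N + 1))" using xk by (simp add: diff_closed)
      have Bdx: "conn C (N - 1) (diff C N (x j)) \<in> carrier (grp C N)"
        using xj by (simp add: B_closed diff_closed)
      have yk: "?y (Suc j) = diff C (N + 2) (x (Suc j)) \<otimes>\<^bsub>grp C (N + 1)\<^esub> conn C N (x j)"
        by (simp add: diff_neg_Suc N_def add.commute)
      have "diff C (N + 1) (?y (Suc j)) = inv\<^bsub>grp C N\<^esub> conn C (N - 1) (diff C N (x j))"
        unfolding yk
        using diff_mult[OF dxk Bxj, of N] diff_diff[OF xk, of "N + 1" N] diff_B[OF xj, of "N + 1" "N - 1"] Bdx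
        by simp
      moreover have "conn C (N - 1) (?y j) = conn C (N - 1) (diff C N (x j))"
      proof (cases j)
        case 0
        then show ?thesis by (simp add: diff_neg_0 N_def)
      next
        case (Suc i)
        have "x i \<in> carrier (grp C (N - 2))" using x[of i] Suc by (simp add: N_def algebra_simps)
        moreover from this have "conn C (N - 2) (x i) \<in> carrier (grp C (N - 1))" by (simp add: B_closed)
        moreover have "?y j = diff C N (x j) \<otimes>\<^bsub>grp C (N - 1)\<^esub> conn C (N - 2) (x i)"
          unfolding Suc diff_neg_Suc by (simp add: Suc N_def ac_simps)
        ultimately show ?thesis
          using B_mult[of "diff C N (x j)" "N - 1" "conn C (N - 2) (x i)" N] xj Bdx
            B_B[of "x i" "N - 2" "N - 1" N] by (simp add: diff_closed)
      qed
      moreover have "diff (neg_cyclic C) n ?y k = diff C (N + 1) (?y (Suc j)) \<otimes>\<^bsub>grp C N\<^esub> conn C (N - 1) (?y j)"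
        unfolding Suc diff_neg_Suc by (simp add: N_def algebra_simps)
      ultimately have "diff (neg_cyclic C) n ?y k = \<one>\<^bsub>grp C N\<^esub>"
        using Bdx by simp
      then show ?thesis unfolding one_neg Suc index_shift by (simp add: N_def algebra_simps)
    qed
  qed
qed

end

context mixed_map begin

sublocale C: record_mixed C by unfold_locales
sublocale D: record_mixed D by unfold_locales

lemma complex_map_neg: "complex_map (neg_cyclic C) (neg_cyclic D) (neg_cyclic_map \<phi>)"
proof (intro complex_map.intro C.group_complex_neg D.group_complex_neg complex_map_axioms.intro)
  fix n
  show "neg_cyclic_map \<phi> n \<in> hom (grp (neg_cyclic C) n) (grp (neg_cyclic D) n)"
    by (intro homI)
      (auto simp: C.carrier_neg D.carrier_neg neg_cyclic_map_def C.mult_neg D.mult_neg \<phi>_closed hom_mult[OF \<phi>_hom])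
  fix x assume x: "x \<in> carrier (grp (neg_cyclic C) n)"
  show "diff (neg_cyclic D) n (neg_cyclic_map \<phi> n x) = neg_cyclic_map \<phi> (n - 1) (diff (neg_cyclic C) n x)"
  proof
    fix k
    show "diff (neg_cyclic D) n (neg_cyclic_map \<phi> n x) k = neg_cyclic_map \<phi> (n - 1) (diff (neg_cyclic C) n x) k"
    proof (cases k)
      case 0
      then show ?thesis
        using x[unfolded C.carrier_neg, rule_format, of 0]
        by (simp add: D.diff_neg_0 C.diff_neg_0 neg_cyclic_map_def \<phi>_diff)
    next
      case (Suc j)
      have d: "diff D (n + 2 * int (Suc j)) (\<phi> (n + 2 * int (Suc j)) (x (Suc j))) =
         \<phi> (n + 2 * int j + 1) (diff C (n + 2 * int (Suc j)) (x (Suc j)))"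
        using \<phi>_diff[of "x (Suc j)" "n + 2 * int (Suc j)"] x[unfolded C.carrier_neg, rule_format, of "Suc j"]
        by (simp add: algebra_simps)
      have B: "conn D (n + 2 * int j) (\<phi> (n + 2 * int j) (x j)) = \<phi> (n + 2 * int j + 1) (conn C (n + 2 * int j) (x j))"
        using x by (intro \<phi>_conn) (simp add: C.carrier_neg)
      show ?thesis
        unfolding Suc neg_cyclic_map_def C.diff_neg_Suc D.diff_neg_Suc index_shift d B
        by (rule hom_mult[OF \<phi>_hom, symmetric]) (rule C.diff_neg_terms_closed[OF x])+
    qed
  qed
qed

end

section \<open>The negative cyclic complex of a fiber\<close>

text \<open>
  A chain of the fiber of negative cyclic complexes, seen as a power series with coefficients in the
  fiber of the underlying mixed complexes.
\<close>

definition fiber_coeff :: "nat \<Rightarrow> (nat \<Rightarrow> 'c) \<times> (nat \<Rightarrow> 'd) \<Rightarrow> 'c \<times> 'd" where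
  "fiber_coeff k = (\<lambda>(x, y). (x k, y k))"

lemma fiber_coeff_eqI: "(\<And>k. fiber_coeff k u = fiber_coeff k v) \<Longrightarrow> u = v"
  by (cases u; cases v) (auto simp: fiber_coeff_def)

lemma fiber_coeff_surj: "\<exists>u. \<forall>k. fiber_coeff k u = m k"
  by (rule exI[of _ "(\<lambda>k. fst (m k), \<lambda>k. snd (m k))"]) (simp add: fiber_coeff_def)

context mixed_map begin

abbreviation "K \<equiv> fiber (neg_cyclic C) (neg_cyclic D) (neg_cyclic_map \<phi>)"
abbreviation "L \<equiv> fiber C D \<phi>"

sublocale L: group_mixed L "fiber_conn C D" by (rule group_mixed_fiber)
sublocale K: group_complex K by (rule complex_map.group_complex_fiber[OF complex_map_neg])

lemma grp_K: "grp K n = grp (neg_cyclic C) n \<times>\<times> grp (neg_cyclic D) (n + 1)"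
  by (rule complex_map.grp_fiber[OF complex_map_neg])

lemma swap_index: "n + 1 + 2 * int k = n + 2 * int k + 1" by simp

lemma carrier_K: "u \<in> carrier (grp K n) \<longleftrightarrow> (\<forall>k. fiber_coeff k u \<in> carrier (grp L (n + 2 * int k)))"
  by (cases u) (auto simp: grp_K C.carrier_neg D.carrier_neg grp_fiber fiber_coeff_def swap_index)

lemma coeff_one: "fiber_coeff k \<one>\<^bsub>grp K n\<^esub> = \<one>\<^bsub>grp L (n + 2 * int k)\<^esub>"
  by (simp add: grp_K C.one_neg D.one_neg grp_fiber fiber_coeff_def swap_index)

lemma coeff_mult: "fiber_coeff k (u \<otimes>\<^bsub>grp K n\<^esub> v)
    = fiber_coeff k u \<otimes>\<^bsub>grp L (n + 2 * int k)\<^esub> fiber_coeff k v"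
  by (cases u; cases v) (simp add: grp_K C.mult_neg D.mult_neg grp_fiber fiber_coeff_def swap_index)

lemma coeff_hom: "fiber_coeff 0 \<in> hom (grp K n) (grp L n)"
  by (rule homI) (use coeff_mult[of 0] in \<open>auto simp: carrier_K dest: spec[of _ 0]\<close>)

lemma diff_K: "diff K n (x, y) = (diff (neg_cyclic C) n x,
    neg_cyclic_map \<phi> n x \<otimes>\<^bsub>grp (neg_cyclic D) n\<^esub> inv\<^bsub>grp (neg_cyclic D) n\<^esub> diff (neg_cyclic D) (n + 1) y)"
  by (rule complex_map.diff_fiber[OF complex_map_neg])

lemma coeff_snd_diff_K:
  assumes "(x, y) \<in> carrier (grp K n)"
  shows "snd (diff K n (x, y)) k = \<phi> (n + 2 * int k) (x k)
    \<otimes>\<^bsub>grp D (n + 2 * int k)\<^esub> inv\<^bsub>grp D (n + 2 * int k)\<^esub> diff (neg_cyclic D) (n + 1) y k"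
proof -
  have "y \<in> carrier (grp (neg_cyclic D) (n + 1))" using assms by (simp add: grp_K)
  then have "diff (neg_cyclic D) (n + 1) y \<in> carrier (grp (neg_cyclic D) n)"
    by (rule group_complex.diff_closed[OF D.group_complex_neg]) simp
  then show ?thesis by (simp add: diff_K D.mult_neg D.inv_neg neg_cyclic_map_def)
qed

lemma coeff_diff_0:
  assumes "u \<in> carrier (grp K n)"
  shows "fiber_coeff 0 (diff K n u) = diff L n (fiber_coeff 0 u)"
proof (cases u)
  case (Pair x y)
  show ?thesis
    using coeff_snd_diff_K[of x y n 0] assms
    by (simp add: Pair fiber_coeff_def split_beta diff_fiber D.diff_neg_0) (simp add: diff_K C.diff_neg_0)
qed

text \<open>
  Under this identification the differential of the fiber is again \<open>b + u B\<close>, with \<open>b\<close> and \<open>B\<close> those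
  of the fiber; here the two sign conventions of the fiber have to agree.
\<close>

lemma coeff_diff_Suc:
  assumes u: "u \<in> carrier (grp K n)"
  shows "fiber_coeff (Suc k) (diff K n u) = diff L (n + 2 * int (Suc k)) (fiber_coeff (Suc k) u)
    \<otimes>\<^bsub>grp L (n + 2 * int k + 1)\<^esub> fiber_conn C D (n + 2 * int k) (fiber_coeff k u)"
proof (cases u)
  case (Pair x y)
  define N where "N = n + 2 * int k"
  have N: "n + 2 * int k = N" "n + 2 * int (Suc k) = N + 2" "n + 1 + 2 * int k = N + 1"
    "n + 1 + 2 * int (Suc k) = N + 3" "N + 1 + 1 = N + 2" "N + 2 + 1 = N + 3"
    by (simp_all add: N_def)
  interpret D2: comm_group "grp D (N + 2)" by (rule D.comm)
  have x: "x \<in> carrier (grp (neg_cyclic C) n)" and y: "y \<in> carrier (grp (neg_cyclic D) (n + 1))"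
    using u by (auto simp: Pair grp_K)
  have xk: "x (Suc k) \<in> carrier (grp C (N + 2))" and yk: "y (Suc k) \<in> carrier (grp D (N + 3))"
    and yj: "y k \<in> carrier (grp D (N + 1))"
    using x y unfolding C.carrier_neg D.carrier_neg by (metis N)+
  have cl: "\<phi> (N + 2) (x (Suc k)) \<in> carrier (grp D (N + 2))" "diff D (N + 3) (y (Suc k)) \<in> carrier (grp D (N + 2))"
    "conn D (N + 1) (y k) \<in> carrier (grp D (N + 2))"
    using xk yk yj by (simp_all add: \<phi>_closed D.diff_closed D.B_closed)
  have 1: "fst (diff K n u) (Suc k)
    = diff C (N + 2) (x (Suc k)) \<otimes>\<^bsub>grp C (N + 1)\<^esub> conn C N (x k)"
    by (simp add: Pair diff_K C.diff_neg_Suc N_def ac_simps)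
  have dy: "diff (neg_cyclic D) (n + 1) y (Suc k) = diff D (N + 3) (y (Suc k)) \<otimes>\<^bsub>grp D (N + 2)\<^esub> conn D (N + 1) (y k)"
    unfolding D.diff_neg_Suc N ..
  have "snd (diff K n u) (Suc k) = \<phi> (N + 2) (x (Suc k)) \<otimes>\<^bsub>grp D (N + 2)\<^esub>
     inv\<^bsub>grp D (N + 2)\<^esub> (diff D (N + 3) (y (Suc k)) \<otimes>\<^bsub>grp D (N + 2)\<^esub> conn D (N + 1) (y k))"
    using coeff_snd_diff_K[of x y n "Suc k"] u unfolding Pair dy N by blast
  also have "\<dots> = (\<phi> (N + 2) (x (Suc k)) \<otimes>\<^bsub>grp D (N + 2)\<^esub> inv\<^bsub>grp D (N + 2)\<^esub> diff D (N + 3) (y (Suc k)))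
     \<otimes>\<^bsub>grp D (N + 2)\<^esub> inv\<^bsub>grp D (N + 2)\<^esub> conn D (N + 1) (y k)"
    using cl by (simp add: D2.inv_mult D2.m_assoc)
  finally have 2: "snd (diff K n u) (Suc k) = \<dots>" .
  have "fiber_coeff (Suc k) (diff K n u) = (fst (diff K n u) (Suc k), snd (diff K n u) (Suc k))"
    by (simp add: fiber_coeff_def split_beta)
  also have "\<dots> = diff L (N + 2) (x (Suc k), y (Suc k)) \<otimes>\<^bsub>grp L (N + 1)\<^esub> fiber_conn C D N (x k, y k)"
    unfolding 1 2 diff_fiber fiber_conn_Pair grp_fiber_Suc mult_DirProd N ..
  finally show ?thesis unfolding N by (simp add: Pair fiber_coeff_def)
qed

lemma cycles_K:
  "u \<in> carrier (cycles K n) \<longleftrightarrow> u \<in> carrier (grp K n) \<and> fiber_coeff 0 u \<in> carrier (cycles L n) \<and>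
    (\<forall>k. diff L (n + 2 * int (Suc k)) (fiber_coeff (Suc k) u)
      \<otimes>\<^bsub>grp L (n + 2 * int k + 1)\<^esub> fiber_conn C D (n + 2 * int k) (fiber_coeff k u) = \<one>\<^bsub>grp L (n + 2 * int k + 1)\<^esub>)"
proof (cases "u \<in> carrier (grp K n)")
  case u: True
  have all_nat_split: "(\<forall>k. P k) \<longleftrightarrow> P 0 \<and> (\<forall>k. P (Suc k))" for P
    by (metis not0_implies_Suc)
  have "diff K n u = \<one>\<^bsub>grp K (n - 1)\<^esub> \<longleftrightarrow> (\<forall>k. fiber_coeff k (diff K n u) = \<one>\<^bsub>grp L (n - 1 + 2 * int k)\<^esub>)"
    by (metis coeff_one fiber_coeff_eqI)
  also have "\<dots> \<longleftrightarrow> fiber_coeff 0 (diff K n u) = \<one>\<^bsub>grp L (n - 1)\<^esub> \<and>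
     (\<forall>k. fiber_coeff (Suc k) (diff K n u) = \<one>\<^bsub>grp L (n - 1 + 2 * int (Suc k))\<^esub>)"
    by (subst all_nat_split) simp
  finally show ?thesis
    using u coeff_hom[of n] unfolding index_shift coeff_diff_0[OF u] coeff_diff_Suc[OF u]
    by (auto simp: K.carrier_cycles[OF refl] L.carrier_cycles[OF refl] dest: hom_in_carrier)
qed (simp add: K.carrier_cycles[OF refl])

lemma boundaries_K: "fiber_coeff 0 ` boundaries K n \<subseteq> boundaries L n"
proof (rule image_subsetI)
  fix u assume "u \<in> boundaries K n"
  then obtain v where v: "v \<in> carrier (grp K (n + 1))" "u = diff K (n + 1) v"
    by (auto simp: boundaries_def)
  then show "fiber_coeff 0 u \<in> boundaries L n"
    using coeff_diff_0[OF v(1)] hom_in_carrier[OF coeff_hom v(1)] by (auto simp: boundaries_def)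
qed

lemma coeff_cycles: "u \<in> carrier (cycles K n) \<Longrightarrow> fiber_coeff 0 u \<in> carrier (cycles L n)"
  by (simp add: cycles_K)

lemma F_class: "u \<in> carrier (cycles K n) \<Longrightarrow>
    homology_map L n (fiber_coeff 0) (homology_class K n u) = homology_class L n (fiber_coeff 0 u)"
  by (rule homology_map_class[OF K.group_complex_axioms L.group_complex_axioms coeff_hom _ boundaries_K])
    (rule coeff_cycles)

lemma F_group_hom: "group_hom (homology K n) (homology L n) (homology_map L n (fiber_coeff 0))"
  by (rule homology_map_group_hom[OF K.group_complex_axioms L.group_complex_axioms coeff_hom _ boundaries_K])
    (rule coeff_cycles)

end

text \<open>
  Lifting gives surjectivity onto the kernel and bounding gives injectivity; the coefficient
  description turns the sequences produced there into chains of the fiber.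
\<close>

theorem (in mixed_map) neg_cyclic_fiber_iso_kernel:
  fixes n :: int
  assumes "B_acyclic_mixed (fiber C D \<phi>) (fiber_conn C D)"
  defines "F \<equiv> homology_map L n (fiber_coeff 0)"
    and "HB \<equiv> homology_map L (n + 1) (fiber_conn C D n)"
  shows "inj_on F (carrier (homology K n))"
    and "F ` carrier (homology K n) = kernel (homology L n) (homology L (n + 1)) HB"
proof -
  interpret A: B_acyclic_mixed L "fiber_conn C D" by fact
  interpret F: group_hom "homology K n" "homology L n" F unfolding F_def by (rule F_group_hom)
  have one_iff: "HB (homology_class L n x) = \<one>\<^bsub>homology L (n + 1)\<^esub> \<longleftrightarrow> fiber_conn C D n x \<in> boundaries L (n + 1)"
    if "x \<in> carrier (cycles L n)" for x
    unfolding HB_def L.homology_B[OF that]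
    by (rule L.homology_class_eq_one) (rule L.B_cycles[OF that refl])
  show "F ` carrier (homology K n) = kernel (homology L n) (homology L (n + 1)) HB"
  proof (intro equalityI subsetI)
    fix a assume "a \<in> F ` carrier (homology K n)"
    then obtain u where u: "u \<in> carrier (cycles K n)" and a: "a = homology_class L n (fiber_coeff 0 u)"
      using F_class by (auto simp: K.carrier_homology F_def)
    have u0: "fiber_coeff 0 u \<in> carrier (cycles L n)" and uK: "u \<in> carrier (grp K n)"
      using u by (auto simp: cycles_K)
    have u1: "fiber_coeff 1 u \<in> carrier (grp L (n + 2))"
      using uK[unfolded carrier_K, rule_format, of 1] by simp
    interpret L1: comm_group "grp L (n + 1)" by (rule L.comm)
    interpret L2: comm_group "grp L (n + 2)" by (rule L.comm)
    have cl: "diff L (n + 2) (fiber_coeff 1 u) \<in> carrier (grp L (n + 1))"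
      "fiber_conn C D n (fiber_coeff 0 u) \<in> carrier (grp L (n + 1))"
      using u1 u0 by (auto intro: L.diff_closed L.B_closed simp: L.carrier_cycles[OF refl])
    have "diff L (n + 2) (fiber_coeff 1 u) \<otimes>\<^bsub>grp L (n + 1)\<^esub> fiber_conn C D n (fiber_coeff 0 u) = \<one>\<^bsub>grp L (n + 1)\<^esub>"
      using u[unfolded cycles_K, THEN conjunct2, THEN conjunct2, rule_format, of 0] by simp
    then have "inv\<^bsub>grp L (n + 1)\<^esub> diff L (n + 2) (fiber_coeff 1 u) = fiber_conn C D n (fiber_coeff 0 u)"
      using cl L1.inv_equality[of "fiber_conn C D n (fiber_coeff 0 u)" "diff L (n + 2) (fiber_coeff 1 u)"]
      by (simp add: L1.m_comm)
    then have "diff L (n + 2) (inv\<^bsub>grp L (n + 2)\<^esub> fiber_coeff 1 u) = fiber_conn C D n (fiber_coeff 0 u)"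
      using L.diff_inv[OF u1, of "n + 1"] by simp
    then have "fiber_conn C D n (fiber_coeff 0 u) \<in> boundaries L (n + 1)"
      using L.mem_boundaries[of "n + 2" "n + 1" "fiber_conn C D n (fiber_coeff 0 u)"] L2.inv_closed[OF u1]
      by (auto intro: bexI[rotated])
    then show "a \<in> kernel (homology L n) (homology L (n + 1)) HB"
      using one_iff[OF u0] u0 by (simp add: kernel_def a L.carrier_homology)
  next
    fix a assume "a \<in> kernel (homology L n) (homology L (n + 1)) HB"
    then obtain x0 where x0: "x0 \<in> carrier (cycles L n)" and a: "a = homology_class L n x0"
      and "fiber_conn C D n x0 \<in> boundaries L (n + 1)"
      using one_iff by (auto simp: kernel_def L.carrier_homology)
    from A.lift[OF x0 this(3)] obtain x where x: "x 0 = x0"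
      "\<And>k. x k \<in> carrier (grp L (n + 2 * int k))"
      "\<And>k. diff L (n + 2 * int (Suc k)) (x (Suc k)) \<otimes>\<^bsub>grp L (n + 2 * int k + 1)\<^esub> fiber_conn C D (n + 2 * int k) (x k)
      = \<one>\<^bsub>grp L (n + 2 * int k + 1)\<^esub>"
      by blast
    obtain u where u: "\<And>k. fiber_coeff k u = x k" using fiber_coeff_surj by metis
    have "u \<in> carrier (cycles K n)"
      unfolding cycles_K carrier_K u using x x0 by blast
    moreover from this have "F (homology_class K n u) = a"
      using F_class[of u n] by (simp add: F_def u x(1) a)
    ultimately show "a \<in> F ` carrier (homology K n)"
      by (auto simp: K.carrier_homology)
  qed
  show "inj_on F (carrier (homology K n))"
    unfolding F.inj_on_one_iff
  proof (intro allI impI)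
    fix a assume "a \<in> carrier (homology K n)" and Fa: "F a = \<one>\<^bsub>homology L n\<^esub>"
    then obtain u where u: "u \<in> carrier (cycles K n)" and a: "a = homology_class K n u"
      by (auto simp: K.carrier_homology)
    have uK: "u \<in> carrier (grp K n)" and u0: "fiber_coeff 0 u \<in> carrier (cycles L n)"
      using u by (auto simp: cycles_K)
    have "fiber_coeff 0 u \<in> boundaries L n"
      using Fa F_class[OF u] L.homology_class_eq_one[OF u0] by (simp add: a F_def)
    from A.bound[of "\<lambda>k. fiber_coeff k u" n, OF _ _ this] u
    obtain z where z: "diff L (n + 1) (z 0) = fiber_coeff 0 u"
      "\<And>k. z k \<in> carrier (grp L (n + 1 + 2 * int k))"
      "\<And>k. diff L (n + 1 + 2 * int (Suc k)) (z (Suc k)) \<otimes>\<^bsub>grp L (n + 2 * int (Suc k))\<^esub>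
         fiber_conn C D (n + 1 + 2 * int k) (z k) = fiber_coeff (Suc k) u"
      unfolding cycles_K carrier_K by blast
    obtain v where v: "\<And>k. fiber_coeff k v = z k" using fiber_coeff_surj by metis
    have vK: "v \<in> carrier (grp K (n + 1))" unfolding carrier_K v using z(2) by blast
    have "diff K (n + 1) v = u"
    proof (rule fiber_coeff_eqI)
      fix k
      show "fiber_coeff k (diff K (n + 1) v) = fiber_coeff k u"
      proof (cases k)
        case 0
        then show ?thesis using coeff_diff_0[OF vK] by (simp add: v z(1))
      next
        case (Suc j)
        have "n + 1 + 2 * int j + 1 = n + 2 * int (Suc j)" by simp
        then show ?thesis unfolding Suc coeff_diff_Suc[OF vK] v z(3)[symmetric] by (simp only:)
      qed
    qed
    with vK have "u \<in> boundaries K n" by (auto simp: boundaries_def)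
    then show "a = \<one>\<^bsub>homology K n\<^esub>"
      using K.homology_class_eq_one[OF u] a by simp
  qed
qed

section \<open>Words\<close>

text \<open>
  Faces and rotations are handled through their letters: two words of equal length are equal when
  their letters are, which reduces each cyclic identity to a comparison of indices. The wrap-around
  face needs its own clause because its product sits at the front.
\<close>

lemma length_hoch_face: "2 \<le> length w \<Longrightarrow> length (hoch_face S i w) = length w - 1"
  by (auto simp: hoch_face_def min_def)

lemma nth_hoch_face:
  assumes "2 \<le> length w" "j < length w - 1"
  shows "hoch_face S i w ! j =
    (if Suc i < length w then
       if j < i then w ! j else if j = i then w ! i \<otimes>\<^bsub>S\<^esub> w ! Suc i else w ! Suc j
     else if j = 0 then w ! (length w - 1) \<otimes>\<^bsub>S\<^esub> w ! 0 else w ! j)"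
proof -
  have "w \<noteq> []" using assms by auto
  then show ?thesis
    using assms
    by (auto simp: hoch_face_def nth_append nth_Cons' min_def last_conv_nth hd_conv_nth
        nth_butlast nth_tl)
qed

lemma length_hoch_cyc: "w \<noteq> [] \<Longrightarrow> length (hoch_cyc w) = length w"
  by (auto simp: hoch_cyc_def)

lemma nth_hoch_cyc:
  "j < length w \<Longrightarrow> hoch_cyc w ! j = w ! (if j = 0 then length w - 1 else j - 1)"
  by (cases "w = []") (auto simp: hoch_cyc_def nth_Cons' last_conv_nth nth_butlast)

lemma set_hoch_cyc: "w \<noteq> [] \<Longrightarrow> set (hoch_cyc w) = set w"
  by (metis append_butlast_last_id hoch_cyc_def list.set(2) rotate1.simps(2) set_rotate1)

lemma set_nth_subset_iff: "set w \<subseteq> A \<longleftrightarrow> (\<forall>j<length w. w ! j \<in> A)"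
  by (auto simp: set_conv_nth)

lemma hoch_cyc_tensor_words: "w \<in> tensor_words S (Suc p) \<Longrightarrow> hoch_cyc w \<in> tensor_words S (Suc p)"
  unfolding tensor_words_def
  by (metis (mono_tags, lifting) length_greater_0_conv length_hoch_cyc mem_Collect_eq set_hoch_cyc zero_less_Suc)

lemma hoch_cyc_pow_tensor_words:
  "w \<in> tensor_words S (Suc p) \<Longrightarrow> (hoch_cyc ^^ j) w \<in> tensor_words S (Suc p)"
  by (induction j) (auto intro: hoch_cyc_tensor_words)

text \<open>
  The library rotation \<open>rotate1\<close> is a left inverse, and its power by the length is known to be the
  identity.
\<close>

lemma hoch_cyc_pow_length: "(hoch_cyc ^^ length w) w = w"
proof (cases "w = []")
  case False
  have ne: "(hoch_cyc ^^ j) w \<noteq> [] \<and> length ((hoch_cyc ^^ j) w) = length w" for j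
    using False by (induction j) (auto simp: length_hoch_cyc, auto simp: hoch_cyc_def)
  have "(rotate1 ^^ j) ((hoch_cyc ^^ j) w) = w" for j
  proof (induction j)
    case (Suc j)
    have "rotate1 (hoch_cyc v) = v" if "v \<noteq> []" for v :: "'a list"
      using that by (simp add: hoch_cyc_def)
    then have "(rotate1 ^^ Suc j) ((hoch_cyc ^^ Suc j) w) = (rotate1 ^^ j) ((hoch_cyc ^^ j) w)"
      unfolding funpow_Suc_right[of j rotate1] using ne[of j] by simp
    with Suc show ?case by simp
  qed simp
  from this[of "length w"] ne[of "length w"] show ?thesis
    by (metis rotate_def rotate_id mod_self)
qed simp

text \<open>
  Words are built over a ring record without extension fields, so the ring locale is specialised
  accordingly.
\<close>

locale letter_ring = ring S for S :: "'a ring" (structure)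
begin

lemma hoch_face_tensor_words:
  assumes "w \<in> tensor_words S (Suc (Suc p))"
  shows "hoch_face S i w \<in> tensor_words S (Suc p)"
proof -
  have l: "length w = Suc (Suc p)" and c: "\<And>j. j < Suc (Suc p) \<Longrightarrow> w ! j \<in> carrier S"
    using assms by (auto simp: tensor_words_def)
  show ?thesis
    using l c by (auto simp: tensor_words_def set_nth_subset_iff length_hoch_face nth_hoch_face)
qed

lemma hoch_face_face:
  assumes w: "w \<in> tensor_words S (Suc (Suc (Suc p)))" and ij: "i < j" "j < Suc (Suc (Suc p))"
  shows "hoch_face S i (hoch_face S j w) = hoch_face S (j - 1) (hoch_face S i w)"
proof (rule nth_equalityI)
  have l: "length w = Suc (Suc (Suc p))"
    and c: "\<And>j. j < Suc (Suc (Suc p)) \<Longrightarrow> w ! j \<in> carrier S"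
    using w by (auto simp: tensor_words_def)
  show "length (hoch_face S i (hoch_face S j w)) = length (hoch_face S (j - 1) (hoch_face S i w))"
    using l by (simp add: length_hoch_face)
  fix k assume "k < length (hoch_face S i (hoch_face S j w))"
  then have k: "k < Suc p" using l by (simp add: length_hoch_face)
  obtain j' where j': "j = Suc j'" using ij by (cases j) auto
  show "hoch_face S i (hoch_face S j w) ! k = hoch_face S (j - 1) (hoch_face S i w) ! k"
  proof (cases "j' = Suc p")
    case True
    then show ?thesis
      using l k ij c
      by (cases "k = 0"; cases "i = 0"; cases "p = 0"; cases "i = Suc p")
        (auto simp: j' length_hoch_face nth_hoch_face m_assoc, auto simp: less_Suc_eq)
  next
    case False
    then have "j' < Suc p" using ij j' by simp
    then show ?thesis
      using l k ij c
      by (cases "k < j'"; cases "k = j'"; cases "k = i"; cases "k < i"; cases "i = j'")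
        (simp_all add: j' length_hoch_face nth_hoch_face m_assoc)
  qed
qed

end

lemma hoch_face_cyc:
  assumes "w \<in> tensor_words S (Suc (Suc p))" "0 < i" "i < Suc (Suc p)"
  shows "hoch_face S i (hoch_cyc w) = hoch_cyc (hoch_face S (i - 1) w)"
proof -
  have l: "length w = Suc (Suc p)" and ne: "w \<noteq> []"
    using assms by (auto simp: tensor_words_def)
  have ne': "hoch_face S i w \<noteq> []" for i using length_hoch_face[of w S i] l by fastforce
  show ?thesis
    by (rule nth_equalityI)
      (use l ne ne' assms(2,3) in \<open>auto simp: length_hoch_face nth_hoch_face length_hoch_cyc nth_hoch_cyc\<close>)
qed

lemma hoch_face_0_cyc:
  assumes "w \<in> tensor_words S (Suc (Suc p))"
  shows "hoch_face S 0 (hoch_cyc w) = hoch_face S (Suc p) w"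
proof -
  have l: "length w = Suc (Suc p)" and ne: "w \<noteq> []"
    using assms by (auto simp: tensor_words_def)
  show ?thesis
    by (rule nth_equalityI)
      (use l ne in \<open>auto simp: length_hoch_face nth_hoch_face length_hoch_cyc nth_hoch_cyc\<close>)
qed

lemma hoch_face_cyc_pow_le:
  assumes "w \<in> tensor_words S (Suc (Suc p))" "j \<le> i" "i < Suc (Suc p)"
  shows "hoch_face S i ((hoch_cyc ^^ j) w) = (hoch_cyc ^^ j) (hoch_face S (i - j) w)"
  using assms(2,3)
proof (induction j arbitrary: i)
  case (Suc j)
  have "hoch_face S i ((hoch_cyc ^^ Suc j) w) = hoch_cyc (hoch_face S (i - 1) ((hoch_cyc ^^ j) w))"
    using Suc.prems hoch_face_cyc[OF hoch_cyc_pow_tensor_words[OF assms(1)], of i] by simp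
  also have "\<dots> = (hoch_cyc ^^ Suc j) (hoch_face S (i - Suc j) w)"
    using Suc.prems Suc.IH[of "i - 1"] by simp
  finally show ?case .
qed simp

text \<open>
  The face is carried through the first \<open>i\<close> rotations until it is the face \<open>0\<close>; one more rotation
  turns it into the last face, which then passes the remaining rotations. That one rotation is
  absorbed, so the exponent drops by one.
\<close>

lemma hoch_face_cyc_pow_gt:
  assumes w: "w \<in> tensor_words S (Suc (Suc p))" and "i < j" "j \<le> Suc p"
  shows "hoch_face S i ((hoch_cyc ^^ j) w) = (hoch_cyc ^^ (j - 1)) (hoch_face S (Suc (Suc p) + i - j) w)"
proof -
  obtain m where m: "j = i + Suc m" using \<open>i < j\<close> by (metis add_Suc_right less_iff_Suc_add)
  have "(hoch_cyc ^^ j) w = (hoch_cyc ^^ i) (hoch_cyc ((hoch_cyc ^^ m) w))"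
    by (simp only: m funpow_add funpow.simps o_apply)
  then have "hoch_face S i ((hoch_cyc ^^ j) w)
      = (hoch_cyc ^^ i) (hoch_face S 0 (hoch_cyc ((hoch_cyc ^^ m) w)))"
    using hoch_face_cyc_pow_le[of "hoch_cyc ((hoch_cyc ^^ m) w)" S p i i] assms
    by (simp add: hoch_cyc_tensor_words hoch_cyc_pow_tensor_words)
  also have "\<dots> = (hoch_cyc ^^ i) (hoch_face S (Suc p) ((hoch_cyc ^^ m) w))"
    using hoch_face_0_cyc[OF hoch_cyc_pow_tensor_words[OF w]] by simp
  also have "\<dots> = (hoch_cyc ^^ i) ((hoch_cyc ^^ m) (hoch_face S (Suc p - m) w))"
    using hoch_face_cyc_pow_le[OF w, of m "Suc p"] m assms by simp
  also have "\<dots> = (hoch_cyc ^^ (j - 1)) (hoch_face S (Suc (Suc p) + i - j) w)"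
    using m by (simp add: funpow_add)
  finally show ?thesis .
qed

context letter_ring begin

lemma Cons_one_tensor_words: "w \<in> tensor_words S m \<Longrightarrow> \<one> # w \<in> tensor_words S (Suc m)"
  by (auto simp: tensor_words_def)

lemma hoch_face_0_Cons_one:
  assumes "w \<in> tensor_words S (Suc p)"
  shows "hoch_face S 0 (\<one> # w) = w"
  using assms by (cases w) (auto simp: hoch_face_def tensor_words_def)

lemma hoch_face_Cons_one:
  assumes "w \<in> tensor_words S (Suc p)" "i < p"
  shows "hoch_face S (Suc i) (\<one> # w) = \<one> # hoch_face S i w"
  using assms by (auto simp: hoch_face_def tensor_words_def)

end

lemma hoch_face_map:
  assumes f: "f \<in> ring_hom S T" and w: "w \<in> tensor_words S (Suc (Suc p))"
  shows "hoch_face T i (map f w) = map f (hoch_face S i w)"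
proof (rule nth_equalityI)
  have l: "length w = Suc (Suc p)"
    and c: "\<And>j. j < Suc (Suc p) \<Longrightarrow> w ! j \<in> carrier S"
    using w by (auto simp: tensor_words_def)
  show "length (hoch_face T i (map f w)) = length (map f (hoch_face S i w))"
    using l by (simp add: length_hoch_face)
  fix k assume "k < length (hoch_face T i (map f w))"
  then show "hoch_face T i (map f w) ! k = map f (hoch_face S i w) ! k"
    using l c f by (auto simp: length_hoch_face nth_hoch_face ring_hom_mult)
qed

lemma hoch_cyc_map: "w \<noteq> [] \<Longrightarrow> hoch_cyc (map f w) = map f (hoch_cyc w)"
  by (simp add: hoch_cyc_def last_map map_butlast)

lemma map_tensor_words:
  "f \<in> ring_hom S T \<Longrightarrow> w \<in> tensor_words S m \<Longrightarrow> map f w \<in> tensor_words T m"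
  by (auto simp: tensor_words_def ring_hom_def)

section \<open>The Hochschild and simplicial operators on formal sums of words\<close>

definition supported :: "'x set \<Rightarrow> ('x \<Rightarrow>\<^sub>0 int) \<Rightarrow> bool" where
  "supported V c \<longleftrightarrow> Poly_Mapping.keys c \<subseteq> V"

lemma supported_0 [simp]: "supported V 0"
  and supported_frag_of [simp]: "supported V (frag_of x) \<longleftrightarrow> x \<in> V"
  and supported_minus [simp]: "supported V (- c) \<longleftrightarrow> supported V c"
  by (auto simp: supported_def)

lemma supported_mono: "supported V c \<Longrightarrow> V \<subseteq> V' \<Longrightarrow> supported V' c"
  by (auto simp: supported_def)

lemma supported_cmul: "supported V c \<Longrightarrow> supported V (frag_cmul k c)"
  by (auto simp: supported_def)

lemma supported_add: "supported V c \<Longrightarrow> supported V d \<Longrightarrow> supported V (c + d)"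
  using keys_add[of c d] by (auto simp: supported_def)

lemma supported_diff: "supported V c \<Longrightarrow> supported V d \<Longrightarrow> supported V (c - d)"
  using keys_diff[of c d] by (auto simp: supported_def)

lemma supported_sum: "(\<And>i. i \<in> I \<Longrightarrow> supported V (c i)) \<Longrightarrow> supported V (sum c I)"
  using keys_sum[of c I] unfolding supported_def by blast

lemma supported_frag_extend:
  "supported V c \<Longrightarrow> (\<And>x. x \<in> V \<Longrightarrow> supported V' (g x)) \<Longrightarrow> supported V' (frag_extend g c)"
  using keys_frag_extend[of g c] by (fastforce simp: supported_def)

lemmas supported_intros =
  supported_cmul supported_add supported_diff supported_sum

lemma frag_extend_frag_extend:
  "frag_extend g (frag_extend h c) = frag_extend (\<lambda>x. frag_extend g (h x)) c"
  using subset_UNIV by (induction c rule: frag_induction) (auto simp: frag_extend_diff)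

lemma frag_extend_cong:
  "supported V c \<Longrightarrow> (\<And>x. x \<in> V \<Longrightarrow> g x = h x) \<Longrightarrow> frag_extend g c = frag_extend h c"
  by (rule frag_extend_eq) (auto simp: supported_def)

lemma frag_extend_fun_add: "frag_extend (\<lambda>x. g x + h x) c = frag_extend g c + frag_extend h c"
  by (simp add: frag_extend_def frag_cmul_distrib2 sum.distrib)

lemma frag_cmul_diff_distrib2: "frag_cmul k (a - b) = frag_cmul k a - frag_cmul k b"
  by (metis add_diff_cancel diff_add_cancel frag_cmul_distrib2)

lemma frag_extend_fun_diff: "frag_extend (\<lambda>x. g x - h x) c = frag_extend g c - frag_extend h c"
  by (simp add: frag_extend_def frag_cmul_diff_distrib2 sum_subtractf)

lemma frag_extend_fun_cmul: "frag_extend (\<lambda>x. frag_cmul k (g x)) c = frag_cmul k (frag_extend g c)"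
  by (simp add: frag_extend_def frag_cmul_sum mult.commute)

lemma frag_extend_fun_sum:
  "finite I \<Longrightarrow> frag_extend (\<lambda>x. \<Sum>i\<in>I. g i x) c = (\<Sum>i\<in>I. frag_extend (g i) c)"
  by (induction I rule: finite_induct) (simp_all add: frag_extend_fun_add, simp add: frag_extend_def)

lemma frag_extend_frag_of [simp]: "frag_extend frag_of c = c"
  by (metis frag_expansion)

lemma frag_extend_sum_distrib: "finite I \<Longrightarrow> frag_extend f (\<Sum>i\<in>I. g i) = (\<Sum>i\<in>I. frag_extend f (g i))"
  by (simp add: frag_extend_sum)

lemmas frag_extend_linear = frag_extend_add frag_extend_diff frag_extend_minus frag_extend_cmul
  frag_extend_sum_distrib frag_cmul_sum

text \<open>
  The terms with \<open>i < j\<close> cancel against those with \<open>j \<le> i\<close> under \<open>(j, i) \<mapsto> (i, j - 1)\<close>, which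
  changes the parity of \<open>i + j\<close>.
\<close>

lemma alternating_double_sum_zero:
  fixes g :: "nat \<Rightarrow> nat \<Rightarrow> 'x \<Rightarrow>\<^sub>0 int"
  assumes "\<And>i j. i < j \<Longrightarrow> j \<le> Suc n \<Longrightarrow> g i j = g (j - 1) i"
  shows "(\<Sum>j\<le>Suc n. \<Sum>i\<le>n. frag_cmul ((- 1) ^ (i + j)) (g i j)) = 0"
proof -
  let ?h = "\<lambda>(j, i). frag_cmul ((- 1) ^ (i + j)) (g i j)"
  let ?A = "{(j, i). j \<le> Suc n \<and> i \<le> n \<and> i < j}"
  let ?B = "{(j, i). j \<le> Suc n \<and> i \<le> n \<and> j \<le> i}"
  have fin: "finite ?A" "finite ?B"
    by (rule finite_subset[of _ "{..Suc n} \<times> {..n}"], force, simp)+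
  have "(\<Sum>j\<le>Suc n. \<Sum>i\<le>n. frag_cmul ((- 1) ^ (i + j)) (g i j)) = sum ?h ({..Suc n} \<times> {..n})"
    unfolding sum.cartesian_product ..
  also have "{..Suc n} \<times> {..n} = ?A \<union> ?B" by auto
  also have "sum ?h (?A \<union> ?B) = sum ?h ?A + sum ?h ?B"
    by (rule sum.union_disjoint[OF fin]) auto
  also have "sum ?h ?A = sum (\<lambda>x. - ?h x) ?B"
  proof (rule sum.reindex_bij_witness[of _ "\<lambda>(j, i). (Suc i, j)" "\<lambda>(j, i). (i, j - 1)"])
    fix x assume "x \<in> ?A"
    then obtain a i where ai: "x = (a, i)" "a \<le> Suc n" "i < a" by blast
    then obtain j where x: "x = (Suc j, i)" "j \<le> n" "i \<le> j" by (cases a) auto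
    then show "- ?h (case x of (j, i) \<Rightarrow> (i, j - 1)) = ?h x"
      using assms[of i "Suc j"] by (simp add: add.commute)
  qed (auto simp del: minus_frag_cmul)
  also have "\<dots> + sum ?h ?B = 0"
    by (simp add: sum_negf)
  finally show ?thesis .
qed

lemma neg_one_power_cong: "even (a + b) \<Longrightarrow> (- 1 :: int) ^ a = (- 1) ^ b"
  by (auto simp: minus_one_power_iff)

text \<open>
  In this order: \<open>1 - t\<close> for the signed rotation \<open>t\<close>, the norm \<open>N\<close>, the bar differential \<open>b'\<close> (the
  Hochschild differential without the wrap-around face) and the extra degeneracy \<open>s\<close>. Signs depend
  on the length of the word, which makes these functions uniform in the degree.
\<close>

definition one_minus_t :: "'a list \<Rightarrow> 'a list \<Rightarrow>\<^sub>0 int" where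
  "one_minus_t w = frag_of w - frag_cmul ((- 1) ^ (length w - 1)) (frag_of (hoch_cyc w))"

definition cyc_norm :: "'a list \<Rightarrow> 'a list \<Rightarrow>\<^sub>0 int" where
  "cyc_norm w = (\<Sum>j\<le>length w - 1.
     frag_cmul ((- 1) ^ ((length w - 1) * j)) (frag_of ((hoch_cyc ^^ j) w)))"

definition bar_b :: "'a ring \<Rightarrow> 'a list \<Rightarrow> 'a list \<Rightarrow>\<^sub>0 int" where
  "bar_b S w = (\<Sum>i<length w - 1. frag_cmul ((- 1) ^ i) (frag_of (hoch_face S i w)))"

definition prepend_one :: "'a ring \<Rightarrow> 'a list \<Rightarrow> 'a list \<Rightarrow>\<^sub>0 int" where
  "prepend_one S w = frag_of (\<one>\<^bsub>S\<^esub> # w)"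

lemma hoch_B_eq:
  assumes "w \<noteq> []"
  shows "hoch_B S w = frag_extend one_minus_t (frag_extend (prepend_one S) (cyc_norm w))"
proof -
  have "length ((hoch_cyc ^^ j) w) = length w" for j
    using assms by (induction j) (auto simp: length_hoch_cyc, auto simp: hoch_cyc_def)
  moreover obtain p where "length w = Suc p" using assms by (cases w) auto
  ultimately show ?thesis
    by (simp add: hoch_B_def cyc_norm_def one_minus_t_def prepend_one_def Let_def frag_extend_linear)
qed

lemma length_tensor_words: "w \<in> tensor_words S m \<Longrightarrow> length w = m"
  by (simp add: tensor_words_def)

lemma supported_one_minus_t:
  "w \<in> tensor_words S (Suc p) \<Longrightarrow> supported (tensor_words S (Suc p)) (one_minus_t w)"
  by (auto simp: one_minus_t_def intro!: supported_intros hoch_cyc_tensor_words)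

lemma supported_cyc_norm:
  "w \<in> tensor_words S (Suc p) \<Longrightarrow> supported (tensor_words S (Suc p)) (cyc_norm w)"
  by (auto simp: cyc_norm_def intro!: supported_intros hoch_cyc_pow_tensor_words)

text \<open>
  Both composites telescope: \<open>t\<close> shifts the summands of \<open>N\<close> cyclically, with the sign of a full turn
  being \<open>(- 1)\<^sup>p\<^sup>(\<^sup>p\<^sup>+\<^sup>1\<^sup>) = 1\<close>.
\<close>

lemma norm_t:
  assumes "w \<in> tensor_words S (Suc p)"
  shows "frag_extend one_minus_t (cyc_norm w) = 0" "frag_extend cyc_norm (one_minus_t w) = 0"
proof -
  have l: "length ((hoch_cyc ^^ j) w) = Suc p" for j
    using length_tensor_words[OF hoch_cyc_pow_tensor_words[OF assms]] .
  have l0: "length w = Suc p" "length (hoch_cyc w) = Suc p" using l[of 0] l[of 1] by simp_all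
  define T where "T j = frag_cmul ((- 1) ^ (p * j)) (frag_of ((hoch_cyc ^^ j) w))" for j
  have T: "T (Suc p) = T 0"
    using hoch_cyc_pow_length[of w] l0 by (simp add: T_def del: funpow.simps)
  have e: "frag_extend one_minus_t (cyc_norm w) = (\<Sum>j\<le>p. T j - T (Suc j))"
    by (simp add: cyc_norm_def l0 one_minus_t_def frag_extend_linear l T_def
        frag_cmul_diff_distrib2 power_add[symmetric] ac_simps)
  show z: "frag_extend one_minus_t (cyc_norm w) = 0"
    using T by (simp add: e sum_telescope)
  have "frag_extend cyc_norm (one_minus_t w) = (\<Sum>j\<le>p. T j - T (Suc j))"
    by (simp add: cyc_norm_def l0 one_minus_t_def frag_extend_linear l T_def
        frag_cmul_diff_distrib2 power_add[symmetric] ac_simps sum_subtractf funpow_swap1)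
  with e z show "frag_extend cyc_norm (one_minus_t w) = 0" by simp
qed

lemma supported_hoch_b:
  "ring S \<Longrightarrow> w \<in> tensor_words S (Suc (Suc p)) \<Longrightarrow> supported (tensor_words S (Suc p)) (hoch_b S w)"
  by (auto simp: hoch_b_def letter_ring_def
      intro!: supported_intros letter_ring.hoch_face_tensor_words)

lemma supported_prepend_one:
  "ring S \<Longrightarrow> w \<in> tensor_words S m \<Longrightarrow> supported (tensor_words S (Suc m)) (prepend_one S w)"
  by (simp add: prepend_one_def letter_ring.Cons_one_tensor_words letter_ring_def)

lemma supported_hoch_B:
  assumes "ring S" "w \<in> tensor_words S (Suc p)"
  shows "supported (tensor_words S (Suc (Suc p))) (hoch_B S w)"
proof -
  have "w \<noteq> []" using assms by (auto simp: tensor_words_def)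
  then show ?thesis
    using assms by (auto simp: hoch_B_eq intro!: supported_frag_extend supported_one_minus_t
      supported_prepend_one supported_cyc_norm)
qed

lemma hoch_b_hoch_b:
  assumes S: "ring S" and w: "w \<in> tensor_words S (Suc (Suc (Suc p)))"
  shows "frag_extend (hoch_b S) (hoch_b S w) = 0"
proof -
  interpret letter_ring S using S by (simp add: letter_ring_def)
  have l: "length (hoch_face S i w) = Suc (Suc p)" "length w = Suc (Suc (Suc p))" for i
    using length_tensor_words[OF hoch_face_tensor_words[OF w]] length_tensor_words[OF w] by auto
  have "frag_extend (hoch_b S) (hoch_b S w)
     = (\<Sum>j\<le>Suc (Suc p). \<Sum>i\<le>Suc p. frag_cmul ((- 1) ^ (i + j))
        (frag_of (hoch_face S i (hoch_face S j w))))"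
    by (simp add: hoch_b_def frag_extend_linear l lessThan_Suc_atMost power_add ac_simps
        del: sum.atMost_Suc sum.lessThan_Suc)
  also have "\<dots> = 0"
    using hoch_face_face[OF w] by (intro alternating_double_sum_zero) simp
  finally show ?thesis .
qed

text \<open>
  \<open>b (1 - t) = (1 - t) b'\<close>: rotating first turns the wrap-around face into face \<open>0\<close>, and every other
  face is moved by one place, so the term \<open>b t\<close> accounts for the wrap-around face of \<open>b\<close> and for \<open>t
  b'\<close>.
\<close>

lemma hoch_b_one_minus_t:
  assumes S: "ring S" and w: "w \<in> tensor_words S (Suc (Suc p))"
  shows "frag_extend (hoch_b S) (one_minus_t w) = frag_extend one_minus_t (bar_b S w)"
proof -
  interpret letter_ring S using S by (simp add: letter_ring_def)
  have l: "length (hoch_face S i w) = Suc p" "length w = Suc (Suc p)" for i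
    using length_tensor_words[OF hoch_face_tensor_words[OF w]] length_tensor_words[OF w] by auto
  have l': "length (hoch_cyc w) = Suc (Suc p)" using l(2) by (subst length_hoch_cyc) auto
  have b: "hoch_b S w = bar_b S w + frag_cmul ((- 1) ^ Suc p) (frag_of (hoch_face S (Suc p) w))"
    by (simp add: hoch_b_def bar_b_def l)
  have "hoch_b S (hoch_cyc w) = frag_of (hoch_face S 0 (hoch_cyc w))
     + (\<Sum>i<Suc p. frag_cmul ((- 1) ^ Suc i) (frag_of (hoch_face S (Suc i) (hoch_cyc w))))"
    unfolding hoch_b_def l' by (subst sum.lessThan_Suc_shift) simp
  also have "\<dots> = frag_of (hoch_face S (Suc p) w)
     + (\<Sum>i<Suc p. frag_cmul ((- 1) ^ Suc i) (frag_of (hoch_cyc (hoch_face S i w))))"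
    using hoch_face_cyc[OF w] hoch_face_0_cyc[OF w] by simp
  finally have c: "frag_cmul ((- 1) ^ Suc p) (hoch_b S (hoch_cyc w))
    = frag_cmul ((- 1) ^ Suc p) (frag_of (hoch_face S (Suc p) w))
     + (\<Sum>i<Suc p. frag_cmul ((- 1) ^ (p + i)) (frag_of (hoch_cyc (hoch_face S i w))))"
    by (simp add: frag_cmul_distrib2 frag_cmul_sum power_add)
  show ?thesis
    unfolding one_minus_t_def frag_extend_diff frag_extend_cmul frag_extend_of
    unfolding l diff_Suc_1 c b
    by (simp add: bar_b_def l frag_extend_fun_diff frag_extend_linear power_add
        sum_subtractf ac_simps frag_cmul_diff_distrib2 del: sum.lessThan_Suc)
qed

text \<open>
  \<open>b' N = N b\<close>: moving each face through the rotations permutes the index pairs of the double sum.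
  Pairs with \<open>j \<le> i\<close> give \<open>t\<^sup>j d\<^sub>k\<close> with \<open>j + k \<le> p\<close>; the other pairs give the remaining products,
  among them all those with the wrap-around face \<open>k = p + 1\<close>.
\<close>

lemma bar_b_cyc_norm:
  assumes S: "ring S" and w: "w \<in> tensor_words S (Suc (Suc p))"
  shows "frag_extend (bar_b S) (cyc_norm w) = frag_extend cyc_norm (hoch_b S w)"
proof -
  interpret letter_ring S using S by (simp add: letter_ring_def)
  have l: "length (hoch_face S i w) = Suc p" "length w = Suc (Suc p)" for i
    using length_tensor_words[OF hoch_face_tensor_words[OF w]] length_tensor_words[OF w] by auto
  have l': "length ((hoch_cyc ^^ j) w) = Suc (Suc p)" for j
    using length_tensor_words[OF hoch_cyc_pow_tensor_words[OF w]] .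
  let ?g = "\<lambda>(j, i). frag_cmul ((- 1) ^ (Suc p * j + i)) (frag_of (hoch_face S i ((hoch_cyc ^^ j) w)))"
  let ?h = "\<lambda>(i, j). frag_cmul ((- 1) ^ (i + p * j)) (frag_of ((hoch_cyc ^^ j) (hoch_face S i w)))"
  have "frag_extend (bar_b S) (cyc_norm w) = (\<Sum>j\<le>Suc p. \<Sum>i\<le>p. ?g (j, i))"
    by (simp add: cyc_norm_def bar_b_def l l' frag_extend_linear power_add lessThan_Suc_atMost
        del: sum.atMost_Suc sum.lessThan_Suc)
  also have "\<dots> = sum ?g ({..Suc p} \<times> {..p})"
    by (simp add: sum.cartesian_product)
  also have "\<dots> = sum ?h ({..Suc p} \<times> {..p})"
  proof (rule sum.reindex_bij_witness[of _
      "\<lambda>(i, j). if i + j \<le> p then (j, i + j) else (Suc j, i + j - Suc p)"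
      "\<lambda>(j, i). if j \<le> i then (i - j, j) else (Suc (Suc p) + i - j, j - 1)"])
    fix x assume "x \<in> {..Suc p} \<times> {..p}"
    then obtain j i where x: "x = (j, i)" "j \<le> Suc p" "i \<le> p" by auto
    show "?h (case x of (j, i) \<Rightarrow> if j \<le> i then (i - j, j) else (Suc (Suc p) + i - j, j - 1)) = ?g x"
    proof (cases "j \<le> i")
      case True
      moreover have "(- 1 :: int) ^ (i - j + p * j) = (- 1) ^ (Suc p * j + i)"
        using True by (intro neg_one_power_cong) auto
      ultimately show ?thesis
        using x hoch_face_cyc_pow_le[OF w, of j i] by simp
    next
      case False
      then obtain m where m: "j = Suc (i + m)" by (metis add_Suc_right less_iff_Suc_add not_le)
      have "(- 1 :: int) ^ (Suc p - m + p * (i + m)) = (- 1) ^ (Suc p * j + i)"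
        using x m by (intro neg_one_power_cong) auto
      with False show ?thesis
        using x hoch_face_cyc_pow_gt[OF w, of i j] m by (simp add: ac_simps)
    qed
  qed (auto split: if_splits)
  also have "\<dots> = (\<Sum>i\<le>Suc p. \<Sum>j\<le>p. ?h (i, j))"
    by (simp add: sum.cartesian_product)
  also have "\<dots> = frag_extend cyc_norm (hoch_b S w)"
    by (simp add: cyc_norm_def hoch_b_def l l' frag_extend_linear power_add lessThan_Suc_atMost
        del: sum.atMost_Suc sum.lessThan_Suc)
  finally show ?thesis .
qed

text \<open>
  The extra degeneracy contracts the bar complex: face \<open>0\<close> removes the prepended unit, and the
  remaining faces of \<open>1 w\<close> are the faces of \<open>w\<close> with the unit prepended and the sign reversed.
\<close>

lemma bar_b_prepend_one:
  assumes S: "ring S" and w: "w \<in> tensor_words S (Suc p)"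
  shows "frag_extend (bar_b S) (prepend_one S w) + frag_extend (prepend_one S) (bar_b S w) = frag_of w"
proof -
  interpret letter_ring S using S by (simp add: letter_ring_def)
  have l: "length w = Suc p" using w by (simp add: length_tensor_words)
  have "bar_b S (\<one>\<^bsub>S\<^esub> # w) = frag_of (hoch_face S 0 (\<one>\<^bsub>S\<^esub> # w))
     + (\<Sum>i<p. frag_cmul ((- 1) ^ Suc i) (frag_of (hoch_face S (Suc i) (\<one>\<^bsub>S\<^esub> # w))))"
    unfolding bar_b_def by (simp add: l sum.lessThan_Suc_shift del: sum.lessThan_Suc)
  also have "\<dots> = frag_of w - frag_extend (prepend_one S) (bar_b S w)"
    using hoch_face_0_Cons_one[OF w] hoch_face_Cons_one[OF w]
    by (simp add: prepend_one_def bar_b_def l frag_extend_linear sum_negf[symmetric])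
  finally show ?thesis by (simp add: prepend_one_def)
qed

lemma hoch_B_hoch_B:
  assumes S: "ring S" and w: "w \<in> tensor_words S (Suc p)"
  shows "frag_extend (hoch_B S) (hoch_B S w) = 0"
proof -
  have "w \<noteq> []" using w by (auto simp: tensor_words_def)
  let ?s = "frag_extend (prepend_one S)" and ?N = "frag_extend cyc_norm" and ?t = "frag_extend one_minus_t"
  have sup: "supported (tensor_words S (Suc (Suc p))) (?s (cyc_norm w))"
    by (intro supported_frag_extend[OF supported_cyc_norm[OF w]] supported_prepend_one[OF S])
  have "frag_extend (hoch_B S) (hoch_B S w) = frag_extend (\<lambda>w. ?t (?s (cyc_norm w))) (hoch_B S w)"
    using supported_hoch_B[OF S w]
    by (rule frag_extend_cong) (rule hoch_B_eq, auto simp: tensor_words_def)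
  also have "\<dots> = ?t (?s (?N (?t (?s (cyc_norm w)))))"
    by (simp add: frag_extend_frag_extend hoch_B_eq[OF \<open>w \<noteq> []\<close>])
  also have "?N (?t (?s (cyc_norm w))) = frag_extend (\<lambda>w. 0) (?s (cyc_norm w))"
    unfolding frag_extend_frag_extend[of cyc_norm] using sup
    by (rule frag_extend_cong) (rule norm_t)
  finally show ?thesis by (simp add: frag_extend_eq_0)
qed

text \<open>
  \<open>b B = b (1 - t) s N = (1 - t) b' s N = (1 - t) (1 - s b') N = - (1 - t) s b' N\<close>. For words of
  length one \<open>b'\<close> vanishes; for longer ones \<open>b' N = N b\<close> identifies the result with \<open>- B b\<close>.
\<close>

lemma hoch_b_hoch_B_aux:
  assumes S: "ring S" and w: "w \<in> tensor_words S (Suc p)"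
  shows "frag_extend (hoch_b S) (hoch_B S w)
    + frag_extend one_minus_t (frag_extend (prepend_one S) (frag_extend (bar_b S) (cyc_norm w))) = 0"
proof -
  have "w \<noteq> []" using w by (auto simp: tensor_words_def)
  let ?s = "frag_extend (prepend_one S)" and ?t = "frag_extend one_minus_t"
  let ?b = "frag_extend (bar_b S)"
  have sup: "supported (tensor_words S (Suc (Suc p))) (?s (cyc_norm w))"
    by (intro supported_frag_extend[OF supported_cyc_norm[OF w]] supported_prepend_one[OF S])
  have "frag_extend (hoch_b S) (hoch_B S w) = frag_extend (\<lambda>w. ?t (bar_b S w)) (?s (cyc_norm w))"
    unfolding hoch_B_eq[OF \<open>w \<noteq> []\<close>] frag_extend_frag_extend[of "hoch_b S"] using sup
    by (rule frag_extend_cong) (rule hoch_b_one_minus_t[OF S])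
  also have "\<dots> = ?t (?b (?s (cyc_norm w)))"
    by (simp add: frag_extend_frag_extend)
  finally have "frag_extend (hoch_b S) (hoch_B S w) + ?t (?s (?b (cyc_norm w)))
     = ?t (frag_extend (\<lambda>w. ?b (prepend_one S w) + ?s (bar_b S w)) (cyc_norm w))"
    by (simp add: frag_extend_add frag_extend_fun_add frag_extend_frag_extend)
  also have "frag_extend (\<lambda>w. ?b (prepend_one S w) + ?s (bar_b S w)) (cyc_norm w)
     = frag_extend frag_of (cyc_norm w)"
    using supported_cyc_norm[OF w]
    by (rule frag_extend_cong) (rule bar_b_prepend_one[OF S])
  finally show ?thesis by (simp add: norm_t(1)[OF w])
qed

text \<open>
  In the lowest degree \<open>b\<close> is not applied to words of length one, so \<open>b B\<close> has to vanish by itself.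
\<close>

lemma hoch_b_hoch_B_zero:
  assumes S: "ring S" and w: "w \<in> tensor_words S 1"
  shows "frag_extend (hoch_b S) (hoch_B S w) = 0"
proof -
  have "frag_extend (bar_b S) (cyc_norm w) = frag_extend (\<lambda>w. 0) (cyc_norm w)"
    using supported_cyc_norm[of w S 0] w
    by (intro frag_extend_cong[of "tensor_words S 1"]) (auto simp: bar_b_def length_tensor_words)
  also have "\<dots> = 0" by (simp add: frag_extend_eq_0)
  finally show ?thesis using hoch_b_hoch_B_aux[of S w 0] assms by simp
qed

lemma hoch_b_hoch_B:
  assumes S: "ring S" and w: "w \<in> tensor_words S (Suc (Suc p))"
  shows "frag_extend (hoch_b S) (hoch_B S w) + frag_extend (hoch_B S) (hoch_b S w) = 0"
proof -
  have "frag_extend (hoch_B S) (hoch_b S w)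
    = frag_extend (\<lambda>w. frag_extend one_minus_t (frag_extend (prepend_one S) (cyc_norm w))) (hoch_b S w)"
    using supported_hoch_b[OF S w]
    by (rule frag_extend_cong) (rule hoch_B_eq, auto simp: tensor_words_def)
  also have "\<dots> = frag_extend one_minus_t (frag_extend (prepend_one S) (frag_extend cyc_norm (hoch_b S w)))"
    by (simp add: frag_extend_frag_extend)
  finally show ?thesis
    using hoch_b_hoch_B_aux[OF S w] bar_b_cyc_norm[OF S w] by simp
qed

section \<open>Naturality and the simplicial direction\<close>

definition word_map :: "('a \<Rightarrow> 'b) \<Rightarrow> 'a list \<Rightarrow> 'b list \<Rightarrow>\<^sub>0 int" where
  "word_map f w = frag_of (map f w)"

lemma supported_word_map:
  "f \<in> ring_hom S T \<Longrightarrow> w \<in> tensor_words S m \<Longrightarrow> supported (tensor_words T m) (word_map f w)"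
  by (simp add: word_map_def map_tensor_words)

lemma hoch_b_map:
  assumes f: "f \<in> ring_hom S T" and w: "w \<in> tensor_words S (Suc (Suc p))"
  shows "hoch_b T (map f w) = frag_extend (word_map f) (hoch_b S w)"
  by (simp add: hoch_b_def hoch_face_map[OF f w] frag_extend_linear word_map_def)

lemma hoch_B_map:
  assumes f: "f \<in> ring_hom S T" and w: "w \<in> tensor_words S (Suc p)"
  shows "hoch_B T (map f w) = frag_extend (word_map f) (hoch_B S w)"
proof -
  have ne: "(hoch_cyc ^^ j) w \<noteq> []" for j
    using length_tensor_words[OF hoch_cyc_pow_tensor_words[OF w, of j]] by auto
  have c: "(hoch_cyc ^^ j) (map f w) = map f ((hoch_cyc ^^ j) w)" for j
    by (induction j) (auto simp: hoch_cyc_map ne)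
  have "\<one>\<^bsub>T\<^esub> # map f v = map f (\<one>\<^bsub>S\<^esub> # v)" for v
    using ring_hom_one[OF f] by simp
  then show ?thesis
    by (simp add: hoch_B_def Let_def frag_extend_linear word_map_def c hoch_cyc_map
        del: minus_frag_cmul list.map)
qed

lemma simp_d_word_map:
  "simp_d R q w = (\<Sum>i\<le>Suc q. frag_cmul ((- 1) ^ (length w - 1 + i)) (word_map (face R q i) w))"
  by (simp add: simp_d_def word_map_def Let_def)

text \<open>
  Naturality moves the operator past each simplicial face. The sign \<open>(- 1)\<^sup>p\<close> carried by the
  simplicial differential changes exactly when the length changes by an odd number.
\<close>

lemma simp_d_anticommute:
  assumes w: "length w = Suc p" and supp: "supported {v. length v = Suc p'} (\<beta>' w)"
    and odd: "odd (p + p')"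
    and nat: "\<And>i. i \<le> Suc q \<Longrightarrow> \<beta> (map (face R q i) w) = frag_extend (word_map (face R q i)) (\<beta>' w)"
  shows "frag_extend \<beta> (simp_d R q w) + frag_extend (simp_d R q) (\<beta>' w) = 0"
proof -
  let ?m = "\<lambda>i. frag_extend (word_map (face R q i)) (\<beta>' w)"
  have 1: "frag_extend \<beta> (simp_d R q w) = (\<Sum>i\<le>Suc q. frag_cmul ((- 1) ^ (p + i)) (?m i))"
    using nat by (simp add: simp_d_def w frag_extend_linear del: sum.atMost_Suc)
  have "frag_extend (simp_d R q) (\<beta>' w)
     = frag_extend (\<lambda>v. \<Sum>i\<le>Suc q. frag_cmul ((- 1) ^ (p' + i)) (word_map (face R q i) v)) (\<beta>' w)"
    using supp by (rule frag_extend_cong) (simp add: simp_d_word_map del: sum.atMost_Suc)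
  also have "\<dots> = (\<Sum>i\<le>Suc q. frag_cmul ((- 1) ^ (p' + i)) (?m i))"
    by (simp add: frag_extend_fun_sum frag_extend_fun_cmul del: sum.atMost_Suc)
  also have "\<dots> = - (\<Sum>i\<le>Suc q. frag_cmul ((- 1) ^ (p + i)) (?m i))"
  proof -
    have "(- 1 :: int) ^ (p' + i) = - ((- 1) ^ (p + i))" for i
      using odd by (auto simp: minus_one_power_iff)
    then show ?thesis by (simp add: sum_negf[symmetric] del: sum.atMost_Suc)
  qed
  finally show ?thesis using 1 by (simp del: sum.atMost_Suc)
qed

context simplicial_ring begin

lemma supported_simp_d:
  "w \<in> tensor_words (level R (Suc q)) m \<Longrightarrow> supported (tensor_words (level R q) m) (simp_d R q w)"
  unfolding simp_d_word_map by (intro supported_intros supported_word_map[OF face_hom]) auto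

lemma simp_d_simp_d:
  assumes w: "w \<in> tensor_words (level R (Suc (Suc q))) m"
  shows "frag_extend (simp_d R q) (simp_d R (Suc q) w) = 0"
proof -
  have sgn: "(- 1 :: int) ^ (a + j) * (- 1) ^ (a + i) = (- 1) ^ (i + j)" for a i j
    by (simp add: minus_one_power_iff)
  have "frag_extend (simp_d R q) (simp_d R (Suc q) w) =
    (\<Sum>j\<le>Suc (Suc q). \<Sum>i\<le>Suc q. frag_cmul ((- 1) ^ (i + j))
        (frag_of (map (face R q i) (map (face R (Suc q) j) w))))"
    by (simp add: simp_d_def frag_extend_linear Let_def sgn del: sum.atMost_Suc map_map)
  also have "\<dots> = 0"
  proof (rule alternating_double_sum_zero)
    fix i j :: nat assume "i < j" "j \<le> Suc (Suc q)"
    moreover have "x \<in> set w \<Longrightarrow> x \<in> carrier (level R (Suc (Suc q)))" for x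
      using w by (auto simp: tensor_words_def)
    ultimately have "map (face R q i) (map (face R (Suc q) j) w)
       = map (face R q (j - 1)) (map (face R (Suc q) i) w)"
      by (simp add: face_face)
    then show "frag_of (map (face R q i) (map (face R (Suc q) j) w))
       = frag_of (map (face R q (j - 1)) (map (face R (Suc q) i) w))"
      by (rule arg_cong)
  qed
  finally show ?thesis .
qed

lemma hoch_b_simp_d:
  assumes w: "w \<in> tensor_words (level R (Suc q)) (Suc (Suc p))"
  shows "frag_extend (hoch_b (level R q)) (simp_d R q w)
    + frag_extend (simp_d R q) (hoch_b (level R (Suc q)) w) = 0"
proof (rule simp_d_anticommute)
  show "length w = Suc (Suc p)" using w by (rule length_tensor_words)
  show "supported {v. length v = Suc p} (hoch_b (level R (Suc q)) w)"
    using supported_hoch_b[OF ring_level w] by (rule supported_mono) (auto simp: tensor_words_def)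
qed (use hoch_b_map[OF face_hom w] in auto)

lemma hoch_B_simp_d:
  assumes w: "w \<in> tensor_words (level R (Suc q)) (Suc p)"
  shows "frag_extend (hoch_B (level R q)) (simp_d R q w)
    + frag_extend (simp_d R q) (hoch_B (level R (Suc q)) w) = 0"
proof (rule simp_d_anticommute)
  show "length w = Suc p" using w by (rule length_tensor_words)
  show "supported {v. length v = Suc (Suc p)} (hoch_B (level R (Suc q)) w)"
    using supported_hoch_B[OF ring_level w] by (rule supported_mono) (auto simp: tensor_words_def)
qed (use hoch_B_map[OF face_hom w] in auto)

end

lemma (in simplicial_ring_map) simp_d_map:
  assumes w: "w \<in> tensor_words (level R (Suc q)) m"
  shows "simp_d R' q (map (f (Suc q)) w) = frag_extend (word_map (f q)) (simp_d R q w)"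
proof -
  have x: "x \<in> set w \<Longrightarrow> x \<in> carrier (level R (Suc q))" for x
    using w by (auto simp: tensor_words_def)
  have "map (face R' q i) (map (f (Suc q)) w) = map (f q) (map (face R q i) w)" if "i \<le> Suc q" for i
    using that x by (simp add: map_face)
  then show ?thesis
    by (simp add: simp_d_def Let_def frag_extend_linear word_map_def del: sum.atMost_Suc map_map)
qed

section \<open>Tensor powers\<close>

text \<open>
  Additivity at a position of the word, instead of at a splitting of it as in the relations of the
  tensor power. Faces and rotations are described by their letters, so this form passes through
  them easily.
\<close>

definition letter_sum :: "'a ring \<Rightarrow> 'a list \<Rightarrow> 'a list \<Rightarrow> 'a list \<Rightarrow> bool" where
  "letter_sum S x y z \<longleftrightarrow> length y = length x \<and> length z = length x \<and>
    (\<exists>k<length x. x ! k = y ! k \<oplus>\<^bsub>S\<^esub> z ! k \<and> (\<forall>j<length x. j \<noteq> k \<longrightarrow> y ! j = x ! j \<and> z ! j = x ! j))"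

lemma letter_sumI:
  "length y = length x \<Longrightarrow> length z = length x \<Longrightarrow> k < length x \<Longrightarrow> x ! k = y ! k \<oplus>\<^bsub>S\<^esub> z ! k \<Longrightarrow>
   (\<And>j. j < length x \<Longrightarrow> j \<noteq> k \<Longrightarrow> y ! j = x ! j \<and> z ! j = x ! j) \<Longrightarrow> letter_sum S x y z"
  unfolding letter_sum_def by blast

definition tensor_relators :: "'a ring \<Rightarrow> nat \<Rightarrow> ('a list \<Rightarrow>\<^sub>0 int) set" where
  "tensor_relators S m = {frag_of x - frag_of y - frag_of z | x y z.
     x \<in> tensor_words S m \<and> y \<in> tensor_words S m \<and> z \<in> tensor_words S m \<and> letter_sum S x y z}"

text \<open>
  Splitting a word at position \<open>k\<close> translates between the two descriptions of the same generators.
\<close>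

lemma tensor_rels_eq:
  assumes "ring S"
  shows "tensor_rels S m = generate (free_Abelian_group (tensor_words S m)) (tensor_relators S m)"
proof -
  interpret ring S by fact
  have "{frag_of (v @ (a \<oplus>\<^bsub>S\<^esub> c) # w) - frag_of (v @ a # w) - frag_of (v @ c # w) | v a c w.
      v @ a # w \<in> tensor_words S m \<and> c \<in> carrier S} = tensor_relators S m" (is "?A = _")
  proof (intro equalityI subsetI)
    fix r assume "r \<in> ?A"
    then obtain v a c w where r: "r = frag_of (v @ (a \<oplus>\<^bsub>S\<^esub> c) # w) - frag_of (v @ a # w) - frag_of (v @ c # w)"
      and w: "v @ a # w \<in> tensor_words S m" "c \<in> carrier S" by blast
    have "letter_sum S (v @ (a \<oplus>\<^bsub>S\<^esub> c) # w) (v @ a # w) (v @ c # w)"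
      by (rule letter_sumI[of _ _ _ "length v"]) (auto simp: nth_append nth_Cons')
    then show "r \<in> tensor_relators S m"
      using r w unfolding tensor_relators_def
      by (intro CollectI exI[of _ "v @ (a \<oplus>\<^bsub>S\<^esub> c) # w"] exI[of _ "v @ a # w"] exI[of _ "v @ c # w"])
        (auto simp: tensor_words_def)
  next
    fix r assume "r \<in> tensor_relators S m"
    then obtain x y z where r: "r = frag_of x - frag_of y - frag_of z"
      and w: "x \<in> tensor_words S m" "y \<in> tensor_words S m" "z \<in> tensor_words S m"
      and xyz: "letter_sum S x y z" unfolding tensor_relators_def by blast
    obtain k where l: "length y = length x" "length z = length x" and k: "k < length x"
      and sum: "x ! k = y ! k \<oplus>\<^bsub>S\<^esub> z ! k"
      and eq: "\<And>j. j < length x \<Longrightarrow> j \<noteq> k \<Longrightarrow> y ! j = x ! j \<and> z ! j = x ! j"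
      using xyz unfolding letter_sum_def by blast
    define v u where "v = take k x" and "u = drop (Suc k) x"
    have x: "x = v @ (y ! k \<oplus>\<^bsub>S\<^esub> z ! k) # u"
      using id_take_nth_drop[OF k] unfolding v_def u_def sum .
    have "take k y = v" "take k z = v" "drop (Suc k) y = u" "drop (Suc k) z = u"
      unfolding v_def u_def using l eq k by (auto intro!: nth_equalityI)
    then have y: "y = v @ y ! k # u" and z: "z = v @ z ! k # u"
      using id_take_nth_drop[of k y] id_take_nth_drop[of k z] k l by simp_all
    have zk: "z ! k \<in> carrier S" using w k l by (auto simp: tensor_words_def)
    have "r = frag_of (v @ (y ! k \<oplus>\<^bsub>S\<^esub> z ! k) # u) - frag_of (v @ y ! k # u) - frag_of (v @ z ! k # u)"
      unfolding x[symmetric] y[symmetric] z[symmetric] by (rule r)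
    moreover have "v @ y ! k # u \<in> tensor_words S m"
      unfolding y[symmetric] by (rule w(2))
    ultimately show "r \<in> ?A" using zk by blast
  qed
  then show ?thesis by (simp add: tensor_rels_def)
qed

context
  fixes S :: "'a ring" and m :: nat
  assumes S: "ring S"
begin

lemma supported_relator: "c \<in> tensor_relators S m \<Longrightarrow> supported (tensor_words S m) c"
  by (auto simp: tensor_relators_def intro!: supported_intros)

lemma tensor_relators_carrier:
  "tensor_relators S m \<subseteq> carrier (free_Abelian_group (tensor_words S m))"
  using supported_relator by (auto simp: supported_def)

lemma subgroup_tensor_rels: "subgroup (tensor_rels S m) (free_Abelian_group (tensor_words S m))"
  unfolding tensor_rels_eq[OF S]
  by (rule group.generate_is_subgroup[OF group_free_Abelian_group tensor_relators_carrier])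

lemma normal_tensor_rels: "tensor_rels S m \<lhd> free_Abelian_group (tensor_words S m)"
  using subgroup_tensor_rels comm_group.normal_iff_subgroup[OF abelian_free_Abelian_group] by blast

lemma supported_tensor_rels: "c \<in> tensor_rels S m \<Longrightarrow> supported (tensor_words S m) c"
  using subgroup.mem_carrier[OF subgroup_tensor_rels, of c] by (simp add: supported_def)

lemma tensor_rels_0: "0 \<in> tensor_rels S m"
  using subgroup.one_closed[OF subgroup_tensor_rels] by simp

lemma tensor_rels_add: "c \<in> tensor_rels S m \<Longrightarrow> d \<in> tensor_rels S m \<Longrightarrow> c + d \<in> tensor_rels S m"
  using subgroup.m_closed[OF subgroup_tensor_rels] by simp

lemma tensor_rels_minus: "c \<in> tensor_rels S m \<Longrightarrow> - c \<in> tensor_rels S m"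
  using subgroup.m_inv_closed[OF subgroup_tensor_rels, of c] supported_tensor_rels[of c]
  by (simp add: supported_def)

lemma tensor_rels_diff: "c \<in> tensor_rels S m \<Longrightarrow> d \<in> tensor_rels S m \<Longrightarrow> c - d \<in> tensor_rels S m"
  using tensor_rels_add[of c "- d"] tensor_rels_minus by simp

lemma tensor_rels_cmul: "c \<in> tensor_rels S m \<Longrightarrow> frag_cmul k c \<in> tensor_rels S m"
  by (rule frag_closure_minus_cmul[of "\<lambda>c. c \<in> tensor_rels S m"])
    (auto intro: tensor_rels_0 tensor_rels_diff)

lemma tensor_rels_sum:
  "(\<And>i. i \<in> I \<Longrightarrow> c i \<in> tensor_rels S m) \<Longrightarrow> sum c I \<in> tensor_rels S m"
  by (induction I rule: infinite_finite_induct) (auto intro: tensor_rels_0 tensor_rels_add)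

end

text \<open>Operators on formal sums that descend to tensor powers.\<close>

definition tensor_op ::
  "'a ring \<Rightarrow> nat \<Rightarrow> 'b ring \<Rightarrow> nat \<Rightarrow> ('a list \<Rightarrow> 'b list \<Rightarrow>\<^sub>0 int) \<Rightarrow> bool" where
  "tensor_op S m T k \<phi> \<longleftrightarrow>
    (\<forall>w \<in> tensor_words S m. supported (tensor_words T k) (\<phi> w)) \<and>
    (\<forall>c \<in> tensor_rels S m. frag_extend \<phi> c \<in> tensor_rels T k)"

lemma tensor_op_supported:
  "tensor_op S m T k \<phi> \<Longrightarrow> supported (tensor_words S m) c \<Longrightarrow> supported (tensor_words T k) (frag_extend \<phi> c)"
  by (auto simp: tensor_op_def intro: supported_frag_extend)

lemma tensor_op_word:
  assumes S: "ring S" and T: "ring T"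
    and g: "\<And>w. w \<in> tensor_words S m \<Longrightarrow> g w \<in> tensor_words T k"
    and add: "\<And>x y z. \<lbrakk>x \<in> tensor_words S m; y \<in> tensor_words S m; z \<in> tensor_words S m;
        letter_sum S x y z\<rbrakk> \<Longrightarrow> letter_sum T (g x) (g y) (g z)"
  shows "tensor_op S m T k (\<lambda>w. frag_of (g w))"
proof -
  have rel: "frag_extend (\<lambda>w. frag_of (g w)) c \<in> tensor_relators T k"
    if c: "c \<in> tensor_relators S m" for c
  proof -
    obtain x y z where "c = frag_of x - frag_of y - frag_of z" and xyz: "x \<in> tensor_words S m"
      "y \<in> tensor_words S m" "z \<in> tensor_words S m" "letter_sum S x y z"
      using c unfolding tensor_relators_def by blast
    then have "frag_extend (\<lambda>w. frag_of (g w)) c = frag_of (g x) - frag_of (g y) - frag_of (g z)"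
      by (simp add: frag_extend_diff)
    then show ?thesis
      unfolding tensor_relators_def using g[OF xyz(1)] g[OF xyz(2)] g[OF xyz(3)] add[OF xyz] by blast
  qed
  have "frag_extend (\<lambda>w. frag_of (g w)) c \<in> tensor_rels T k" if "c \<in> tensor_rels S m" for c
    using that unfolding tensor_rels_eq[OF S]
  proof (induction rule: generate.induct)
    case one
    then show ?case using tensor_rels_0[OF T] by simp
  next
    case (incl c)
    then have "frag_extend (\<lambda>w. frag_of (g w)) c \<in> tensor_relators T k"
      by (rule rel)
    then show ?case by (simp add: tensor_rels_eq[OF T] generate.incl)
  next
    case (inv c)
    then have "frag_extend (\<lambda>w. frag_of (g w)) c \<in> tensor_relators T k"
      by (rule rel)
    then have "frag_extend (\<lambda>w. frag_of (g w)) c \<in> tensor_rels T k"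
      by (simp add: tensor_rels_eq[OF T] generate.incl)
    then show ?case using supported_relator[OF S inv] tensor_rels_minus[OF T]
      by (simp add: supported_def frag_extend_minus)
  next
    case (eng c d)
    then show ?case using tensor_rels_add[OF T] by (simp add: frag_extend_add)
  qed
  then show ?thesis using g by (simp add: tensor_op_def)
qed

lemma tensor_op_cong:
  assumes S: "ring S" and "tensor_op S m T k \<psi>" "\<And>w. w \<in> tensor_words S m \<Longrightarrow> \<phi> w = \<psi> w"
  shows "tensor_op S m T k \<phi>"
proof -
  have "frag_extend \<phi> c = frag_extend \<psi> c" if "c \<in> tensor_rels S m" for c
    using supported_tensor_rels[OF S that] assms(3) by (rule frag_extend_cong)
  then show ?thesis
    using assms(2,3) by (simp add: tensor_op_def)
qed

lemma tensor_op_sum: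
  assumes T: "ring T" and "finite I" "\<And>i. i \<in> I \<Longrightarrow> tensor_op S m T k (\<phi> i)"
  shows "tensor_op S m T k (\<lambda>w. \<Sum>i\<in>I. \<phi> i w)"
  using assms(2,3) tensor_rels_sum[OF T, of I _ k]
  by (simp add: tensor_op_def frag_extend_fun_sum supported_sum)

lemma tensor_op_cmul:
  assumes T: "ring T" and "tensor_op S m T k \<phi>"
  shows "tensor_op S m T k (\<lambda>w. frag_cmul a (\<phi> w))"
  using assms(2) tensor_rels_cmul[OF T, of _ k]
  by (simp add: tensor_op_def frag_extend_fun_cmul supported_cmul)

lemma tensor_op_diff:
  assumes T: "ring T" and "tensor_op S m T k \<phi>" "tensor_op S m T k \<psi>"
  shows "tensor_op S m T k (\<lambda>w. \<phi> w - \<psi> w)"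
  using assms(2,3) tensor_rels_diff[OF T, of _ k]
  by (simp add: tensor_op_def frag_extend_fun_diff supported_diff)

lemma tensor_op_compose:
  assumes "tensor_op S m T k \<phi>" "tensor_op T k U l \<psi>"
  shows "tensor_op S m U l (\<lambda>w. frag_extend \<psi> (\<phi> w))"
  using assms tensor_op_supported[OF assms(2)]
  by (simp add: tensor_op_def frag_extend_frag_extend[symmetric])

lemma tensor_op_word_map:
  assumes S: "ring S" and T: "ring T" and f: "f \<in> ring_hom S T"
  shows "tensor_op S m T m (word_map f)"
proof -
  have "tensor_op S m T m (\<lambda>w. frag_of (map f w))"
  proof (rule tensor_op_word[OF S T map_tensor_words[OF f]])
    fix x y z assume w: "x \<in> tensor_words S m" "y \<in> tensor_words S m" "z \<in> tensor_words S m"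
      and "letter_sum S x y z"
    then obtain k where l: "length y = length x" "length z = length x" and k: "k < length x"
      and sum: "x ! k = y ! k \<oplus>\<^bsub>S\<^esub> z ! k"
      and eq: "\<And>j. j < length x \<Longrightarrow> j \<noteq> k \<Longrightarrow> y ! j = x ! j \<and> z ! j = x ! j"
      unfolding letter_sum_def by blast
    have "y ! k \<in> carrier S" "z ! k \<in> carrier S"
      using w k l by (auto simp: tensor_words_def)
    then show "letter_sum T (map f x) (map f y) (map f z)"
      using l k sum eq by (intro letter_sumI[of _ _ _ k]) (auto simp: ring_hom_add[OF f])
  qed
  then show ?thesis by (simp add: word_map_def[abs_def])
qed

lemma tensor_op_hoch_cyc:
  assumes S: "ring S"
  shows "tensor_op S (Suc p) S (Suc p) (\<lambda>w. frag_of (hoch_cyc w))"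
proof (rule tensor_op_word[OF S S hoch_cyc_tensor_words])
  fix x y z assume w: "x \<in> tensor_words S (Suc p)" "y \<in> tensor_words S (Suc p)" "z \<in> tensor_words S (Suc p)"
    and "letter_sum S x y z"
  then obtain k where k: "k < length x"
    and sum: "x ! k = y ! k \<oplus>\<^bsub>S\<^esub> z ! k"
    and eq: "\<And>j. j < length x \<Longrightarrow> j \<noteq> k \<Longrightarrow> y ! j = x ! j \<and> z ! j = x ! j"
    unfolding letter_sum_def by blast
  have l: "length x = Suc p" "length y = Suc p" "length z = Suc p"
    using w by (simp_all add: length_tensor_words)
  then have ne: "x \<noteq> []" "y \<noteq> []" "z \<noteq> []" by auto
  let ?k = "if k = p then 0 else Suc k"
  show "letter_sum S (hoch_cyc x) (hoch_cyc y) (hoch_cyc z)"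
  proof (rule letter_sumI[of _ _ _ ?k])
    show "length (hoch_cyc y) = length (hoch_cyc x)" "length (hoch_cyc z) = length (hoch_cyc x)"
      "?k < length (hoch_cyc x)"
      using k l ne by (simp_all add: length_hoch_cyc)
    show "hoch_cyc x ! ?k = hoch_cyc y ! ?k \<oplus>\<^bsub>S\<^esub> hoch_cyc z ! ?k"
      using k l sum by (cases "k = p") (simp_all add: nth_hoch_cyc)
    fix j assume j: "j < length (hoch_cyc x)" "j \<noteq> ?k"
    then have "(if j = 0 then p else j - 1) \<noteq> k" "(if j = 0 then p else j - 1) < length x"
      using l ne by (auto simp: length_hoch_cyc split: if_splits)
    from eq[OF this(2,1)]
    show "hoch_cyc y ! j = hoch_cyc x ! j \<and> hoch_cyc z ! j = hoch_cyc x ! j"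
      using j l ne by (cases "j = 0") (simp_all add: length_hoch_cyc nth_hoch_cyc)
  qed
qed

lemma tensor_op_prepend_one:
  assumes S: "ring S"
  shows "tensor_op S m S (Suc m) (prepend_one S)"
proof -
  have "tensor_op S m S (Suc m) (\<lambda>w. frag_of (\<one>\<^bsub>S\<^esub> # w))"
  proof (rule tensor_op_word[OF S S])
    fix x y z assume w: "x \<in> tensor_words S m" "y \<in> tensor_words S m" "z \<in> tensor_words S m"
      and "letter_sum S x y z"
    then obtain k where l: "length y = length x" "length z = length x" and k: "k < length x"
      and sum: "x ! k = y ! k \<oplus>\<^bsub>S\<^esub> z ! k"
      and eq: "\<And>j. j < length x \<Longrightarrow> j \<noteq> k \<Longrightarrow> y ! j = x ! j \<and> z ! j = x ! j"
      unfolding letter_sum_def by blast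
    show "letter_sum S (\<one>\<^bsub>S\<^esub> # x) (\<one>\<^bsub>S\<^esub> # y) (\<one>\<^bsub>S\<^esub> # z)"
    proof (rule letter_sumI[of _ _ _ "Suc k"])
      fix j assume "j < length (\<one>\<^bsub>S\<^esub> # x)" "j \<noteq> Suc k"
      then show "(\<one>\<^bsub>S\<^esub> # y) ! j = (\<one>\<^bsub>S\<^esub> # x) ! j \<and> (\<one>\<^bsub>S\<^esub> # z) ! j = (\<one>\<^bsub>S\<^esub> # x) ! j"
        using eq[of "j - 1"] by (cases j) simp_all
    qed (use l k sum in simp_all)
  qed (use letter_ring.Cons_one_tensor_words S in \<open>auto simp: letter_ring_def\<close>)
  then show ?thesis by (simp add: prepend_one_def[abs_def])
qed

text \<open>
  Multiplying two neighbouring letters is additive in each of them by distributivity. The letter in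
  which the words differ moves to the position of the product, to the left by one place, or stays,
  according to its position relative to the face.
\<close>

lemma tensor_op_hoch_face:
  assumes S: "ring S"
  shows "tensor_op S (Suc (Suc p)) S (Suc p) (\<lambda>w. frag_of (hoch_face S i w))"
proof (rule tensor_op_word[OF S S])
  interpret letter_ring S using S by (simp add: letter_ring_def)
  show "w \<in> tensor_words S (Suc (Suc p)) \<Longrightarrow> hoch_face S i w \<in> tensor_words S (Suc p)" for w
    by (rule hoch_face_tensor_words)
  fix x y z assume w: "x \<in> tensor_words S (Suc (Suc p))" "y \<in> tensor_words S (Suc (Suc p))"
     "z \<in> tensor_words S (Suc (Suc p))"
    and "letter_sum S x y z"
  then obtain k where k: "k < length x"
    and sum: "x ! k = y ! k \<oplus>\<^bsub>S\<^esub> z ! k"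
    and eq: "\<And>j. j < length x \<Longrightarrow> j \<noteq> k \<Longrightarrow> y ! j = x ! j \<and> z ! j = x ! j"
    unfolding letter_sum_def by blast
  have l: "length x = Suc (Suc p)" "length y = Suc (Suc p)" "length z = Suc (Suc p)"
    using w by (simp_all add: length_tensor_words)
  have c: "x ! j \<in> carrier S" "y ! j \<in> carrier S" "z ! j \<in> carrier S" if "j < Suc (Suc p)" for j
    using w that by (auto simp: tensor_words_def)
  have len: "length (hoch_face S i v) = Suc p" if "length v = Suc (Suc p)" for v
    using that by (simp add: length_hoch_face)
  have i: "x ! i \<in> carrier S" "y ! i \<in> carrier S" "z ! i \<in> carrier S" if "i < Suc (Suc p)"
    using c that by auto
  show "letter_sum S (hoch_face S i x) (hoch_face S i y) (hoch_face S i z)"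
  proof (cases "i < Suc p")
    case True
    let ?k = "if k \<le> i then k else k - 1"
    show ?thesis
    proof (rule letter_sumI[of _ _ _ ?k])
      show "?k < length (hoch_face S i x)" using k True l by (auto simp: len)
      show "hoch_face S i x ! ?k = hoch_face S i y ! ?k \<oplus>\<^bsub>S\<^esub> hoch_face S i z ! ?k"
      proof -
        consider "k < i" | "k = i" | "k = Suc i" | "k > Suc i" by linarith
        then show ?thesis
        proof cases
          case 2
          then show ?thesis
            using True l k sum eq[of "Suc i"] c[of i] c[of "Suc i"] by (simp add: nth_hoch_face l_distr)
        next
          case 3
          then show ?thesis
            using True l k sum eq[of i] c[of i] c[of "Suc i"] by (simp add: nth_hoch_face r_distr)
        next
          case 4
          then obtain k' where "k = Suc k'" by (cases k) auto
          then show ?thesis using 4 True l k sum by (simp add: nth_hoch_face)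
        qed (use True l k sum in \<open>simp_all add: nth_hoch_face\<close>)
      qed
      fix j assume j: "j < length (hoch_face S i x)" "j \<noteq> ?k"
      consider "j < i" | "j = i" | "j > i" by linarith
      then show "hoch_face S i y ! j = hoch_face S i x ! j \<and> hoch_face S i z ! j = hoch_face S i x ! j"
      proof cases
        case 1
        then show ?thesis
          using True l j eq[of j] by (simp add: len nth_hoch_face split: if_splits)
      next
        case 2
        then show ?thesis
          using True l j eq[of i] eq[of "Suc i"] by (simp add: len nth_hoch_face split: if_splits)
      next
        case 3
        then show ?thesis
          using True l j eq[of "Suc j"] by (simp add: len nth_hoch_face split: if_splits)
      qed
    qed (simp_all add: len l)
  next
    case False
    let ?k = "if k = Suc p then 0 else k"
    show ?thesis
    proof (rule letter_sumI[of _ _ _ ?k])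
      show "?k < length (hoch_face S i x)" using k l by (auto simp: len)
      show "hoch_face S i x ! ?k = hoch_face S i y ! ?k \<oplus>\<^bsub>S\<^esub> hoch_face S i z ! ?k"
      proof -
        consider "k = 0" | "k = Suc p" | "0 < k" "k < Suc p" using k l by linarith
        then show ?thesis
        proof cases
          case 1
          then show ?thesis
            using False l k sum eq[of "Suc p"] c[of 0] c[of "Suc p"] by (simp add: nth_hoch_face r_distr)
        next
          case 2
          then show ?thesis
            using False l k sum eq[of 0] c[of 0] c[of "Suc p"] by (simp add: nth_hoch_face l_distr)
        qed (use False l k sum in \<open>simp_all add: nth_hoch_face\<close>)
      qed
      fix j assume j: "j < length (hoch_face S i x)" "j \<noteq> ?k"
      show "hoch_face S i y ! j = hoch_face S i x ! j \<and> hoch_face S i z ! j = hoch_face S i x ! j"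
      proof (cases "j = 0")
        case True
        then show ?thesis
          using False l j eq[of 0] eq[of "Suc p"] by (simp add: len nth_hoch_face split: if_splits)
      next
        case j0: False
        then show ?thesis
          using False l j eq[of j] by (simp add: len nth_hoch_face split: if_splits)
      qed
    qed (simp_all add: len l)
  qed
qed

lemma tensor_op_hoch_b:
  assumes S: "ring S"
  shows "tensor_op S (Suc (Suc p)) S (Suc p) (hoch_b S)"
proof -
  have "tensor_op S (Suc (Suc p)) S (Suc p)
     (\<lambda>w. \<Sum>i<Suc (Suc p). frag_cmul ((- 1) ^ i) (frag_of (hoch_face S i w)))"
    by (intro tensor_op_sum[OF S] tensor_op_cmul[OF S] tensor_op_hoch_face[OF S]) auto
  then show ?thesis
    by (rule tensor_op_cong[OF S]) (simp add: hoch_b_def length_tensor_words del: sum.lessThan_Suc)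
qed

lemma tensor_op_frag_of: "tensor_op S m S m frag_of"
  by (simp add: tensor_op_def)

lemma tensor_op_hoch_B:
  assumes S: "ring S"
  shows "tensor_op S (Suc p) S (Suc (Suc p)) (hoch_B S)"
proof -
  have pow: "tensor_op S (Suc p) S (Suc p) (\<lambda>w. frag_of ((hoch_cyc ^^ j) w))" for j p
  proof (induction j)
    case (Suc j)
    from tensor_op_compose[OF this tensor_op_hoch_cyc[OF S]] show ?case by simp
  qed (simp add: tensor_op_frag_of)
  have "tensor_op S (Suc p) S (Suc p)
     (\<lambda>w. \<Sum>j\<le>p. frag_cmul ((- 1) ^ (p * j)) (frag_of ((hoch_cyc ^^ j) w)))"
    by (intro tensor_op_sum[OF S] tensor_op_cmul[OF S] pow) auto
  then have N: "tensor_op S (Suc p) S (Suc p) cyc_norm"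
    by (rule tensor_op_cong[OF S]) (simp add: cyc_norm_def length_tensor_words)
  have "tensor_op S (Suc (Suc p)) S (Suc (Suc p))
     (\<lambda>w. frag_of w - frag_cmul ((- 1) ^ Suc p) (frag_of (hoch_cyc w)))"
    by (intro tensor_op_diff[OF S] tensor_op_frag_of tensor_op_cmul[OF S] tensor_op_hoch_cyc[OF S])
  then have t: "tensor_op S (Suc (Suc p)) S (Suc (Suc p)) one_minus_t"
    by (rule tensor_op_cong[OF S]) (simp add: one_minus_t_def length_tensor_words)
  have "tensor_op S (Suc p) S (Suc (Suc p))
     (\<lambda>w. frag_extend one_minus_t (frag_extend (prepend_one S) (cyc_norm w)))"
    by (rule tensor_op_compose[OF tensor_op_compose[OF N tensor_op_prepend_one[OF S]] t])
  then show ?thesis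
    by (rule tensor_op_cong[OF S]) (rule hoch_B_eq, auto simp: tensor_words_def)
qed

lemma (in simplicial_ring) tensor_op_simp_d:
  "tensor_op (level R (Suc q)) (Suc p) (level R q) (Suc p) (simp_d R q)"
proof -
  have "tensor_op (level R (Suc q)) (Suc p) (level R q) (Suc p)
    (\<lambda>w. \<Sum>i\<le>Suc q. frag_cmul ((- 1) ^ (p + i)) (word_map (face R q i) w))"
    by (intro tensor_op_sum tensor_op_cmul tensor_op_word_map ring_level face_hom) auto
  then show ?thesis
    by (rule tensor_op_cong[OF ring_level])
      (simp add: simp_d_word_map length_tensor_words del: sum.atMost_Suc)
qed

definition tensor_class :: "'a ring \<Rightarrow> nat \<Rightarrow> ('a list \<Rightarrow>\<^sub>0 int) \<Rightarrow> ('a list \<Rightarrow>\<^sub>0 int) set" where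
  "tensor_class S m c = tensor_rels S m #>\<^bsub>free_Abelian_group (tensor_words S m)\<^esub> c"

lemma carrier_tensor_power:
  "carrier (tensor_power S m) = tensor_class S m ` {c. supported (tensor_words S m) c}"
proof -
  have "carrier (free_Abelian_group (tensor_words S m)) = {c. supported (tensor_words S m) c}"
    by (auto simp: supported_def)
  then show ?thesis
    by (simp add: tensor_power_def carrier_FactGroup tensor_class_def[abs_def])
qed

lemma comm_group_tensor_power: "ring S \<Longrightarrow> comm_group (tensor_power S m)"
  unfolding tensor_power_def
  by (intro comm_group.abelian_FactGroup abelian_free_Abelian_group subgroup_tensor_rels)

lemma tensor_class_mult:
  assumes "ring S" "supported (tensor_words S m) c" "supported (tensor_words S m) d"
  shows "tensor_class S m c \<otimes>\<^bsub>tensor_power S m\<^esub> tensor_class S m d = tensor_class S m (c + d)"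
  using normal.rcos_sum[OF normal_tensor_rels[OF assms(1)], of c m d] assms(2,3)
  by (simp add: tensor_class_def tensor_power_def supported_def)

lemma tensor_class_0: "ring S \<Longrightarrow> tensor_class S m 0 = \<one>\<^bsub>tensor_power S m\<^esub>"
  using group.coset_mult_one[OF group_free_Abelian_group, of "tensor_rels S m" "tensor_words S m"]
    subgroup.subset[OF subgroup_tensor_rels, of S m]
  by (simp add: tensor_class_def tensor_power_def)

lemma tensor_map_class:
  assumes S: "ring S" and T: "ring T" and \<phi>: "tensor_op S m T k \<phi>" and c: "supported (tensor_words S m) c"
  shows "tensor_map T k \<phi> (tensor_class S m c) = tensor_class T k (frag_extend \<phi> c)"
  unfolding tensor_map_def tensor_class_def
proof (rule induced_map_coset[OF _ normal_tensor_rels[OF S] normal_tensor_rels[OF T]])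
  show "frag_extend \<phi> \<in> hom (free_Abelian_group (tensor_words S m)) (free_Abelian_group (tensor_words T k))"
    using tensor_op_supported[OF \<phi>] by (intro homI) (auto simp: supported_def frag_extend_add)
qed (use \<phi> c in \<open>auto simp: tensor_op_def supported_def\<close>)

section \<open>The Hochschild complex as a quotient of formal sums of words\<close>

text \<open>
  A family of formal sums representing a chain of degree \<open>n\<close> in the total complex. The bidegrees are
  quantified as \<open>n = p + q\<close> with natural numbers \<open>p\<close> and \<open>q\<close>, so that neighbouring levels are
  successors instead of truncated integers.
\<close>

definition chain_rep :: "'a simplicial_ring \<Rightarrow> int \<Rightarrow> (nat \<Rightarrow> 'a list \<Rightarrow>\<^sub>0 int) \<Rightarrow> bool" where
  "chain_rep R n c \<longleftrightarrow>
    (\<forall>p q. n = int p + int q \<longrightarrow> supported (tensor_words (level R q) (Suc p)) (c p))"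

definition HH_class ::
  "'a simplicial_ring \<Rightarrow> int \<Rightarrow> (nat \<Rightarrow> 'a list \<Rightarrow>\<^sub>0 int) \<Rightarrow> nat \<Rightarrow> ('a list \<Rightarrow>\<^sub>0 int) set" where
  "HH_class R n c = (\<lambda>p\<in>{p. int p \<le> n}. tensor_class (level R (nat (n - int p))) (Suc p) (c p))"

definition rep_b :: "'a simplicial_ring \<Rightarrow> int \<Rightarrow> (nat \<Rightarrow> 'a list \<Rightarrow>\<^sub>0 int) \<Rightarrow> nat \<Rightarrow> 'a list \<Rightarrow>\<^sub>0 int" where
  "rep_b R n c p = (let q = nat (n - 1 - int p) in
    frag_extend (hoch_b (level R q)) (c (Suc p)) + frag_extend (simp_d R q) (c p))"

definition rep_B :: "'a simplicial_ring \<Rightarrow> int \<Rightarrow> (nat \<Rightarrow> 'a list \<Rightarrow>\<^sub>0 int) \<Rightarrow> nat \<Rightarrow> 'a list \<Rightarrow>\<^sub>0 int" where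
  "rep_B R n c p = (case p of 0 \<Rightarrow> 0
    | Suc p' \<Rightarrow> frag_extend (hoch_B (level R (nat (n - int p')))) (c p'))"

definition rep_map :: "(nat \<Rightarrow> 'a \<Rightarrow> 'b) \<Rightarrow> int \<Rightarrow> (nat \<Rightarrow> 'a list \<Rightarrow>\<^sub>0 int) \<Rightarrow> nat \<Rightarrow> 'b list \<Rightarrow>\<^sub>0 int" where
  "rep_map f n c p = frag_extend (word_map (f (nat (n - int p)))) (c p)"

lemma rep_b_eq: "n = int p + int q + 1 \<Longrightarrow>
    rep_b R n c p = frag_extend (hoch_b (level R q)) (c (Suc p)) + frag_extend (simp_d R q) (c p)"
  by (simp add: rep_b_def)

lemma rep_B_0 [simp]: "rep_B R n c 0 = 0"
  by (simp add: rep_B_def)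

lemma rep_B_Suc: "n = int p + int q \<Longrightarrow> rep_B R n c (Suc p) = frag_extend (hoch_B (level R q)) (c p)"
  by (simp add: rep_B_def)

lemma rep_map_eq: "n = int p + int q \<Longrightarrow> rep_map f n c p = frag_extend (word_map (f q)) (c p)"
  by (simp add: rep_map_def)

lemma rep_b_add: "rep_b R n (\<lambda>p. c p + d p) = (\<lambda>p. rep_b R n c p + rep_b R n d p)"
  by (simp add: fun_eq_iff rep_b_def Let_def frag_extend_add ac_simps)

lemma rep_B_add: "rep_B R n (\<lambda>p. c p + d p) = (\<lambda>p. rep_B R n c p + rep_B R n d p)"
  by (auto simp: fun_eq_iff rep_B_def frag_extend_add split: nat.split)

lemma rep_map_add: "rep_map f n (\<lambda>p. c p + d p) = (\<lambda>p. rep_map f n c p + rep_map f n d p)"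
  by (simp add: fun_eq_iff rep_map_def frag_extend_add)

lemma HH_class_eqI:
  assumes "\<And>p q. n = int p + int q \<Longrightarrow> c p = d p"
  shows "HH_class R n c = HH_class R n d"
  unfolding HH_class_def
proof (rule restrict_ext)
  fix p assume "p \<in> {p. int p \<le> n}"
  then have "n = int p + int (nat (n - int p))" by simp
  then have "c p = d p" by (rule assms)
  then show "tensor_class (level R (nat (n - int p))) (Suc p) (c p) =
    tensor_class (level R (nat (n - int p))) (Suc p) (d p)" by simp
qed

lemma chain_repD:
  "chain_rep R n c \<Longrightarrow> n = int p + int q \<Longrightarrow> supported (tensor_words (level R q) (Suc p)) (c p)"
  by (simp add: chain_rep_def)

lemma add_zero_sums:
  fixes a :: "'x :: ab_group_add"
  assumes "a + a' = 0" "d' + d = 0"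
  shows "a + d + (a' + d') = 0"
proof -
  have "a + d + (a' + d') = (a + a') + (d' + d)" by (simp add: ac_simps)
  then show ?thesis using assms by simp
qed

lemma frag_extend_sum_zero:
  assumes "supported V c" "\<And>x. x \<in> V \<Longrightarrow> frag_extend \<phi> (\<psi> x) + frag_extend \<phi>' (\<psi>' x) = 0"
  shows "frag_extend \<phi> (frag_extend \<psi> c) + frag_extend \<phi>' (frag_extend \<psi>' c) = 0"
proof -
  have "frag_extend \<phi> (frag_extend \<psi> c) + frag_extend \<phi>' (frag_extend \<psi>' c)
    = frag_extend (\<lambda>x. frag_extend \<phi> (\<psi> x) + frag_extend \<phi>' (\<psi>' x)) c"
    by (simp add: frag_extend_frag_extend frag_extend_fun_add)
  also have "\<dots> = frag_extend (\<lambda>x. 0) c"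
    using assms by (rule frag_extend_cong)
  finally show ?thesis by (simp add: frag_extend_eq_0)
qed

lemma frag_extend_zero:
  assumes "supported V c" "\<And>x. x \<in> V \<Longrightarrow> frag_extend \<phi> (\<psi> x) = 0"
  shows "frag_extend \<phi> (frag_extend \<psi> c) = 0"
  using frag_extend_sum_zero[of V c \<phi> \<psi> "\<lambda>_. 0" "\<lambda>_. 0"] assms by (simp add: frag_extend_eq_0)

lemma frag_extend_natural:
  assumes c: "supported V c"
    and nat: "\<And>w. w \<in> V \<Longrightarrow> \<beta>' (map g w) = frag_extend \<mu> (\<beta> w)"
  shows "frag_extend \<beta>' (frag_extend (word_map g) c) = frag_extend \<mu> (frag_extend \<beta> c)"
  unfolding frag_extend_frag_extend
  by (rule frag_extend_cong[OF c]) (simp add: word_map_def nat)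

context simplicial_ring begin

lemma grp_HH: "grp (HH R) n = product_group {p. int p \<le> n}
       (\<lambda>p. tensor_power (level R (nat (n - int p))) (Suc p))"
  by (simp add: HH_def)

lemma diff_HH: "diff (HH R) n x = (\<lambda>p\<in>{p. int p \<le> n - 1}.
    let q = nat (n - 1 - int p); S = level R q in
      tensor_map S (Suc p) (hoch_b S) (x (Suc p))
        \<otimes>\<^bsub>tensor_power S (Suc p)\<^esub> tensor_map S (Suc p) (simp_d R q) (x p))"
  unfolding HH_def chain_complex.simps mixed_complex.simps ..

lemma comm_group_HH: "comm_group (grp (HH R) n)"
  unfolding grp_HH by (intro comm_group_product_group comm_group_tensor_power ring_level)

lemma chain_rep_supported:
  "chain_rep R n c \<Longrightarrow> int p \<le> n \<Longrightarrow> supported (tensor_words (level R (nat (n - int p))) (Suc p)) (c p)"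
  by (rule chain_repD) auto

lemma HH_class_closed: "chain_rep R n c \<Longrightarrow> HH_class R n c \<in> carrier (grp (HH R) n)"
  by (auto simp: grp_HH HH_class_def carrier_tensor_power dest: chain_rep_supported)

lemma HH_cases:
  assumes "x \<in> carrier (grp (HH R) n)"
  obtains c where "chain_rep R n c" "x = HH_class R n c"
proof -
  have "\<exists>d. int p \<le> n \<longrightarrow> supported (tensor_words (level R (nat (n - int p))) (Suc p)) d
     \<and> x p = tensor_class (level R (nat (n - int p))) (Suc p) d" for p
  proof (cases "int p \<le> n")
    case True
    then have "x p \<in> carrier (tensor_power (level R (nat (n - int p))) (Suc p))"
      using assms by (auto simp: grp_HH)
    then show ?thesis unfolding carrier_tensor_power by blast
  qed simp
  then obtain c where c: "\<And>p. int p \<le> n \<longrightarrow> supported (tensor_words (level R (nat (n - int p))) (Suc p)) (c p)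
     \<and> x p = tensor_class (level R (nat (n - int p))) (Suc p) (c p)"
    by metis
  show thesis
  proof
    show "chain_rep R n c"
      unfolding chain_rep_def
    proof (intro allI impI)
      fix p q assume "n = int p + int q"
      then show "supported (tensor_words (level R q) (Suc p)) (c p)" using c[of p] by simp
    qed
    have "x \<in> extensional {p. int p \<le> n}" using assms by (auto simp: grp_HH PiE_def)
    then show "x = HH_class R n c"
      unfolding HH_class_def by (intro extensionalityI[of _ "{p. int p \<le> n}"]) (use c in auto)
  qed
qed

lemma HH_class_mult:
  assumes "chain_rep R n c" "chain_rep R n d"
  shows "HH_class R n c \<otimes>\<^bsub>grp (HH R) n\<^esub> HH_class R n d = HH_class R n (\<lambda>p. c p + d p)"
  using assms
  by (auto simp: grp_HH HH_class_def chain_rep_supported tensor_class_mult ring_level intro!: restrict_ext)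

lemma HH_class_0: "HH_class R n (\<lambda>_. 0) = \<one>\<^bsub>grp (HH R) n\<^esub>"
  by (auto simp: grp_HH HH_class_def tensor_class_0 ring_level intro!: restrict_ext)

lemma HH_class_eq_one: "(\<And>p q. n = int p + int q \<Longrightarrow> c p = 0) \<Longrightarrow> HH_class R n c = \<one>\<^bsub>grp (HH R) n\<^esub>"
  unfolding HH_class_0[symmetric] by (rule HH_class_eqI) auto

lemma chain_rep_add: "chain_rep R n c \<Longrightarrow> chain_rep R n d \<Longrightarrow> chain_rep R n (\<lambda>p. c p + d p)"
  by (auto simp: chain_rep_def intro: supported_add)

lemma chain_rep_b:
  assumes c: "chain_rep R n c"
  shows "chain_rep R (n - 1) (rep_b R n c)"
  unfolding chain_rep_def
proof (intro allI impI)
  fix p q assume "n - 1 = int p + int q"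
  then have n: "n = int p + int q + 1" "n = int (Suc p) + int q" "n = int p + int (Suc q)" by auto
  show "supported (tensor_words (level R q) (Suc p)) (rep_b R n c p)"
    unfolding rep_b_eq[OF n(1)]
    by (intro supported_add supported_frag_extend[OF chain_repD[OF c n(2)]]
        supported_frag_extend[OF chain_repD[OF c n(3)]] supported_hoch_b ring_level supported_simp_d)
qed

lemma chain_rep_B:
  assumes c: "chain_rep R n c"
  shows "chain_rep R (n + 1) (rep_B R n c)"
  unfolding chain_rep_def
proof (intro allI impI)
  fix p q assume n: "n + 1 = int p + int q"
  show "supported (tensor_words (level R q) (Suc p)) (rep_B R n c p)"
  proof (cases p)
    case (Suc p')
    then have n': "n = int p' + int q" using n by simp
    show ?thesis
      unfolding Suc rep_B_Suc[OF n']
      by (intro supported_frag_extend[OF chain_repD[OF c n']] supported_hoch_B ring_level)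
  qed simp
qed

lemma diff_HH_class:
  assumes c: "chain_rep R n c"
  shows "diff (HH R) n (HH_class R n c) = HH_class R (n - 1) (rep_b R n c)"
  unfolding HH_class_def[of R "n - 1"] diff_HH
proof (rule restrict_ext)
  fix p assume "p \<in> {p. int p \<le> n - 1}"
  define q where "q = nat (n - 1 - int p)"
  have n: "n = int p + int q + 1" "n = int (Suc p) + int q" "n = int p + int (Suc q)"
    using \<open>p \<in> _\<close> by (auto simp: q_def)
  have 1: "HH_class R n c (Suc p) = tensor_class (level R q) (Suc (Suc p)) (c (Suc p))"
    using n(2) by (simp add: HH_class_def)
  have "nat (int p + int (Suc q) - int p) = Suc q" by simp
  then have 2: "HH_class R n c p = tensor_class (level R (Suc q)) (Suc p) (c p)"
    using n(3) by (simp add: HH_class_def)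
  note c1 = chain_repD[OF c n(2)] and c2 = chain_repD[OF c n(3)]
  show "(let q = nat (n - 1 - int p); S = level R q in
         tensor_map S (Suc p) (hoch_b S) (HH_class R n c (Suc p))
           \<otimes>\<^bsub>tensor_power S (Suc p)\<^esub> tensor_map S (Suc p) (simp_d R q) (HH_class R n c p))
      = tensor_class (level R (nat (n - 1 - int p))) (Suc p) (rep_b R n c p)"
    unfolding Let_def q_def[symmetric] 1 2 rep_b_eq[OF n(1)]
      tensor_map_class[OF ring_level ring_level tensor_op_hoch_b[OF ring_level] c1]
      tensor_map_class[OF ring_level ring_level tensor_op_simp_d c2]
    by (rule tensor_class_mult[OF ring_level])
      (rule tensor_op_supported[OF tensor_op_hoch_b[OF ring_level] c1] tensor_op_supported[OF tensor_op_simp_d c2])+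
qed

lemma conn_HH_class:
  assumes c: "chain_rep R n c"
  shows "conn (HH R) n (HH_class R n c) = HH_class R (n + 1) (rep_B R n c)"
proof
  fix p
  show "conn (HH R) n (HH_class R n c) p = HH_class R (n + 1) (rep_B R n c) p"
  proof (cases "int p \<le> n + 1")
    case True
    show ?thesis
    proof (cases p)
      case 0
      then show ?thesis using True
        by (simp add: HH_def HH_class_def[of R "n + 1"] Let_def tensor_class_0[OF ring_level])
    next
      case (Suc p')
      define q where "q = nat (n - int p')"
      have n: "n = int p' + int q" using True Suc by (auto simp: q_def)
      have q: "nat (n + 1 - int (Suc p')) = q" by (simp add: q_def)
      have 1: "HH_class R n c p' = tensor_class (level R q) (Suc p') (c p')"
        using n by (simp add: HH_class_def)
      have "conn (HH R) n (HH_class R n c) p = tensor_map (level R q) (Suc (Suc p')) (hoch_B (level R q)) (HH_class R n c p')"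
        using True unfolding Suc by (simp add: HH_def Let_def q_def)
      also have "\<dots> = tensor_class (level R q) (Suc (Suc p')) (rep_B R n c (Suc p'))"
        unfolding 1 rep_B_Suc[OF n]
        by (rule tensor_map_class[OF ring_level ring_level tensor_op_hoch_B[OF ring_level] chain_repD[OF c n]])
      also have "\<dots> = HH_class R (n + 1) (rep_B R n c) p"
        using True unfolding Suc HH_class_def q[symmetric] by simp
      finally show ?thesis .
    qed
  qed (simp add: HH_def HH_class_def)
qed

text \<open>
  The three terms of the square are \<open>b b\<close>, the anticommutator of \<open>b\<close> with the simplicial
  differential, and the square of the latter, applied to three neighbouring bidegrees.
\<close>

lemma rep_b_rep_b:
  assumes c: "chain_rep R n c" and n: "n = int p + int q + 2"
  shows "rep_b R (n - 1) (rep_b R n c) p = 0"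
proof -
  have e: "n - 1 = int p + int q + 1" "n = int (Suc p) + int q + 1" "n = int p + int (Suc q) + 1"
    "n = int (Suc (Suc p)) + int q" "n = int (Suc p) + int (Suc q)" "n = int p + int (Suc (Suc q))"
    using n by auto
  note r = ring_level[of q]
  have bb: "frag_extend (hoch_b (level R q)) (frag_extend (hoch_b (level R q)) (c (Suc (Suc p)))) = 0"
    by (rule frag_extend_zero[OF chain_repD[OF c e(4)]]) (rule hoch_b_hoch_b[OF r])
  have bd: "frag_extend (hoch_b (level R q)) (frag_extend (simp_d R q) (c (Suc p)))
    + frag_extend (simp_d R q) (frag_extend (hoch_b (level R (Suc q))) (c (Suc p))) = 0"
    by (rule frag_extend_sum_zero[OF chain_repD[OF c e(5)]]) (rule hoch_b_simp_d)
  have dd: "frag_extend (simp_d R q) (frag_extend (simp_d R (Suc q)) (c p)) = 0"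
    by (rule frag_extend_zero[OF chain_repD[OF c e(6)]]) (rule simp_d_simp_d)
  show ?thesis
    unfolding rep_b_eq[OF e(1)] rep_b_eq[OF e(2)] rep_b_eq[OF e(3)] frag_extend_add bb dd
    using bd by simp
qed

lemma rep_B_rep_B:
  assumes c: "chain_rep R n c" and n: "n + 2 = int p + int q"
  shows "rep_B R (n + 1) (rep_B R n c) p = 0"
proof (cases p)
  case (Suc p')
  show ?thesis
  proof (cases p')
    case 0
    then show ?thesis by (simp add: Suc rep_B_def)
  next
    case (Suc p'')
    have e: "n + 1 = int (Suc p'') + int q" "n = int p'' + int q"
      using n \<open>p = Suc p'\<close> Suc by auto
    show ?thesis
      unfolding \<open>p = Suc p'\<close> Suc rep_B_Suc[OF e(1)] rep_B_Suc[OF e(2)]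
      by (rule frag_extend_zero[OF chain_repD[OF c e(2)]]) (rule hoch_B_hoch_B[OF ring_level])
  qed
qed simp

text \<open>
  The terms with \<open>b\<close> and those with the simplicial differential cancel separately. In bidegree \<open>p =
  0\<close> only \<open>b B\<close> occurs.
\<close>

lemma rep_b_rep_B:
  assumes c: "chain_rep R n c" and n: "n = int p + int q"
  shows "rep_b R (n + 1) (rep_B R n c) p + rep_B R (n - 1) (rep_b R n c) p = 0"
proof -
  have e1: "n + 1 = int p + int q + 1" using n by simp
  note r = ring_level[of q]
  show ?thesis
  proof (cases p)
    case 0
    have "frag_extend (hoch_b (level R q)) (frag_extend (hoch_B (level R q)) (c 0)) = 0"
      by (rule frag_extend_zero[OF chain_repD[OF c n[unfolded 0]]])
        (rule hoch_b_hoch_B_zero[OF r], simp)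
    then show ?thesis
      unfolding rep_b_eq[OF e1] rep_B_Suc[OF n] by (simp add: 0)
  next
    case (Suc p')
    have e: "n - 1 = int p' + int q" "n = int p' + int (Suc q)" "n = int p' + int q + 1"
      using n Suc by auto
    have "frag_extend (hoch_b (level R q)) (frag_extend (hoch_B (level R q)) (c p))
        + frag_extend (hoch_B (level R q)) (frag_extend (hoch_b (level R q)) (c p)) = 0"
      by (rule frag_extend_sum_zero[OF chain_repD[OF c n]]) (rule hoch_b_hoch_B[OF r, of _ p'], simp add: Suc)
    moreover have "frag_extend (hoch_B (level R q)) (frag_extend (simp_d R q) (c p'))
      + frag_extend (simp_d R q) (frag_extend (hoch_B (level R (Suc q))) (c p')) = 0"
      by (rule frag_extend_sum_zero[OF chain_repD[OF c e(2)]]) (rule hoch_B_simp_d)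
    ultimately show ?thesis
      unfolding rep_b_eq[OF e1] rep_B_Suc[OF n] unfolding Suc rep_B_Suc[OF e(1)] rep_B_Suc[OF e(2)]
        rep_b_eq[OF e(3)] frag_extend_add
      by (rule add_zero_sums)
  qed
qed

text \<open>
  Every chain has a representative, on which differential and operator are computed by formal sums
  of words; the required identities hold there exactly.
\<close>

lemma group_mixed_HH: "group_mixed (HH R) (conn (HH R))"
proof (intro group_mixed.intro group_complex.intro group_mixed_axioms.intro)
  fix n
  show "comm_group (grp (HH R) n)" by (rule comm_group_HH)
  show "diff (HH R) n \<in> hom (grp (HH R) n) (grp (HH R) (n - 1))"
  proof (rule homI)
    fix x assume "x \<in> carrier (grp (HH R) n)"
    then obtain c where c: "chain_rep R n c" "x = HH_class R n c" by (rule HH_cases)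
    show "diff (HH R) n x \<in> carrier (grp (HH R) (n - 1))"
      unfolding c(2) diff_HH_class[OF c(1)] by (rule HH_class_closed[OF chain_rep_b[OF c(1)]])
    fix y assume "y \<in> carrier (grp (HH R) n)"
    then obtain d where d: "chain_rep R n d" "y = HH_class R n d" by (rule HH_cases)
    show "diff (HH R) n (x \<otimes>\<^bsub>grp (HH R) n\<^esub> y) = diff (HH R) n x \<otimes>\<^bsub>grp (HH R) (n - 1)\<^esub> diff (HH R) n y"
      unfolding c(2) d(2) HH_class_mult[OF c(1) d(1)] diff_HH_class[OF c(1)] diff_HH_class[OF d(1)]
        diff_HH_class[OF chain_rep_add[OF c(1) d(1)]]
        HH_class_mult[OF chain_rep_b[OF c(1)] chain_rep_b[OF d(1)]] rep_b_add ..
  qed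
  show "conn (HH R) n \<in> hom (grp (HH R) n) (grp (HH R) (n + 1))"
  proof (rule homI)
    fix x assume "x \<in> carrier (grp (HH R) n)"
    then obtain c where c: "chain_rep R n c" "x = HH_class R n c" by (rule HH_cases)
    show "conn (HH R) n x \<in> carrier (grp (HH R) (n + 1))"
      unfolding c(2) conn_HH_class[OF c(1)] by (rule HH_class_closed[OF chain_rep_B[OF c(1)]])
    fix y assume "y \<in> carrier (grp (HH R) n)"
    then obtain d where d: "chain_rep R n d" "y = HH_class R n d" by (rule HH_cases)
    show "conn (HH R) n (x \<otimes>\<^bsub>grp (HH R) n\<^esub> y) = conn (HH R) n x \<otimes>\<^bsub>grp (HH R) (n + 1)\<^esub> conn (HH R) n y"
      unfolding c(2) d(2) HH_class_mult[OF c(1) d(1)] conn_HH_class[OF c(1)] conn_HH_class[OF d(1)]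
        conn_HH_class[OF chain_rep_add[OF c(1) d(1)]]
        HH_class_mult[OF chain_rep_B[OF c(1)] chain_rep_B[OF d(1)]] rep_B_add ..
  qed
next
  fix n x assume "x \<in> carrier (grp (HH R) (n + 1))"
  then obtain c where c: "chain_rep R (n + 1) c" "x = HH_class R (n + 1) c" by (rule HH_cases)
  have 1: "diff (HH R) (n + 1) x = HH_class R n (rep_b R (n + 1) c)" and 2: "chain_rep R n (rep_b R (n + 1) c)"
    using diff_HH_class[OF c(1)] chain_rep_b[OF c(1)] by (simp_all add: c(2))
  show "diff (HH R) n (diff (HH R) (n + 1) x) = \<one>\<^bsub>grp (HH R) (n - 1)\<^esub>"
    unfolding 1 diff_HH_class[OF 2]
  proof (rule HH_class_eq_one)
    fix p q assume "n - 1 = int p + int q"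
    then have "n + 1 = int p + int q + 2" by simp
    from rep_b_rep_b[OF c(1) this] show "rep_b R n (rep_b R (n + 1) c) p = 0"
      by (simp only: add_diff_cancel_right')
  qed
next
  fix n x assume "x \<in> carrier (grp (HH R) n)"
  then obtain c where c: "chain_rep R n c" "x = HH_class R n c" by (rule HH_cases)
  have e: "n + 1 + 1 = n + 2" "n - 1 + 1 = n" "n + 1 - 1 = n" by simp_all
  show "conn (HH R) (n + 1) (conn (HH R) n x) = \<one>\<^bsub>grp (HH R) (n + 2)\<^esub>"
    unfolding c(2) conn_HH_class[OF c(1)] conn_HH_class[OF chain_rep_B[OF c(1)]] e
    by (rule HH_class_eq_one) (rule rep_B_rep_B[OF c(1)])
  note b = chain_rep_b[OF c(1)] and B = chain_rep_B[OF c(1)]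
  have "HH_class R n (rep_b R (n + 1) (rep_B R n c)) \<otimes>\<^bsub>grp (HH R) n\<^esub> HH_class R n (rep_B R (n - 1) (rep_b R n c))
    = \<one>\<^bsub>grp (HH R) n\<^esub>"
    unfolding HH_class_mult[OF chain_rep_b[OF B, unfolded e] chain_rep_B[OF b, unfolded e]]
    by (rule HH_class_eq_one) (rule rep_b_rep_B[OF c(1)])
  then show "diff (HH R) (n + 1) (conn (HH R) n x) \<otimes>\<^bsub>grp (HH R) n\<^esub> conn (HH R) (n - 1) (diff (HH R) n x)
    = \<one>\<^bsub>grp (HH R) n\<^esub>"
    unfolding c(2) conn_HH_class[OF c(1)] diff_HH_class[OF c(1)] conn_HH_class[OF b] diff_HH_class[OF B] e .
qed

end

context simplicial_ring_map begin

lemma chain_rep_map: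
  assumes c: "chain_rep R n c"
  shows "chain_rep R' n (rep_map f n c)"
  unfolding chain_rep_def
proof (intro allI impI)
  fix p q assume n: "n = int p + int q"
  show "supported (tensor_words (level R' q) (Suc p)) (rep_map f n c p)"
    unfolding rep_map_eq[OF n]
    by (intro supported_frag_extend[OF chain_repD[OF c n]] supported_word_map[OF map_hom])
qed

lemma HH_map_class:
  assumes c: "chain_rep R n c"
  shows "HH_map R' f n (HH_class R n c) = HH_class R' n (rep_map f n c)"
  unfolding HH_class_def[of R'] HH_map_def
proof (rule restrict_ext)
  fix p assume p: "p \<in> {p. int p \<le> n}"
  define q where "q = nat (n - int p)"
  have n: "n = int p + int q" using p by (simp add: q_def)
  have 1: "HH_class R n c p = tensor_class (level R q) (Suc p) (c p)"
    using n by (simp add: HH_class_def)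
  show "(let q = nat (n - int p) in
      tensor_map (level R' q) (Suc p) (\<lambda>w. frag_of (map (f q) w)) (HH_class R n c p))
     = tensor_class (level R' (nat (n - int p))) (Suc p) (rep_map f n c p)"
    unfolding Let_def q_def[symmetric] 1 rep_map_eq[OF n] word_map_def[symmetric]
    by (rule tensor_map_class[OF source.ring_level target.ring_level
          tensor_op_word_map[OF source.ring_level target.ring_level map_hom] chain_repD[OF c n]])
qed

lemma rep_b_map:
  assumes c: "chain_rep R n c" and n: "n - 1 = int p + int q"
  shows "rep_b R' n (rep_map f n c) p = rep_map f (n - 1) (rep_b R n c) p"
proof -
  have e: "n = int p + int q + 1" "n = int (Suc p) + int q" "n = int p + int (Suc q)" using n by auto
  show ?thesis
    unfolding rep_b_eq[OF e(1)] rep_map_eq[OF e(2)] rep_map_eq[OF e(3)] rep_map_eq[OF n] frag_extend_add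
    by (rule arg_cong2[of _ _ _ _ "(+)"]; rule frag_extend_natural)
      (rule chain_repD[OF c e(2)], erule hoch_b_map[OF map_hom],
        rule chain_repD[OF c e(3)], erule simp_d_map)
qed

lemma rep_B_map:
  assumes c: "chain_rep R n c" and n: "n + 1 = int p + int q"
  shows "rep_B R' n (rep_map f n c) p = rep_map f (n + 1) (rep_B R n c) p"
proof (cases p)
  case 0
  then show ?thesis by (simp add: rep_map_def)
next
  case (Suc p')
  then have e: "n = int p' + int q" "n + 1 = int (Suc p') + int q" using n by auto
  show ?thesis
    unfolding Suc rep_B_Suc[OF e(1)] rep_map_eq[OF e(2)] rep_map_eq[OF e(1)]
    by (rule frag_extend_natural[OF chain_repD[OF c e(1)]]) (rule hoch_B_map[OF map_hom])
qed

lemma mixed_map_HH: "mixed_map (HH R) (HH R') (HH_map R' f)"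
proof (intro mixed_map.intro complex_map.intro complex_map_axioms.intro mixed_map_axioms.intro
    group_mixed.axioms(1)[OF source.group_mixed_HH] group_mixed.axioms(1)[OF target.group_mixed_HH]
    source.group_mixed_HH target.group_mixed_HH)
  fix n
  show "HH_map R' f n \<in> hom (grp (HH R) n) (grp (HH R') n)"
  proof (rule homI)
    fix x assume "x \<in> carrier (grp (HH R) n)"
    then obtain c where c: "chain_rep R n c" "x = HH_class R n c" by (rule source.HH_cases)
    show "HH_map R' f n x \<in> carrier (grp (HH R') n)"
      unfolding c(2) HH_map_class[OF c(1)] by (rule target.HH_class_closed[OF chain_rep_map[OF c(1)]])
    fix y assume "y \<in> carrier (grp (HH R) n)"
    then obtain d where d: "chain_rep R n d" "y = HH_class R n d" by (rule source.HH_cases)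
    show "HH_map R' f n (x \<otimes>\<^bsub>grp (HH R) n\<^esub> y) = HH_map R' f n x \<otimes>\<^bsub>grp (HH R') n\<^esub> HH_map R' f n y"
      unfolding c(2) d(2) source.HH_class_mult[OF c(1) d(1)] HH_map_class[OF c(1)] HH_map_class[OF d(1)]
        HH_map_class[OF source.chain_rep_add[OF c(1) d(1)]]
        target.HH_class_mult[OF chain_rep_map[OF c(1)] chain_rep_map[OF d(1)]] rep_map_add ..
  qed
next
  fix n x assume "x \<in> carrier (grp (HH R) n)"
  then obtain c where c: "chain_rep R n c" "x = HH_class R n c" by (rule source.HH_cases)
  show "diff (HH R') n (HH_map R' f n x) = HH_map R' f (n - 1) (diff (HH R) n x)"
    unfolding c(2) source.diff_HH_class[OF c(1)] HH_map_class[OF c(1)]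
      HH_map_class[OF source.chain_rep_b[OF c(1)]] target.diff_HH_class[OF chain_rep_map[OF c(1)]]
    by (rule HH_class_eqI) (rule rep_b_map[OF c(1)])
  show "conn (HH R') n (HH_map R' f n x) = HH_map R' f (n + 1) (conn (HH R) n x)"
    unfolding c(2) source.conn_HH_class[OF c(1)] HH_map_class[OF c(1)]
      HH_map_class[OF source.chain_rep_B[OF c(1)]] target.conn_HH_class[OF chain_rep_map[OF c(1)]]
    by (rule HH_class_eqI) (rule rep_B_map[OF c(1)])
qed

end

theorem proposition1p8:
  fixes R :: "'a simplicial_ring" and R' :: "'b simplicial_ring" and f :: "nat \<Rightarrow> 'a \<Rightarrow> 'b"
  assumes "simplicial_ring_map R R' f"
    and "de_Rham_equivalence R R' f"
  shows "\<forall>n :: int.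
      group_hom (HCm_rel R R' f n) (HH_rel R R' f n) (F_rel R R' f n)
    \<and> group_hom (HH_rel R R' f n) (HH_rel R R' f (n + 1)) (B_rel R R' f n)
    \<and> inj_on (F_rel R R' f n) (carrier (HCm_rel R R' f n))
    \<and> F_rel R R' f n ` carrier (HCm_rel R R' f n) = ker_B_rel R R' f n
    \<and> F_rel R R' f n
        \<in> iso (HCm_rel R R' f n) ((HH_rel R R' f n)\<lparr>carrier := ker_B_rel R R' f n\<rparr>)"
proof
  fix n :: int
  interpret simplicial_ring_map R R' f by fact
  interpret mixed_map "HH R" "HH R'" "HH_map R' f" by (rule mixed_map_HH)
  have HH: "HH_rel R R' f = homology L" and HC: "HCm_rel R R' f = homology K"
    by (simp_all add: fun_eq_iff HH_rel_def HH_fiber_def HCm_rel_def HCm_fiber_def)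
  have B: "B_rel R R' f m = homology_map L (m + 1) (fiber_conn (HH R) (HH R') m)" for m
    by (simp add: B_rel_def HH_fiber_def)
  have F: "F_rel R R' f n = homology_map L n (fiber_coeff 0)"
    by (simp add: F_rel_def HH_fiber_def fiber_coeff_def)
  have acyclic: "B_acyclic_mixed L (fiber_conn (HH R) (HH R'))"
  proof (rule L.B_acyclic_mixedI)
    fix m
    have "trivial_group (de_Rham_homology_rel R R' f m)"
      using assms(2) by (simp add: de_Rham_equivalence_def)
    then show "trivial_group ((homology L m)\<lparr>carrier :=
        kernel (homology L m) (homology L (m + 1)) (homology_map L (m + 1) (fiber_conn (HH R) (HH R') m))\<rparr>
      Mod (homology_map L (m - 1 + 1) (fiber_conn (HH R) (HH R') (m - 1)) ` carrier (homology L (m - 1))))"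
      unfolding de_Rham_homology_rel_def HH B .
  qed
  interpret F: group_hom "homology K n" "homology L n" "F_rel R R' f n"
    unfolding F by (rule F_group_hom)
  have B_hom: "group_hom (homology L n) (homology L (n + 1)) (B_rel R R' f n)"
    unfolding B by (rule L.group_hom_homology_B)
  have inj: "inj_on (F_rel R R' f n) (carrier (homology K n))"
    unfolding F by (rule neg_cyclic_fiber_iso_kernel(1)[OF acyclic])
  have img: "F_rel R R' f n ` carrier (homology K n) = ker_B_rel R R' f n"
    unfolding F HH B by (rule neg_cyclic_fiber_iso_kernel(2)[OF acyclic])
  have "F_rel R R' f n \<in> iso (homology K n) ((homology L n)\<lparr>carrier := ker_B_rel R R' f n\<rparr>)"
    using inj img by (auto simp: iso_def bij_betw_def intro!: homI)
  then show "group_hom (HCm_rel R R' f n) (HH_rel R R' f n) (F_rel R R' f n)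
    \<and> group_hom (HH_rel R R' f n) (HH_rel R R' f (n + 1)) (B_rel R R' f n)
    \<and> inj_on (F_rel R R' f n) (carrier (HCm_rel R R' f n))
    \<and> F_rel R R' f n ` carrier (HCm_rel R R' f n) = ker_B_rel R R' f n
    \<and> F_rel R R' f n
        \<in> iso (HCm_rel R R' f n) ((HH_rel R R' f n)\<lparr>carrier := ker_B_rel R R' f n\<rparr>)"
    using F.group_hom_axioms B_hom inj img unfolding HH HC by blast
qed

end
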